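(* Let $(M,g)$ be a complete Riemannian manifold of dimension $n\geq 2$ and $f:M\to\mathbb{R}$ a smooth function such that $(M,g,f)$ is $CD(0,1)$. Fix a point $p\in M$ and let $r$ be the distance function to $p$. Let $q$ be a point such that $r$ is smooth at $q$, and let $\gamma(t)$ be the unique minimal geodesic from $p$ to $q$, parametrized by arc-length with $\gamma(0)=p$. Then $$(\Delta_f r)(q)\le\frac{n-1}{v^2(q)\int_0^{r(q)}v^{-2}(\gamma(t))\,dt},$$ where $v=e^{\frac{f}{n-1}}$.
   Context: Manifolds are smooth and connected. For an $n$-dimensional Riemannian manifold $(M,g)$ with $n\geq2$ and a smooth function $f:M\to\mathbb{R}$, put $$\mathrm{Ric}_f^1=\mathrm{Ric}+\mathrm{Hess} f+\frac{df\otimes df}{n-1}.$$ $(M,g,f)$ is $CD(0,1)$ if $\mathrm{Ric}_f^1\ge 0$. The weighted Laplacian is $\Delta_f=\Delta-D_{\nabla f}$, i.e. $\Delta_f h=\Delta h-g(\nabla f,\nabla h)$ with $\Delta=\mathrm{tr}\,\mathrm{Hess}$. *)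

theory Defs
  imports "HOL-Analysis.Analysis"
begin

section \<open>Smooth maps between open subsets of Euclidean spaces\<close>

definition dir_deriv :: "('a::euclidean_space \<Rightarrow> 'b::real_normed_vector) \<Rightarrow> 'a \<Rightarrow> 'a \<Rightarrow> 'b" where
  "dir_deriv F x v = frechet_derivative F (at x) v"

text \<open>Only used for open sets \<open>S\<close>.\<close>

primrec Ck_on :: "nat \<Rightarrow> 'a::euclidean_space set \<Rightarrow> ('a \<Rightarrow> 'b::real_normed_vector) \<Rightarrow> bool" where
  "Ck_on 0 S F \<longleftrightarrow> continuous_on S F"
| "Ck_on (Suc k) S F \<longleftrightarrow>
     (\<forall>x\<in>S. F differentiable (at x)) \<and> (\<forall>v. Ck_on k S (\<lambda>x. dir_deriv F x v))"

definition smooth_on :: "'a::euclidean_space set \<Rightarrow> ('a \<Rightarrow> 'b::real_normed_vector) \<Rightarrow> bool" where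
  "smooth_on S F \<longleftrightarrow> (\<forall>k. Ck_on k S F)"


section \<open>Smooth manifolds\<close>

text \<open>
  The manifold is the whole type \<open>'a\<close> (a second countable Hausdorff space), its dimension is
  \<open>DIM('e)\<close>. A chart is a pair of an open domain and a coordinate map; the values of the
  coordinate map outside the domain are irrelevant. Atlases need not be maximal.
\<close>

type_synonym ('a, 'e) chart = "'a set \<times> ('a \<Rightarrow> 'e)"

definition chart_inv :: "('a, 'e) chart \<Rightarrow> 'e \<Rightarrow> 'a" where
  "chart_inv c = inv_into (fst c) (snd c)"

definition is_chart ::
  "('a::{t2_space,second_countable_topology}, 'e::euclidean_space) chart \<Rightarrow> bool" where
  "is_chart c \<longleftrightarrow> open (fst c) \<and> open (snd c ` fst c) \<and>
     homeomorphism (fst c) (snd c ` fst c) (snd c) (chart_inv c)"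

definition smooth_atlas ::
  "('a::{t2_space,second_countable_topology}, 'e::euclidean_space) chart set \<Rightarrow> bool" where
  "smooth_atlas A \<longleftrightarrow> (\<forall>c\<in>A. is_chart c) \<and> (\<Union>c\<in>A. fst c) = UNIV \<and>
     (\<forall>c\<in>A. \<forall>d\<in>A. smooth_on (snd c ` (fst c \<inter> fst d)) (snd d \<circ> chart_inv c))"

definition smooth_fun_on ::
  "('a::{t2_space,second_countable_topology}, 'e::euclidean_space) chart set
     \<Rightarrow> 'a set \<Rightarrow> ('a \<Rightarrow> real) \<Rightarrow> bool" where
  "smooth_fun_on A W h \<longleftrightarrow> (\<forall>c\<in>A. smooth_on (snd c ` (fst c \<inter> W)) (h \<circ> chart_inv c))"

definition smooth_at ::
  "('a::{t2_space,second_countable_topology}, 'e::euclidean_space) chart set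
     \<Rightarrow> ('a \<Rightarrow> real) \<Rightarrow> 'a \<Rightarrow> bool" where
  "smooth_at A h m \<longleftrightarrow> (\<exists>W. open W \<and> m \<in> W \<and> smooth_fun_on A W h)"

text \<open>
  A tangent vector at \<open>m\<close> is the derivation that it induces on the functions that are smooth near
  \<open>m\<close>, extended by \<open>0\<close> to all other functions. In this way it does not depend on a chart:
  \<open>tangent_vec A c m v\<close> is the tangent vector \<open>\<Sum>\<^sub>i v\<^sup>i \<partial>\<^sub>i\<close> of the chart \<open>c\<close>.
\<close>

type_synonym 'a derivation = "('a \<Rightarrow> real) \<Rightarrow> real"

definition tangent_vec ::
  "('a::{t2_space,second_countable_topology}, 'e::euclidean_space) chart set
     \<Rightarrow> ('a, 'e) chart \<Rightarrow> 'a \<Rightarrow> 'e \<Rightarrow> 'a derivation" where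
  "tangent_vec A c m v =
     (\<lambda>h. if smooth_at A h m then dir_deriv (h \<circ> chart_inv c) (snd c m) v else 0)"

definition tangent_space ::
  "('a::{t2_space,second_countable_topology}, 'e::euclidean_space) chart set
     \<Rightarrow> 'a \<Rightarrow> 'a derivation set" where
  "tangent_space A m = {tangent_vec A c m v | c v. c \<in> A \<and> m \<in> fst c}"

definition velocity ::
  "('a::{t2_space,second_countable_topology}, 'e::euclidean_space) chart set
     \<Rightarrow> (real \<Rightarrow> 'a) \<Rightarrow> real \<Rightarrow> 'a derivation" where
  "velocity A \<gamma> t =
     (\<lambda>h. if smooth_at A h (\<gamma> t) then vector_derivative (h \<circ> \<gamma>) (at t) else 0)"


section \<open>Riemannian metrics\<close>

type_synonym 'a metric = "'a \<Rightarrow> 'a derivation \<Rightarrow> 'a derivation \<Rightarrow> real"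

text \<open>The coordinate expression of a metric at the coordinate point \<open>x\<close>.\<close>

definition local_metric ::
  "('a::{t2_space,second_countable_topology}, 'e::euclidean_space) chart set \<Rightarrow> 'a metric
     \<Rightarrow> ('a, 'e) chart \<Rightarrow> 'e \<Rightarrow> 'e \<Rightarrow> 'e \<Rightarrow> real" where
  "local_metric A g c x v w =
     g (chart_inv c x) (tangent_vec A c (chart_inv c x) v) (tangent_vec A c (chart_inv c x) w)"

definition riemannian_metric ::
  "('a::{t2_space,second_countable_topology}, 'e::euclidean_space) chart set
     \<Rightarrow> 'a metric \<Rightarrow> bool" where
  "riemannian_metric A g \<longleftrightarrow>
     (\<forall>m. \<forall>X\<in>tangent_space A m. \<forall>Y\<in>tangent_space A m. g m X Y = g m Y X) \<and>
     (\<forall>m. \<forall>X\<in>tangent_space A m. \<forall>Y\<in>tangent_space A m. \<forall>Z\<in>tangent_space A m. \<forall>a b.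
        g m (\<lambda>h. a * X h + b * Y h) Z = a * g m X Z + b * g m Y Z) \<and>
     (\<forall>m. \<forall>X\<in>tangent_space A m. X \<noteq> (\<lambda>h. 0) \<longrightarrow> g m X X > 0) \<and>
     (\<forall>c\<in>A. \<forall>v w. smooth_on (snd c ` fst c) (\<lambda>x. local_metric A g c x v w))"

definition riemannian_manifold ::
  "('a::{t2_space,second_countable_topology}, 'e::euclidean_space) chart set
     \<Rightarrow> 'a metric \<Rightarrow> bool" where
  "riemannian_manifold A g \<longleftrightarrow>
     connected (UNIV :: 'a set) \<and> smooth_atlas A \<and> riemannian_metric A g"


section \<open>Length, distance and completeness\<close>

definition speed ::
  "('a::{t2_space,second_countable_topology}, 'e::euclidean_space) chart set \<Rightarrow> 'a metric
     \<Rightarrow> (real \<Rightarrow> 'a) \<Rightarrow> real \<Rightarrow> real" where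
  "speed A g \<gamma> t = sqrt (g (\<gamma> t) (velocity A \<gamma> t) (velocity A \<gamma> t))"

text \<open>\<open>C\<^sup>1\<close> up to the end points, with one-sided derivatives there.\<close>

definition C1_curve ::
  "('a::{t2_space,second_countable_topology}, 'e::euclidean_space) chart set
     \<Rightarrow> (real \<Rightarrow> 'a) \<Rightarrow> real \<Rightarrow> real \<Rightarrow> bool" where
  "C1_curve A \<gamma> a b \<longleftrightarrow> continuous_on {a..b} \<gamma> \<and>
     (\<forall>c\<in>A. \<exists>D. continuous_on {t\<in>{a..b}. \<gamma> t \<in> fst c} D \<and>
        (\<forall>t\<in>{a..b}. \<gamma> t \<in> fst c \<longrightarrow>
           (snd c \<circ> \<gamma> has_vector_derivative D t) (at t within {a..b})))"

definition piecewise_C1_curve ::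
  "('a::{t2_space,second_countable_topology}, 'e::euclidean_space) chart set
     \<Rightarrow> (real \<Rightarrow> 'a) \<Rightarrow> real \<Rightarrow> real \<Rightarrow> bool" where
  "piecewise_C1_curve A \<gamma> a b \<longleftrightarrow>
     (\<exists>(\<tau> :: nat \<Rightarrow> real) k. \<tau> 0 = a \<and> \<tau> k = b \<and>
        (\<forall>i<k. \<tau> i < \<tau> (Suc i) \<and> C1_curve A \<gamma> (\<tau> i) (\<tau> (Suc i))))"

text \<open>The finitely many corners, where the velocity is meaningless, do not affect the integral.\<close>

definition curve_length ::
  "('a::{t2_space,second_countable_topology}, 'e::euclidean_space) chart set \<Rightarrow> 'a metric
     \<Rightarrow> (real \<Rightarrow> 'a) \<Rightarrow> real \<Rightarrow> real \<Rightarrow> real" where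
  "curve_length A g \<gamma> a b = integral {a..b} (speed A g \<gamma>)"

definition riem_dist ::
  "('a::{t2_space,second_countable_topology}, 'e::euclidean_space) chart set \<Rightarrow> 'a metric
     \<Rightarrow> 'a \<Rightarrow> 'a \<Rightarrow> real" where
  "riem_dist A g p q =
     Inf {curve_length A g \<gamma> 0 1 | \<gamma>. piecewise_C1_curve A \<gamma> 0 1 \<and> \<gamma> 0 = p \<and> \<gamma> 1 = q}"

definition complete_riemannian_manifold ::
  "('a::{t2_space,second_countable_topology}, 'e::euclidean_space) chart set
     \<Rightarrow> 'a metric \<Rightarrow> bool" where
  "complete_riemannian_manifold A g \<longleftrightarrow>
     riemannian_manifold A g \<and> Metric_space.mcomplete UNIV (riem_dist A g)"


section \<open>Levi-Civita connection, curvature and weighted Laplacian in a chart\<close>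

text \<open>
  Tensor fields are given by their components in a chart \<open>c\<close>, at a coordinate point \<open>x\<close> and for
  coordinate vectors in \<open>'e\<close>. The vector \<open>sharp A g c x \<alpha>\<close> represents the covector \<open>\<alpha>\<close>.
\<close>

definition sharp ::
  "('a::{t2_space,second_countable_topology}, 'e::euclidean_space) chart set \<Rightarrow> 'a metric
     \<Rightarrow> ('a, 'e) chart \<Rightarrow> 'e \<Rightarrow> ('e \<Rightarrow> real) \<Rightarrow> 'e" where
  "sharp A g c x \<alpha> = (THE u. \<forall>w. local_metric A g c x u w = \<alpha> w)"

text \<open>The Christoffel symbols as a bilinear map: \<open>\<Gamma>(\<partial>\<^sub>i, \<partial>\<^sub>j) = \<Sum>\<^sub>k \<Gamma>\<^sup>k\<^sub>i\<^sub>j \<partial>\<^sub>k\<close>.\<close>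

definition christoffel ::
  "('a::{t2_space,second_countable_topology}, 'e::euclidean_space) chart set \<Rightarrow> 'a metric
     \<Rightarrow> ('a, 'e) chart \<Rightarrow> 'e \<Rightarrow> 'e \<Rightarrow> 'e \<Rightarrow> 'e" where
  "christoffel A g c x v w = sharp A g c x (\<lambda>z.
     (dir_deriv (\<lambda>y. local_metric A g c y w z) x v
      + dir_deriv (\<lambda>y. local_metric A g c y v z) x w
      - dir_deriv (\<lambda>y. local_metric A g c y v w) x z) / 2)"

text \<open>
  \<open>R(u,v)w = \<nabla>\<^sub>u \<nabla>\<^sub>v w - \<nabla>\<^sub>v \<nabla>\<^sub>u w\<close> for constant coordinate vector fields \<open>u\<close>, \<open>v\<close>, \<open>w\<close>. With this
  sign the Ricci tensor is the trace of \<open>u \<mapsto> R(u,v)w\<close> and is positive on round spheres.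
\<close>

definition curvature ::
  "('a::{t2_space,second_countable_topology}, 'e::euclidean_space) chart set \<Rightarrow> 'a metric
     \<Rightarrow> ('a, 'e) chart \<Rightarrow> 'e \<Rightarrow> 'e \<Rightarrow> 'e \<Rightarrow> 'e \<Rightarrow> 'e" where
  "curvature A g c x u v w =
     dir_deriv (\<lambda>y. christoffel A g c y v w) x u
     - dir_deriv (\<lambda>y. christoffel A g c y u w) x v
     + christoffel A g c x u (christoffel A g c x v w)
     - christoffel A g c x v (christoffel A g c x u w)"

definition ricci ::
  "('a::{t2_space,second_countable_topology}, 'e::euclidean_space) chart set \<Rightarrow> 'a metric
     \<Rightarrow> ('a, 'e) chart \<Rightarrow> 'e \<Rightarrow> 'e \<Rightarrow> 'e \<Rightarrow> real" where
  "ricci A g c x v w = (\<Sum>b\<in>Basis. curvature A g c x b v w \<bullet> b)"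

definition differential :: "('a, 'e::euclidean_space) chart \<Rightarrow> ('a \<Rightarrow> real) \<Rightarrow> 'e \<Rightarrow> 'e \<Rightarrow> real" where
  "differential c h x v = dir_deriv (h \<circ> chart_inv c) x v"

definition gradient ::
  "('a::{t2_space,second_countable_topology}, 'e::euclidean_space) chart set \<Rightarrow> 'a metric
     \<Rightarrow> ('a, 'e) chart \<Rightarrow> ('a \<Rightarrow> real) \<Rightarrow> 'e \<Rightarrow> 'e" where
  "gradient A g c h x = sharp A g c x (differential c h x)"

definition hessian ::
  "('a::{t2_space,second_countable_topology}, 'e::euclidean_space) chart set \<Rightarrow> 'a metric
     \<Rightarrow> ('a, 'e) chart \<Rightarrow> ('a \<Rightarrow> real) \<Rightarrow> 'e \<Rightarrow> 'e \<Rightarrow> 'e \<Rightarrow> real" where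
  "hessian A g c h x v w =
     dir_deriv (\<lambda>y. differential c h y w) x v - differential c h x (christoffel A g c x v w)"

definition laplacian ::
  "('a::{t2_space,second_countable_topology}, 'e::euclidean_space) chart set \<Rightarrow> 'a metric
     \<Rightarrow> ('a, 'e) chart \<Rightarrow> ('a \<Rightarrow> real) \<Rightarrow> 'e \<Rightarrow> real" where
  "laplacian A g c h x = (\<Sum>b\<in>Basis. sharp A g c x (hessian A g c h x b) \<bullet> b)"

definition weighted_laplacian ::
  "('a::{t2_space,second_countable_topology}, 'e::euclidean_space) chart set \<Rightarrow> 'a metric
     \<Rightarrow> ('a \<Rightarrow> real) \<Rightarrow> ('a, 'e) chart \<Rightarrow> ('a \<Rightarrow> real) \<Rightarrow> 'e \<Rightarrow> real" where
  "weighted_laplacian A g f c h x =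
     laplacian A g c h x - local_metric A g c x (gradient A g c f x) (gradient A g c h x)"

definition ricci_f1 ::
  "('a::{t2_space,second_countable_topology}, 'e::euclidean_space) chart set \<Rightarrow> 'a metric
     \<Rightarrow> ('a \<Rightarrow> real) \<Rightarrow> ('a, 'e) chart \<Rightarrow> 'e \<Rightarrow> 'e \<Rightarrow> 'e \<Rightarrow> real" where
  "ricci_f1 A g f c x v w =
     ricci A g c x v w + hessian A g c f x v w
     + differential c f x v * differential c f x w / (real DIM('e) - 1)"

definition CD_0_1 ::
  "('a::{t2_space,second_countable_topology}, 'e::euclidean_space) chart set \<Rightarrow> 'a metric
     \<Rightarrow> ('a \<Rightarrow> real) \<Rightarrow> bool" where
  "CD_0_1 A g f \<longleftrightarrow> (\<forall>c\<in>A. \<forall>x\<in>snd c ` fst c. \<forall>v. ricci_f1 A g f c x v v \<ge> 0)"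


section \<open>Geodesics\<close>

text \<open>The geodesic equation \<open>u'' + \<Gamma>(u', u') = 0\<close> for the coordinate expression \<open>u\<close> of \<open>\<gamma>\<close>.\<close>

definition geodesic_on ::
  "('a::{t2_space,second_countable_topology}, 'e::euclidean_space) chart set \<Rightarrow> 'a metric
     \<Rightarrow> real set \<Rightarrow> (real \<Rightarrow> 'a) \<Rightarrow> bool" where
  "geodesic_on A g J \<gamma> \<longleftrightarrow> continuous_on J \<gamma> \<and>
     (\<forall>c\<in>A. smooth_on {t\<in>J. \<gamma> t \<in> fst c} (snd c \<circ> \<gamma>) \<and>
        (\<forall>t\<in>J. \<gamma> t \<in> fst c \<longrightarrow>
           (let u = snd c \<circ> \<gamma>; u' = (\<lambda>s. vector_derivative u (at s))
            in vector_derivative u' (at t) + christoffel A g c (u t) (u' t) (u' t) = 0)))"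

text \<open>
  A minimal geodesic \<open>\<gamma> : [0,l] \<rightarrow> M\<close> parametrized by arc-length. As every geodesic on a compact
  interval, it extends to a slightly larger open interval; its values outside \<open>[0,l]\<close> play no role.
\<close>

definition unit_speed_minimal_geodesic ::
  "('a::{t2_space,second_countable_topology}, 'e::euclidean_space) chart set \<Rightarrow> 'a metric
     \<Rightarrow> (real \<Rightarrow> 'a) \<Rightarrow> real \<Rightarrow> bool" where
  "unit_speed_minimal_geodesic A g \<gamma> l \<longleftrightarrow>
     (\<exists>a b. a < 0 \<and> l < b \<and> geodesic_on A g {a<..<b} \<gamma>) \<and>
     (\<forall>t\<in>{0..l}. speed A g \<gamma> t = 1) \<and>
     curve_length A g \<gamma> 0 l = riem_dist A g (\<gamma> 0) (\<gamma> l)"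

end

theory Submission
  imports Defs
begin

text \<open>
  The bound is obtained by comparison with the lengths of test curves, so that neither Jacobi fields
  nor the exponential map are needed. Along \<open>\<gamma>\<close> take a parallel orthonormal frame \<open>E\<^sub>j\<close> containing the
  velocity and a function \<open>\<phi>\<close> with \<open>\<phi>(0) = 0\<close>, \<open>\<phi>(l) = 1\<close>, where \<open>l = r(q)\<close>. The second variation of
  arc length in the direction \<open>\<phi> E\<^sub>j\<close> dominates \<open>Hess r(E\<^sub>j, E\<^sub>j)\<close> at \<open>q\<close>; summing over the directions
  normal to \<open>\<gamma>\<close> and using the curvature condition along \<open>\<gamma>\<close>, with \<open>F = f \<circ> \<gamma>\<close>, gives
  \<open>\<Delta> r(q) \<le> \<integral> (n-1) \<phi>'\<^sup>2 + \<phi>\<^sup>2 (F'' + F'\<^sup>2/(n-1))\<close>. The optimal choice is \<open>\<phi> = C v \<integral> v\<^sup>-\<^sup>2\<close>, for which the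
  integrand is the derivative of \<open>\<phi>\<^sup>2 F' + (n-1) C\<^sup>2 \<integral> v\<^sup>-\<^sup>2\<close>; the first term at \<open>q\<close> is \<open>g(\<nabla>f, \<nabla>r)\<close>.

  The second variation is computed chart by chart on a subdivision of \<open>\<gamma>\<close>. The boundary terms vanish
  because the transversal curves have zero covariant acceleration; the curves prescribed by two
  charts at a common point differ by \<open>o(s\<^sup>2)\<close> and are joined by short coordinate segments.
\<close>

section \<open>Differential calculus of smooth maps\<close>

text \<open>The optimal \<open>\<phi>\<close> comes from the substitution
  \<open>\<phi> = v \<psi>\<close>. Since \<open>v' = v F' / (n-1)\<close>, the integrand becomes
  \<open>(n-1) v\<^sup>2 \<psi>'\<^sup>2\<close> plus the derivative of
  \<open>\<phi>\<^sup>2 F'\<close>; with the end values of \<open>\<psi>\<close> fixed,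
  Cauchy-Schwarz makes the integral of the first term least when \<open>\<psi>'\<close> is a
  multiple of \<open>v\<^sup>-\<^sup>2\<close>. The distance enters through upper bounds by explicit
  curves that touch it at q; as it is smooth there, touching suffices to compare first and second
  derivatives. One chart need not contain the geodesic, and a parallel frame is produced on short
  intervals only. The statement that is propagated, \<open>Qc\<close>, therefore concerns one
  parameter value and one chart: it carries a frame and numbers \<open>I j\<close>, survives a
  change of chart and passes across a short interval. Curves of zero covariant acceleration are
  chosen also because their second-order expansion means the same in every chart. The case q = p, in
  which there is no geodesic to vary, is excluded by showing that the distance from p is not smooth
  at p.\<close>

lemma has_derivative_dir_deriv:
  "F differentiable (at x) \<Longrightarrow> (F has_derivative dir_deriv F x) (at x)"
  using frechet_derivative_works unfolding dir_deriv_def by blast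

lemma dir_deriv_eqI: "(F has_derivative D) (at x) \<Longrightarrow> dir_deriv F x = D"
  unfolding dir_deriv_def using frechet_derivative_at by fastforce

lemma linear_dir_deriv: "F differentiable (at x) \<Longrightarrow> linear (dir_deriv F x)"
  using has_derivative_dir_deriv has_derivative_linear by blast

lemma has_derivative_cong_open:
  assumes "open U" "x \<in> U" "\<And>y. y \<in> U \<Longrightarrow> F y = H y"
  shows "(F has_derivative D) (at x) \<longleftrightarrow> (H has_derivative D) (at x)"
proof
  assume "(F has_derivative D) (at x)"
  then show "(H has_derivative D) (at x)"
    by (rule has_derivative_transform_within_open[OF _ assms(1,2)]) (rule assms(3))
next
  assume "(H has_derivative D) (at x)"
  then show "(F has_derivative D) (at x)"
    by (rule has_derivative_transform_within_open[OF _ assms(1,2)]) (rule assms(3)[symmetric])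
qed

lemma dir_deriv_cong_open:
  assumes "open U" "x \<in> U" "\<And>y. y \<in> U \<Longrightarrow> F y = H y"
  shows "dir_deriv F x = dir_deriv H x"
proof -
  have "(F has_derivative D) (at x) = (H has_derivative D) (at x)" for D
    by (rule has_derivative_cong_open[OF assms(1,2)]) (rule assms(3))
  then show ?thesis unfolding dir_deriv_def frechet_derivative_def by presburger
qed

lemma differentiable_cong_open:
  assumes "open U" "x \<in> U" "\<And>y. y \<in> U \<Longrightarrow> F y = H y"
  shows "F differentiable (at x) \<longleftrightarrow> H differentiable (at x)"
proof -
  have "(F has_derivative D) (at x) = (H has_derivative D) (at x)" for D
    by (rule has_derivative_cong_open[OF assms(1,2)]) (rule assms(3))
  then show ?thesis unfolding differentiable_def by presburger
qed

lemma has_vector_derivative_chain_dir_deriv: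
  fixes F :: "'a::euclidean_space \<Rightarrow> 'b::real_normed_vector"
  assumes "F differentiable (at (x t))" "(x has_vector_derivative x') (at t within S)"
  shows "((\<lambda>s. F (x s)) has_vector_derivative dir_deriv F (x t) x') (at t within S)"
proof -
  have "(F \<circ> x has_derivative dir_deriv F (x t) \<circ> (\<lambda>h. h *\<^sub>R x')) (at t within S)"
    using assms(2) unfolding has_vector_derivative_def
    by (rule diff_chain_within)
       (rule has_derivative_at_withinI[OF has_derivative_dir_deriv[OF assms(1)]])
  moreover have "dir_deriv F (x t) \<circ> (\<lambda>h. h *\<^sub>R x') = (\<lambda>h. h *\<^sub>R dir_deriv F (x t) x')"
    using linear_dir_deriv[OF assms(1)] by (auto simp: linear_cmul)
  ultimately show ?thesis unfolding has_vector_derivative_def by (simp add: o_def)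
qed

lemma smooth_onD:
  assumes "smooth_on S F"
  shows "continuous_on S F" "x \<in> S \<Longrightarrow> F differentiable (at x)"
    "smooth_on S (\<lambda>x. dir_deriv F x v)"
proof -
  have 0: "Ck_on k S F" for k using assms by (simp add: smooth_on_def)
  show "continuous_on S F" using 0[of 0] by simp
  show "x \<in> S \<Longrightarrow> F differentiable (at x)" using 0[of 1] by simp
  show "smooth_on S (\<lambda>x. dir_deriv F x v)"
    unfolding smooth_on_def using 0[of "Suc k" for k] by simp
qed

text \<open>A directional derivative at \<open>x\<close> depends on the function near
  \<open>x\<close> only, so on an open set equality passes to derivatives; hence the induction with
  \<open>F\<close> and \<open>H\<close> arbitrary.\<close>

lemma Ck_on_cong_open:
  assumes "open S" "\<And>x. x \<in> S \<Longrightarrow> F x = H x" "Ck_on k S F" shows "Ck_on k S H"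
  using assms(2,3)
proof (induction k arbitrary: F H)
  case 0
  then show ?case using continuous_on_cong[of S S F H] by simp
next
  case (Suc k)
  have "H differentiable (at x)" if "x \<in> S" for x
  proof -
    have "F differentiable (at x) \<longleftrightarrow> H differentiable (at x)"
      by (rule differentiable_cong_open[OF assms(1) that]) (rule Suc.prems(1))
    then show ?thesis using Suc.prems(2) that by simp
  qed
  moreover have "Ck_on k S (\<lambda>x. dir_deriv H x v)" for v
  proof (rule Suc.IH)
    show "Ck_on k S (\<lambda>x. dir_deriv F x v)" using Suc.prems(2) by simp
    show "dir_deriv F x v = dir_deriv H x v" if "x \<in> S" for x
    proof -
      have "dir_deriv F x = dir_deriv H x"
        by (rule dir_deriv_cong_open[OF assms(1) that]) (rule Suc.prems(1))
      then show ?thesis by simp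
    qed
  qed
  ultimately show ?case by simp
qed

lemma Ck_on_inner_left:
  assumes "open S" "Ck_on k S F" shows "Ck_on k S (\<lambda>x. F x \<bullet> w)"
  using assms(2)
proof (induction k arbitrary: F)
  case 0
  then show ?case by (auto intro!: continuous_intros)
next
  case (Suc k)
  have D: "((\<lambda>x. F x \<bullet> w) has_derivative (\<lambda>v. dir_deriv F x v \<bullet> w)) (at x)" if "x \<in> S" for x
    using has_derivative_dir_deriv[of F x] that Suc.prems by (auto intro!: derivative_eq_intros)
  have "(\<lambda>x. F x \<bullet> w) differentiable (at x)" if "x \<in> S" for x
    using D[OF that] by (auto simp: differentiable_def)
  moreover have "Ck_on k S (\<lambda>x. dir_deriv (\<lambda>x. F x \<bullet> w) x v)" for v
  proof (rule Ck_on_cong_open[OF assms(1)])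
    show "Ck_on k S (\<lambda>x. dir_deriv F x v \<bullet> w)" using Suc by simp
    show "dir_deriv F x v \<bullet> w = dir_deriv (\<lambda>x. F x \<bullet> w) x v" if "x \<in> S" for x
      by (simp add: dir_deriv_eqI[OF D[OF that]])
  qed
  ultimately show ?case by simp
qed

lemma smooth_on_inner_left:
  "open S \<Longrightarrow> smooth_on S F \<Longrightarrow> smooth_on S (\<lambda>x. F x \<bullet> w)"
  unfolding smooth_on_def using Ck_on_inner_left by blast

section \<open>Product rules and continuity for families of multilinear maps along a curve\<close>

lemma linear_basis_expansion:
  fixes v :: "'v::euclidean_space"
  assumes "linear L" shows "L v = (\<Sum>b\<in>Basis. (v \<bullet> b) *\<^sub>R L b)"
  by (subst euclidean_representation[symmetric, of v])
     (simp add: linear_sum[OF assms] linear_cmul[OF assms] o_def)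

text \<open>Expanding \<open>v s\<close> in the basis leaves finitely many scalar coefficients times
  the curves \<open>L (x s) b\<close>. Thus it is enough that \<open>y \<mapsto> L y w\<close> is
  differentiable for each fixed \<open>w\<close>, and no operator-valued map is
  differentiated.\<close>

lemma has_vector_derivative_linear_family:
  fixes L :: "'e::euclidean_space \<Rightarrow> 'v::euclidean_space \<Rightarrow> 'b::real_normed_vector"
  assumes "open U" and lin: "\<And>y. y \<in> U \<Longrightarrow> linear (L y)"
    and diff: "\<And>w. (\<lambda>y. L y w) differentiable (at (x t))"
    and x: "(x has_vector_derivative x') (at t within S)" "x t \<in> U" and "t \<in> S"
    and v: "(v has_vector_derivative v') (at t within S)"
  shows "((\<lambda>s. L (x s) (v s)) has_vector_derivative
     dir_deriv (\<lambda>y. L y (v t)) (x t) x' + L (x t) v') (at t within S)"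
proof -
  let ?D = "\<lambda>b. dir_deriv (\<lambda>y. L y b) (x t) x'"
  have "((\<lambda>s. L (x s) b) has_vector_derivative ?D b) (at t within S)" for b
    using has_vector_derivative_chain_dir_deriv[OF diff x(1)] .
  then have *: "((\<lambda>s. \<Sum>b\<in>Basis. (v s \<bullet> b) *\<^sub>R L (x s) b) has_vector_derivative
      (\<Sum>b\<in>Basis. (v t \<bullet> b) *\<^sub>R ?D b + (v' \<bullet> b) *\<^sub>R L (x t) b)) (at t within S)"
    using v
    by (intro has_vector_derivative_sum has_vector_derivative_scaleR)
       (auto simp: has_real_derivative_iff_has_vector_derivative
          intro!: bounded_linear.has_vector_derivative[OF bounded_linear_inner_left])
  \<comment> \<open>The same expansion with the vector frozen at \<open>v t\<close> reassembles the
    basis terms into one directional derivative.\<close>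
  have "((\<lambda>y. L y (v t)) has_derivative (\<lambda>z. \<Sum>b\<in>Basis. (v t \<bullet> b) *\<^sub>R dir_deriv (\<lambda>y. L y b) (x t) z)) (at (x t))"
  proof (subst has_derivative_cong_open[OF assms(1) x(2)])
    show "\<And>y. y \<in> U \<Longrightarrow> L y (v t) = (\<Sum>b\<in>Basis. (v t \<bullet> b) *\<^sub>R L y b)"
      using linear_basis_expansion[OF lin] by blast
    show "((\<lambda>y. \<Sum>b\<in>Basis. (v t \<bullet> b) *\<^sub>R L y b) has_derivative
     (\<lambda>z. \<Sum>b\<in>Basis. (v t \<bullet> b) *\<^sub>R dir_deriv (\<lambda>y. L y b) (x t) z)) (at (x t))"
      by (intro has_derivative_sum has_derivative_scaleR_right has_derivative_dir_deriv diff)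
  qed
  then have e1: "dir_deriv (\<lambda>y. L y (v t)) (x t) x' = (\<Sum>b\<in>Basis. (v t \<bullet> b) *\<^sub>R ?D b)"
    by (simp add: dir_deriv_eqI)
  have "continuous (at t within S) x" using x(1) has_vector_derivative_continuous by blast
  then have "\<forall>\<^sub>F s in at t within S. x s \<in> U"
    using assms(1) x(2) by (auto simp: continuous_within tendsto_def)
  then have ev: "\<forall>\<^sub>F s in at t within S. (\<Sum>b\<in>Basis. (v s \<bullet> b) *\<^sub>R L (x s) b) = L (x s) (v s)"
    by eventually_elim (rule linear_basis_expansion[OF lin, symmetric])
  show ?thesis
    using * unfolding has_vector_derivative_def
    apply (rule has_derivative_transform_eventually[THEN has_derivative_eq_rhs])
    using ev apply simp
    apply (rule linear_basis_expansion[OF lin[OF x(2)], symmetric])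
     apply fact
    using e1 linear_basis_expansion[OF lin[OF x(2)], of v'] by (simp add: sum.distrib)
qed

text \<open>Only the first vector argument is expanded in the basis; the linear case applied to
  \<open>B y b\<close> takes care of the second.\<close>

lemma has_vector_derivative_bilinear_family:
  fixes B :: "'e::euclidean_space \<Rightarrow> 'v::euclidean_space \<Rightarrow> 'w::euclidean_space \<Rightarrow> 'b::real_normed_vector"
  assumes "open U" and lin: "\<And>y w. y \<in> U \<Longrightarrow> linear (\<lambda>v. B y v w)" "\<And>y v. y \<in> U \<Longrightarrow> linear (B y v)"
    and diff: "\<And>v w. (\<lambda>y. B y v w) differentiable (at (x t))"
    and x: "(x has_vector_derivative x') (at t within S)" "x t \<in> U" and "t \<in> S"
    and v: "(v has_vector_derivative v') (at t within S)"
    and w: "(w has_vector_derivative w') (at t within S)"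
  shows "((\<lambda>s. B (x s) (v s) (w s)) has_vector_derivative
     dir_deriv (\<lambda>y. B y (v t) (w t)) (x t) x' + B (x t) v' (w t) + B (x t) (v t) w') (at t within S)"
proof -
  let ?D = "\<lambda>b. dir_deriv (\<lambda>y. B y b (w t)) (x t) x' + B (x t) b w'"
  have "((\<lambda>s. B (x s) b (w s)) has_vector_derivative ?D b) (at t within S)" for b
    by (rule has_vector_derivative_linear_family[OF assms(1) lin(2) diff x \<open>t \<in> S\<close> w])
  then have *: "((\<lambda>s. \<Sum>b\<in>Basis. (v s \<bullet> b) *\<^sub>R B (x s) b (w s)) has_vector_derivative
      (\<Sum>b\<in>Basis. (v t \<bullet> b) *\<^sub>R ?D b + (v' \<bullet> b) *\<^sub>R B (x t) b (w t))) (at t within S)"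
    using v
    by (intro has_vector_derivative_sum has_vector_derivative_scaleR)
       (auto simp: has_real_derivative_iff_has_vector_derivative
          intro!: bounded_linear.has_vector_derivative[OF bounded_linear_inner_left])
  have "((\<lambda>y. B y (v t) (w t)) has_derivative (\<lambda>z. \<Sum>b\<in>Basis. (v t \<bullet> b) *\<^sub>R dir_deriv (\<lambda>y. B y b (w t)) (x t) z)) (at (x t))"
  proof (subst has_derivative_cong_open[OF assms(1) x(2)])
    show "\<And>y. y \<in> U \<Longrightarrow> B y (v t) (w t) = (\<Sum>b\<in>Basis. (v t \<bullet> b) *\<^sub>R B y b (w t))"
      using linear_basis_expansion[OF lin(1)] by blast
    show "((\<lambda>y. \<Sum>b\<in>Basis. (v t \<bullet> b) *\<^sub>R B y b (w t)) has_derivative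
     (\<lambda>z. \<Sum>b\<in>Basis. (v t \<bullet> b) *\<^sub>R dir_deriv (\<lambda>y. B y b (w t)) (x t) z)) (at (x t))"
      by (intro has_derivative_sum has_derivative_scaleR_right has_derivative_dir_deriv diff)
  qed
  then have e1: "dir_deriv (\<lambda>y. B y (v t) (w t)) (x t) x' = (\<Sum>b\<in>Basis. (v t \<bullet> b) *\<^sub>R dir_deriv (\<lambda>y. B y b (w t)) (x t) x')"
    by (simp add: dir_deriv_eqI)
  have "continuous (at t within S) x" using x(1) has_vector_derivative_continuous by blast
  then have "\<forall>\<^sub>F s in at t within S. x s \<in> U"
    using assms(1) x(2) by (auto simp: continuous_within tendsto_def)
  then have ev: "\<forall>\<^sub>F s in at t within S. (\<Sum>b\<in>Basis. (v s \<bullet> b) *\<^sub>R B (x s) b (w s)) = B (x s) (v s) (w s)"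
    by eventually_elim (rule linear_basis_expansion[OF lin(1), symmetric])
  show ?thesis
    using * unfolding has_vector_derivative_def
    apply (rule has_derivative_transform_eventually[THEN has_derivative_eq_rhs])
    using ev apply simp
    apply (rule linear_basis_expansion[OF lin(1)[OF x(2)], symmetric])
     apply fact
    using e1 linear_basis_expansion[OF lin(1)[OF x(2), of "w t"], of v']
      linear_basis_expansion[OF lin(1)[OF x(2), of w'], of "v t"]
    by (simp only: sum.distrib scaleR_add_right) (simp add: add_ac)
qed

lemma continuous_on_linear_family:
  fixes L :: "'e::euclidean_space \<Rightarrow> 'v::euclidean_space \<Rightarrow> 'b::real_normed_vector"
  assumes lin: "\<And>y. y \<in> U \<Longrightarrow> linear (L y)" and c: "\<And>w. continuous_on U (\<lambda>y. L y w)"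
    and x: "continuous_on T x" "x ` T \<subseteq> U" and v: "continuous_on T v"
  shows "continuous_on T (\<lambda>s. L (x s) (v s))"
proof -
  have "continuous_on T (\<lambda>s. L (x s) b)" for b
    using continuous_on_compose2[OF c x] .
  then have "continuous_on T (\<lambda>s. \<Sum>b\<in>Basis. (v s \<bullet> b) *\<^sub>R L (x s) b)"
    by (intro continuous_intros v)
  moreover have "L (x s) (v s) = (\<Sum>b\<in>Basis. (v s \<bullet> b) *\<^sub>R L (x s) b)" if "s \<in> T" for s
    using linear_basis_expansion[OF lin] that x(2) by blast
  ultimately show ?thesis by (simp cong: continuous_on_cong)
qed

lemma continuous_on_bilinear_family:
  fixes B :: "'e::euclidean_space \<Rightarrow> 'v::euclidean_space \<Rightarrow> 'w::euclidean_space \<Rightarrow> 'b::real_normed_vector"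
  assumes lin: "\<And>y w. y \<in> U \<Longrightarrow> linear (\<lambda>v. B y v w)" "\<And>y v. y \<in> U \<Longrightarrow> linear (B y v)"
    and c: "\<And>v w. continuous_on U (\<lambda>y. B y v w)"
    and x: "continuous_on T x" "x ` T \<subseteq> U" and v: "continuous_on T v" and w: "continuous_on T w"
  shows "continuous_on T (\<lambda>s. B (x s) (v s) (w s))"
proof -
  have "continuous_on T (\<lambda>s. B (x s) b (w s))" for b
    by (rule continuous_on_linear_family[OF lin(2) c x w])
  then have "continuous_on T (\<lambda>s. \<Sum>b\<in>Basis. (v s \<bullet> b) *\<^sub>R B (x s) b (w s))"
    by (intro continuous_intros v)
  moreover have "B (x s) (v s) (w s) = (\<Sum>b\<in>Basis. (v s \<bullet> b) *\<^sub>R B (x s) b (w s))" if "s \<in> T" for s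
    using linear_basis_expansion[OF lin(1)] that x(2) by blast
  ultimately show ?thesis by (simp cong: continuous_on_cong)
qed

lemma continuous_on_trilinear_family:
  fixes B :: "'e::euclidean_space \<Rightarrow> 'u::euclidean_space \<Rightarrow> 'v::euclidean_space \<Rightarrow> 'w::euclidean_space \<Rightarrow> 'b::real_normed_vector"
  assumes lin: "\<And>y v w. y \<in> U \<Longrightarrow> linear (\<lambda>u. B y u v w)" "\<And>y u w. y \<in> U \<Longrightarrow> linear (\<lambda>v. B y u v w)"
      "\<And>y u v. y \<in> U \<Longrightarrow> linear (B y u v)"
    and c: "\<And>u v w. continuous_on U (\<lambda>y. B y u v w)"
    and x: "continuous_on T x" "x ` T \<subseteq> U" and u: "continuous_on T u" and v: "continuous_on T v"
    and w: "continuous_on T w"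
  shows "continuous_on T (\<lambda>s. B (x s) (u s) (v s) (w s))"
proof -
  have "continuous_on T (\<lambda>s. B (x s) b (v s) (w s))" for b
    by (rule continuous_on_bilinear_family[OF lin(2,3) c x v w])
  then have "continuous_on T (\<lambda>s. \<Sum>b\<in>Basis. (u s \<bullet> b) *\<^sub>R B (x s) b (v s) (w s))"
    by (intro continuous_intros u)
  moreover have "B (x s) (u s) (v s) (w s) = (\<Sum>b\<in>Basis. (u s \<bullet> b) *\<^sub>R B (x s) b (v s) (w s))" if "s \<in> T" for s
    using linear_basis_expansion[OF lin(1)] that x(2) by blast
  ultimately show ?thesis by (simp cong: continuous_on_cong)
qed

text \<open>The remainder \<open>h\<close> has derivative \<open>f' y - f' 0 - y f''\<close>, which
  is \<open>o(y)\<close> by differentiability of \<open>f'\<close> at the single point 0. The mean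
  value inequality on the interval of radius \<open>|s|\<close> contributes the second factor
  \<open>|s|\<close>.\<close>

lemma Peano_second_order:
  fixes f :: "real \<Rightarrow> 'b::real_normed_vector"
  assumes "r > 0" and f: "\<And>s. \<bar>s\<bar> < r \<Longrightarrow> (f has_vector_derivative f' s) (at s)"
    and f': "(f' has_vector_derivative f'') (at 0)" and "\<epsilon> > 0"
  shows "\<exists>\<delta>>0. \<forall>s. \<bar>s\<bar> < \<delta> \<longrightarrow> norm (f s - f 0 - s *\<^sub>R f' 0 - (s\<^sup>2 / 2) *\<^sub>R f'') \<le> \<epsilon> * s\<^sup>2"
proof -
  obtain d where d: "d > 0" "\<And>s. \<bar>s\<bar> < d \<Longrightarrow> norm (f' s - f' 0 - s *\<^sub>R f'') \<le> \<epsilon> * \<bar>s\<bar>"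
    using f' \<open>\<epsilon> > 0\<close> unfolding has_vector_derivative_def has_derivative_at_alt by auto
  define \<delta> where "\<delta> = min r d"
  have "norm (f s - f 0 - s *\<^sub>R f' 0 - (s\<^sup>2 / 2) *\<^sub>R f'') \<le> \<epsilon> * s\<^sup>2" if s: "\<bar>s\<bar> < \<delta>" for s
  proof -
    define h where "h = (\<lambda>s. f s - s *\<^sub>R f' 0 - (s\<^sup>2 / 2) *\<^sub>R f'')"
    have h: "(h has_vector_derivative (f' y - f' 0 - y *\<^sub>R f'')) (at y within {-\<bar>s\<bar>..\<bar>s\<bar>})"
      if "y \<in> {-\<bar>s\<bar>..\<bar>s\<bar>}" for y
    proof (rule has_vector_derivative_at_within)
      have "((\<lambda>s. s *\<^sub>R f' 0) has_vector_derivative f' 0) (at y)"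
        using has_vector_derivative_scaleR[of "\<lambda>s. s" 1 y UNIV "\<lambda>_. f' 0" 0] by auto
      moreover have "((\<lambda>s. (s\<^sup>2 / 2) *\<^sub>R f'') has_vector_derivative y *\<^sub>R f'') (at y)"
        using has_vector_derivative_scaleR[of "\<lambda>s. s\<^sup>2/2" y y UNIV "\<lambda>_. f''" 0]
        by (auto intro!: derivative_eq_intros)
      moreover have "(f has_vector_derivative f' y) (at y)" using f[of y] that s by (auto simp: \<delta>_def)
      ultimately show "(h has_vector_derivative (f' y - f' 0 - y *\<^sub>R f'')) (at y)"
        unfolding h_def by (intro has_vector_derivative_diff)
    qed
    have "norm (h s - h 0) \<le> (\<epsilon> * \<bar>s\<bar>) * norm (s - 0)"
    proof (rule differentiable_bound[where S = "{-\<bar>s\<bar>..\<bar>s\<bar>}" and f' = "\<lambda>y t. t *\<^sub>R (f' y - f' 0 - y *\<^sub>R f'')"])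
      show "onorm (\<lambda>t. t *\<^sub>R (f' y - f' 0 - y *\<^sub>R f'')) \<le> \<epsilon> * \<bar>s\<bar>" if "y \<in> {- \<bar>s\<bar>..\<bar>s\<bar>}" for y
      proof (rule onorm_le)
        have "norm (f' y - f' 0 - y *\<^sub>R f'') \<le> \<epsilon> * \<bar>y\<bar>" using d(2)[of y] that s by (auto simp: \<delta>_def)
        also have "\<dots> \<le> \<epsilon> * \<bar>s\<bar>" using that \<open>\<epsilon> > 0\<close> by (auto simp: abs_if)
        finally show "norm (t *\<^sub>R (f' y - f' 0 - y *\<^sub>R f'')) \<le> \<epsilon> * \<bar>s\<bar> * norm t" for t
          by (simp add: mult.commute mult_left_mono)
      qed
    next
      show "(h has_derivative (\<lambda>t. t *\<^sub>R (f' y - f' 0 - y *\<^sub>R f''))) (at y within {-\<bar>s\<bar>..\<bar>s\<bar>})"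
        if "y \<in> {- \<bar>s\<bar>..\<bar>s\<bar>}" for y using h[OF that] by (simp add: has_vector_derivative_def)
    next
      show "convex {- \<bar>s\<bar>..\<bar>s\<bar>}" "s \<in> {- \<bar>s\<bar>..\<bar>s\<bar>}" "0 \<in> {- \<bar>s\<bar>..\<bar>s\<bar>}" by auto
    qed
    moreover have "h s - h 0 = f s - f 0 - s *\<^sub>R f' 0 - (s\<^sup>2 / 2) *\<^sub>R f''" by (simp add: h_def)
    moreover have "(\<epsilon> * \<bar>s\<bar>) * norm (s - 0) = \<epsilon> * s\<^sup>2"
      by (simp add: power2_eq_square mult.assoc)
    ultimately show ?thesis by metis
  qed
  then show ?thesis using \<open>r > 0\<close> d(1) by (intro exI[of _ \<delta>]) (auto simp: \<delta>_def)
qed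

section \<open>Symmetry of second directional derivatives\<close>

lemma dir_deriv_line:
  fixes F :: "'e::euclidean_space \<Rightarrow> 'b::real_normed_vector"
  assumes "F differentiable (at (x + s *\<^sub>R a))"
  shows "((\<lambda>s. F (x + s *\<^sub>R a)) has_vector_derivative dir_deriv F (x + s *\<^sub>R a) a) (at s within S)"
proof (rule has_vector_derivative_chain_dir_deriv[where x = "\<lambda>s. x + s *\<^sub>R a", OF assms])
  show "((\<lambda>s. x + s *\<^sub>R a) has_vector_derivative a) (at s within S)"
    unfolding has_vector_derivative_def by (auto intro!: derivative_eq_intros)
qed

text \<open>Two applications of the mean value theorem: along \<open>a\<close> to the difference
  \<open>h\<close>, then along \<open>b\<close> to its derivative. The left side is unchanged when
  \<open>a\<close> and \<open>b\<close> are exchanged, which is what the symmetry of second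
  derivatives rests on.\<close>

lemma mixed_difference:
  fixes F :: "'e::euclidean_space \<Rightarrow> real"
  assumes "t > 0" and U: "\<And>s s'. \<bar>s\<bar> \<le> t \<Longrightarrow> \<bar>s'\<bar> \<le> t \<Longrightarrow> x + s *\<^sub>R a + s' *\<^sub>R b \<in> U"
    and F: "\<And>y. y \<in> U \<Longrightarrow> F differentiable (at y)" "\<And>y. y \<in> U \<Longrightarrow> (\<lambda>y. dir_deriv F y a) differentiable (at y)"
  shows "\<exists>s\<in>{0..t}. \<exists>s'\<in>{0..t}. F (x + t *\<^sub>R a + t *\<^sub>R b) - F (x + t *\<^sub>R a) - F (x + t *\<^sub>R b) + F x
     = t * t * dir_deriv (\<lambda>y. dir_deriv F y a) (x + s *\<^sub>R a + s' *\<^sub>R b) b"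
proof -
  define h where "h = (\<lambda>s. F (x + t *\<^sub>R b + s *\<^sub>R a) - F (x + s *\<^sub>R a))"
  have U': "x + s *\<^sub>R a \<in> U" "x + t *\<^sub>R b + s *\<^sub>R a \<in> U" if "\<bar>s\<bar> \<le> t" for s
    using U[OF that, of 0] U[OF that, of t] \<open>t > 0\<close> by (auto simp: algebra_simps)
  have "\<exists>z>0. z < t \<and> h t - h 0 = (t - 0) * (dir_deriv F (x + t *\<^sub>R b + z *\<^sub>R a) a - dir_deriv F (x + z *\<^sub>R a) a)"
  proof (rule MVT2[OF \<open>t > 0\<close>])
    fix s assume "0 \<le> s" "s \<le> t"
    then show "(h has_real_derivative dir_deriv F (x + t *\<^sub>R b + s *\<^sub>R a) a - dir_deriv F (x + s *\<^sub>R a) a) (at s)"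
      unfolding h_def has_real_derivative_iff_has_vector_derivative
      by (intro has_vector_derivative_diff dir_deriv_line F U') auto
  qed
  then obtain z where z: "0 < z" "z < t"
    "h t - h 0 = t * (dir_deriv F (x + t *\<^sub>R b + z *\<^sub>R a) a - dir_deriv F (x + z *\<^sub>R a) a)" by auto
  have "\<exists>w>0. w < t \<and> dir_deriv F ((x + z *\<^sub>R a) + t *\<^sub>R b) a - dir_deriv F ((x + z *\<^sub>R a) + 0 *\<^sub>R b) a
     = (t - 0) * dir_deriv (\<lambda>y. dir_deriv F y a) ((x + z *\<^sub>R a) + w *\<^sub>R b) b"
  proof (rule MVT2[OF \<open>t > 0\<close>])
    fix s assume "0 \<le> s" "s \<le> t"
    then show "((\<lambda>s. dir_deriv F ((x + z *\<^sub>R a) + s *\<^sub>R b) a) has_real_derivative dir_deriv (\<lambda>y. dir_deriv F y a) ((x + z *\<^sub>R a) + s *\<^sub>R b) b) (at s)"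
      unfolding has_real_derivative_iff_has_vector_derivative
      using dir_deriv_line[of "\<lambda>y. dir_deriv F y a" "x + z *\<^sub>R a" s b] F(2) U[of z s] z by auto
  qed
  then obtain w where "0 < w" "w < t" "dir_deriv F (x + t *\<^sub>R b + z *\<^sub>R a) a - dir_deriv F (x + z *\<^sub>R a) a
     = t * dir_deriv (\<lambda>y. dir_deriv F y a) ((x + z *\<^sub>R a) + w *\<^sub>R b) b"
    by (auto simp: algebra_simps)
  then show ?thesis using z unfolding h_def
    by (intro bexI[of _ z] bexI[of _ w]) (auto simp: algebra_simps)
qed

text \<open>One second difference equals \<open>t * t\<close> times a value of either mixed
  derivative at points near \<open>x\<close>; both are continuous, and \<open>t\<close> may be as
  small as desired.\<close>

lemma dir_deriv_symmetric:
  fixes F :: "'e::euclidean_space \<Rightarrow> real"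
  assumes "open U" "x \<in> U" "smooth_on U F"
  shows "dir_deriv (\<lambda>y. dir_deriv F y a) x b = dir_deriv (\<lambda>y. dir_deriv F y b) x a"
proof -
  define A where "A = (\<lambda>y. dir_deriv (\<lambda>y. dir_deriv F y a) y b)"
  define B where "B = (\<lambda>y. dir_deriv (\<lambda>y. dir_deriv F y b) y a)"
  have c: "isCont A x" "isCont B x" unfolding A_def B_def
    using smooth_onD(1)[OF smooth_onD(3)[OF smooth_onD(3)[OF assms(3)]]] assms(1,2)
    by (auto simp: continuous_on_eq_continuous_at)
  have "\<bar>A x - B x\<bar> \<le> \<epsilon>" if "\<epsilon> > 0" for \<epsilon>
  proof -
    obtain d1 where d1: "d1 > 0" "\<And>y. dist y x < d1 \<Longrightarrow> dist (A y) (A x) < \<epsilon>/2"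
      using c(1) \<open>\<epsilon> > 0\<close> unfolding continuous_at_eps_delta by (metis half_gt_zero)
    obtain d2 where d2: "d2 > 0" "\<And>y. dist y x < d2 \<Longrightarrow> dist (B y) (B x) < \<epsilon>/2"
      using c(2) \<open>\<epsilon> > 0\<close> unfolding continuous_at_eps_delta by (metis half_gt_zero)
    obtain d3 where d3: "d3 > 0" "ball x d3 \<subseteq> U" using assms(1,2) open_contains_ball by blast
    define d where "d = min d1 (min d2 d3)"
    \<comment> \<open>With this step the whole parallelogram stays within \<open>d / 2\<close> of
      \<open>x\<close>; the summand 1 keeps the denominator positive when
      \<open>a = b = 0\<close>.\<close>
    define t where "t = d / (2 * (norm a + norm b + 1))"
    have N: "norm a + norm b + 1 > 0" by (smt (verit) norm_ge_zero)
    have d0: "d > 0" using d1 d2 d3 by (simp add: d_def)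
    have t: "t > 0" using d0 N by (simp add: t_def)
    have near: "dist (x + s *\<^sub>R a + s' *\<^sub>R b) x < d" if "\<bar>s\<bar> \<le> t" "\<bar>s'\<bar> \<le> t" for s s'
    proof -
      have "norm (s *\<^sub>R a + s' *\<^sub>R b) \<le> \<bar>s\<bar> * norm a + \<bar>s'\<bar> * norm b"
        using norm_triangle_ineq[of "s *\<^sub>R a" "s' *\<^sub>R b"] by simp
      also have "\<dots> \<le> t * norm a + t * norm b" using that by (intro add_mono mult_right_mono) auto
      also have "\<dots> \<le> t * (norm a + norm b + 1)" using t by (simp add: algebra_simps)
      also have "\<dots> = d / 2" using N by (simp add: t_def field_simps)
      also have "\<dots> < d" using d0 by simp
      finally show ?thesis by (simp add: dist_norm add.assoc)
    qed
    have U: "x + s *\<^sub>R a + s' *\<^sub>R b \<in> U" if "\<bar>s\<bar> \<le> t" "\<bar>s'\<bar> \<le> t" for s s'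
      using near[OF that] d3 by (auto simp: d_def dist_commute)
    have U2: "x + s *\<^sub>R b + s' *\<^sub>R a \<in> U" if "\<bar>s\<bar> \<le> t" "\<bar>s'\<bar> \<le> t" for s s'
      using U[OF that(2,1)] by (simp add: algebra_simps)
    note sm = smooth_onD(2)[OF assms(3)] smooth_onD(2)[OF smooth_onD(3)[OF assms(3)]]
    obtain s s' where s: "s\<in>{0..t}" "s'\<in>{0..t}" "F (x + t *\<^sub>R a + t *\<^sub>R b) - F (x + t *\<^sub>R a) - F (x + t *\<^sub>R b) + F x
       = t * t * A (x + s *\<^sub>R a + s' *\<^sub>R b)"
      using mixed_difference[OF t U sm] unfolding A_def by blast
    obtain r r' where r: "r\<in>{0..t}" "r'\<in>{0..t}" "F (x + t *\<^sub>R b + t *\<^sub>R a) - F (x + t *\<^sub>R b) - F (x + t *\<^sub>R a) + F x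
       = t * t * B (x + r *\<^sub>R b + r' *\<^sub>R a)"
      using mixed_difference[OF t U2 sm] unfolding B_def by blast
    have "t * t * A (x + s *\<^sub>R a + s' *\<^sub>R b) = t * t * B (x + r *\<^sub>R b + r' *\<^sub>R a)"
      using s(3) r(3) by (simp add: algebra_simps)
    then have "A (x + s *\<^sub>R a + s' *\<^sub>R b) = B (x + r' *\<^sub>R a + r *\<^sub>R b)" using t by (simp add: algebra_simps)
    moreover have "dist (A (x + s *\<^sub>R a + s' *\<^sub>R b)) (A x) < \<epsilon>/2"
      using near[of s s'] s by (intro d1) (auto simp: d_def)
    moreover have "dist (B (x + r' *\<^sub>R a + r *\<^sub>R b)) (B x) < \<epsilon>/2"
      using near[of r' r] r by (intro d2) (auto simp: d_def)
    ultimately show ?thesis unfolding dist_real_def by argo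
  qed
  then have "\<bar>A x - B x\<bar> \<le> 0" using field_le_epsilon[of "\<bar>A x - B x\<bar>" 0] by simp
  then show ?thesis by (simp add: A_def B_def)
qed

section \<open>Riemannian metrics on open subsets of Euclidean space\<close>

lemma linear_dir_deriv_family:
  fixes L :: "'e::euclidean_space \<Rightarrow> 'v::real_vector \<Rightarrow> 'b::real_normed_vector"
  assumes "open U" "x \<in> U" and lin: "\<And>y. y \<in> U \<Longrightarrow> linear (L y)"
    and diff: "\<And>w. (\<lambda>y. L y w) differentiable (at x)"
  shows "linear (\<lambda>w. dir_deriv (\<lambda>y. L y w) x z)"
proof (rule linearI)
  fix v w
  have "((\<lambda>y. L y (v + w)) has_derivative (\<lambda>z. dir_deriv (\<lambda>y. L y v) x z + dir_deriv (\<lambda>y. L y w) x z)) (at x)"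
  proof (subst has_derivative_cong_open[OF assms(1,2)])
    show "L y (v + w) = L y v + L y w" if "y \<in> U" for y using lin[OF that] by (simp add: linear_add)
    show "((\<lambda>y. L y v + L y w) has_derivative (\<lambda>z. dir_deriv (\<lambda>y. L y v) x z + dir_deriv (\<lambda>y. L y w) x z)) (at x)"
      by (intro has_derivative_add has_derivative_dir_deriv diff)
  qed
  then show "dir_deriv (\<lambda>y. L y (v + w)) x z = dir_deriv (\<lambda>y. L y v) x z + dir_deriv (\<lambda>y. L y w) x z"
    by (simp add: dir_deriv_eqI)
next
  fix r v
  have "((\<lambda>y. L y (r *\<^sub>R v)) has_derivative (\<lambda>z. r *\<^sub>R dir_deriv (\<lambda>y. L y v) x z)) (at x)"
  proof (subst has_derivative_cong_open[OF assms(1,2)])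
    show "L y (r *\<^sub>R v) = r *\<^sub>R L y v" if "y \<in> U" for y using lin[OF that] by (simp add: linear_cmul)
    show "((\<lambda>y. r *\<^sub>R L y v) has_derivative (\<lambda>z. r *\<^sub>R dir_deriv (\<lambda>y. L y v) x z)) (at x)"
      by (intro has_derivative_scaleR_right has_derivative_dir_deriv diff)
  qed
  then show "dir_deriv (\<lambda>y. L y (r *\<^sub>R v)) x z = r *\<^sub>R dir_deriv (\<lambda>y. L y v) x z"
    by (simp add: dir_deriv_eqI)
qed

locale metric_patch =
  fixes U :: "'e::euclidean_space set" and G :: "'e \<Rightarrow> 'e \<Rightarrow> 'e \<Rightarrow> real"
  assumes open_U: "open U"
    and G_linear_left: "\<And>x w. x \<in> U \<Longrightarrow> linear (\<lambda>v. G x v w)"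
    and G_sym: "\<And>x v w. x \<in> U \<Longrightarrow> G x v w = G x w v"
    and G_pos: "\<And>x v. x \<in> U \<Longrightarrow> v \<noteq> 0 \<Longrightarrow> G x v v > 0"
    and G_smooth: "\<And>v w. smooth_on U (\<lambda>x. G x v w)"
begin

text \<open>The notions of this locale have the shape of \<open>sharp\<close>,
  \<open>christoffel\<close> and \<open>curvature\<close> with \<open>G\<close> in place of the
  local metric, so that unfolding identifies them later for every chart.\<close>

definition shp :: "'e \<Rightarrow> ('e \<Rightarrow> real) \<Rightarrow> 'e" where
  "shp x \<alpha> = (THE u. \<forall>w. G x u w = \<alpha> w)"

definition dG :: "'e \<Rightarrow> 'e \<Rightarrow> 'e \<Rightarrow> 'e \<Rightarrow> real" where
  "dG x z v w = dir_deriv (\<lambda>y. G y v w) x z"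

text \<open>The Christoffel symbols of the first kind, as a trilinear form.\<close>

definition koszul :: "'e \<Rightarrow> 'e \<Rightarrow> 'e \<Rightarrow> 'e \<Rightarrow> real" where
  "koszul x v w z = (dG x v w z + dG x w v z - dG x z v w) / 2"

definition Gam :: "'e \<Rightarrow> 'e \<Rightarrow> 'e \<Rightarrow> 'e" where
  "Gam x v w = shp x (koszul x v w)"

definition dGam :: "'e \<Rightarrow> 'e \<Rightarrow> 'e \<Rightarrow> 'e \<Rightarrow> 'e" where
  "dGam x z v w = dir_deriv (\<lambda>y. Gam y v w) x z"

definition Rm :: "'e \<Rightarrow> 'e \<Rightarrow> 'e \<Rightarrow> 'e \<Rightarrow> 'e" where
  "Rm x u v w = dGam x u v w - dGam x v u w + Gam x u (Gam x v w) - Gam x v (Gam x u w)"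

lemma G_linear_right: "x \<in> U \<Longrightarrow> linear (G x v)"
proof -
  assume "x \<in> U"
  moreover then have "G x v = (\<lambda>w. G x w v)" using G_sym by auto
  ultimately show ?thesis using G_linear_left by metis
qed

lemma G_simps:
  assumes "x \<in> U"
  shows "G x (u + v) w = G x u w + G x v w" "G x (u - v) w = G x u w - G x v w"
    "G x (a *\<^sub>R v) w = a * G x v w" "G x (- v) w = - G x v w" "G x 0 w = 0"
    "G x w (u + v) = G x w u + G x w v" "G x w (u - v) = G x w u - G x w v"
    "G x w (a *\<^sub>R v) = a * G x w v" "G x w (- v) = - G x w v" "G x w 0 = 0"
  using linear_add[OF G_linear_left[OF assms]] linear_add[OF G_linear_right[OF assms]]
    linear_diff[OF G_linear_left[OF assms]] linear_diff[OF G_linear_right[OF assms]]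
    linear_cmul[OF G_linear_left[OF assms]] linear_cmul[OF G_linear_right[OF assms]]
    linear_neg[OF G_linear_left[OF assms]] linear_neg[OF G_linear_right[OF assms]]
    linear_0[OF G_linear_left[OF assms]] linear_0[OF G_linear_right[OF assms]]
  by auto

lemma G_nonneg: "x \<in> U \<Longrightarrow> G x v v \<ge> 0"
  using G_pos[of x v] by (cases "v = 0") (auto simp: G_simps)

lemma G_nondegenerate: "x \<in> U \<Longrightarrow> (\<And>w. G x u w = G x v w) \<Longrightarrow> u = v"
  using G_pos[of x "u - v"] by (cases "u = v") (auto simp: G_simps)

lemma shp_eqI: "x \<in> U \<Longrightarrow> (\<And>w. G x u w = \<alpha> w) \<Longrightarrow> shp x \<alpha> = u"
  unfolding shp_def using G_nondegenerate by (intro the_equality) auto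

text \<open>Existence of the representing vector: the map \<open>T\<close>, which lists the values
  of \<open>G x u\<close> on the basis, is injective by nondegeneracy and hence surjective in finite
  dimension.\<close>

lemma G_shp:
  assumes "x \<in> U" "linear \<alpha>" shows "G x (shp x \<alpha>) w = \<alpha> w"
proof -
  define T where "T = (\<lambda>u. \<Sum>b\<in>Basis. G x u b *\<^sub>R b)"
  have lT: "linear T" unfolding T_def
    by (rule linearI) (simp_all add: G_simps[OF assms(1)] scaleR_add_left sum.distrib scaleR_sum_right)
  have T: "T u \<bullet> b = G x u b" if "b \<in> Basis" for u b
    using that by (simp add: T_def inner_sum_left inner_Basis if_distrib cong: if_cong)
  have exp: "\<beta> w = (\<Sum>b\<in>Basis. (w \<bullet> b) * \<beta> b)" if "linear \<beta>" for \<beta> :: "'e \<Rightarrow> real" and w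
    using linear_basis_expansion[OF that, of w] by simp
  have "inj T"
  proof (rule injI)
    fix u v assume "T u = T v"
    then have "G x u b = G x v b" if "b \<in> Basis" for b using T that by metis
    then have "G x u w = G x v w" for w
      using exp[OF G_linear_right[OF assms(1)], of u w] exp[OF G_linear_right[OF assms(1)], of v w] by simp
    then show "u = v" using G_nondegenerate[OF assms(1)] by blast
  qed
  then have "surj T" using linear_injective_imp_surjective[OF lT] by simp
  then obtain u where u: "T u = (\<Sum>b\<in>Basis. \<alpha> b *\<^sub>R b)" by (metis surjD)
  have "G x u b = \<alpha> b" if "b \<in> Basis" for b
    using that T[OF that, of u] unfolding u by (simp add: inner_sum_left inner_Basis if_distrib cong: if_cong)
  then have "G x u w = \<alpha> w" for w
    using exp[OF assms(2), of w] exp[OF G_linear_right[OF assms(1)], of u w] by simp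
  then show ?thesis using shp_eqI[OF assms(1)] by metis
qed

lemma G_differentiable: "x \<in> U \<Longrightarrow> (\<lambda>y. G y v w) differentiable (at x)"
  by (rule smooth_onD(2)[OF G_smooth])

lemma dG_linear:
  assumes "x \<in> U"
  shows "linear (\<lambda>z. dG x z v w)" "linear (\<lambda>v. dG x z v w)" "linear (dG x z v)"
  unfolding dG_def
  by (rule linear_dir_deriv[OF G_differentiable[OF assms]],
      rule linear_dir_deriv_family[OF open_U assms G_linear_left G_differentiable[OF assms]], assumption,
      rule linear_dir_deriv_family[OF open_U assms G_linear_right G_differentiable[OF assms]], assumption)

lemma dG_sym: "x \<in> U \<Longrightarrow> dG x z v w = dG x z w v"
  unfolding dG_def by (subst dir_deriv_cong_open[OF open_U _ G_sym]) auto

lemma dG_simps: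
  assumes "x \<in> U"
  shows "dG x (u + v) w z = dG x u w z + dG x v w z" "dG x (a *\<^sub>R v) w z = a * dG x v w z"
    "dG x w (u + v) z = dG x w u z + dG x w v z" "dG x w (a *\<^sub>R v) z = a * dG x w v z"
    "dG x w z (u + v) = dG x w z u + dG x w z v" "dG x w z (a *\<^sub>R v) = a * dG x w z v"
  using linear_add[OF dG_linear(1)[OF assms]] linear_cmul[OF dG_linear(1)[OF assms]]
    linear_add[OF dG_linear(2)[OF assms]] linear_cmul[OF dG_linear(2)[OF assms]]
    linear_add[OF dG_linear(3)[OF assms]] linear_cmul[OF dG_linear(3)[OF assms]]
  by auto

lemma dG_smooth: "smooth_on U (\<lambda>x. dG x z v w)"
  unfolding dG_def by (rule smooth_onD(3)[OF G_smooth])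

lemma dG_differentiable: "x \<in> U \<Longrightarrow> (\<lambda>y. dG y z v w) differentiable (at x)"
  by (rule smooth_onD(2)[OF dG_smooth])

lemma koszul_linear: "x \<in> U \<Longrightarrow> linear (koszul x v w)"
  by (rule linearI) (simp_all add: koszul_def dG_simps field_simps)

lemma G_Gam: "x \<in> U \<Longrightarrow> G x (Gam x v w) z = koszul x v w z"
  unfolding Gam_def by (rule G_shp[OF _ koszul_linear])

lemma Gam_eqI: "x \<in> U \<Longrightarrow> (\<And>z. G x u z = koszul x v w z) \<Longrightarrow> Gam x v w = u"
  unfolding Gam_def by (rule shp_eqI)

lemma Gam_sym: "x \<in> U \<Longrightarrow> Gam x v w = Gam x w v"
  by (intro Gam_eqI) (auto simp: G_Gam koszul_def dG_sym[of x _ v w])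

lemma Gam_linear:
  assumes "x \<in> U" shows "linear (\<lambda>v. Gam x v w)" "linear (Gam x v)"
proof -
  show 1: "linear (\<lambda>v. Gam x v w)" for w using assms
    by (intro linearI) (intro Gam_eqI, auto simp: G_simps G_Gam koszul_def dG_simps field_simps)+
  have "Gam x v = (\<lambda>w. Gam x w v)" using Gam_sym[OF assms] by auto
  then show "linear (Gam x v)" using 1[of v] by simp
qed

lemma Gam_simps:
  assumes "x \<in> U"
  shows "Gam x (u + v) w = Gam x u w + Gam x v w" "Gam x (a *\<^sub>R v) w = a *\<^sub>R Gam x v w"
    "Gam x (- v) w = - Gam x v w" "Gam x (u - v) w = Gam x u w - Gam x v w" "Gam x 0 w = 0"
    "Gam x w (u + v) = Gam x w u + Gam x w v" "Gam x w (a *\<^sub>R v) = a *\<^sub>R Gam x w v"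
    "Gam x w (- v) = - Gam x w v" "Gam x w (u - v) = Gam x w u - Gam x w v" "Gam x w 0 = 0"
  using linear_add[OF Gam_linear(1)[OF assms]] linear_cmul[OF Gam_linear(1)[OF assms]]
    linear_neg[OF Gam_linear(1)[OF assms]] linear_diff[OF Gam_linear(1)[OF assms]] linear_0[OF Gam_linear(1)[OF assms]]
    linear_add[OF Gam_linear(2)[OF assms]] linear_cmul[OF Gam_linear(2)[OF assms]]
    linear_neg[OF Gam_linear(2)[OF assms]] linear_diff[OF Gam_linear(2)[OF assms]] linear_0[OF Gam_linear(2)[OF assms]]
  by auto

lemma dG_eq_Gam: "x \<in> U \<Longrightarrow> dG x z v w = G x (Gam x z v) w + G x v (Gam x z w)"
  by (simp add: G_sym[of x v] G_Gam koszul_def dG_sym[of x _ v w] field_simps)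

lemma continuous_on_G:
  assumes "continuous_on T x" "x ` T \<subseteq> U" "continuous_on T v" "continuous_on T w"
  shows "continuous_on T (\<lambda>s. G (x s) (v s) (w s))"
  by (rule continuous_on_bilinear_family[OF G_linear_left G_linear_right smooth_onD(1)[OF G_smooth] assms])

section \<open>Uniform bounds for the metric and regularity of index raising\<close>

lemma G_lower_bound:
  assumes "compact K" "K \<subseteq> U"
  shows "\<exists>m>0. \<forall>x\<in>K. \<forall>v. G x v v \<ge> m * (norm v)\<^sup>2"
proof (cases "K = {}")
  case False
  have c: "continuous_on (K \<times> sphere 0 1) (\<lambda>z. G (fst z) (snd z) (snd z))"
    using assms by (intro continuous_on_G continuous_intros) auto
  have ne: "K \<times> sphere (0::'e) 1 \<noteq> {}"
    using False nonempty_Basis by (auto simp: times_eq_iff)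
  obtain z where z: "z \<in> K \<times> sphere 0 1" "\<And>y. y \<in> K \<times> sphere 0 1 \<Longrightarrow> G (fst z) (snd z) (snd z) \<le> G (fst y) (snd y) (snd y)"
    using continuous_attains_inf[OF _ ne c] assms(1) compact_Times compact_sphere by metis
  define m where "m = G (fst z) (snd z) (snd z)"
  have "snd z \<noteq> 0" using z(1) by (auto simp: sphere_def)
  then have "m > 0" unfolding m_def using z(1) assms by (intro G_pos) auto
  moreover have "G x v v \<ge> m * (norm v)\<^sup>2" if "x \<in> K" for x v
  proof (cases "v = 0")
    case False
    have xU: "x \<in> U" using that assms by auto
    have "m \<le> G x ((1 / norm v) *\<^sub>R v) ((1 / norm v) *\<^sub>R v)"
      unfolding m_def using z(2)[of "(x, (1 / norm v) *\<^sub>R v)"] that False by simp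
    also have "\<dots> = G x v v / (norm v)\<^sup>2" by (simp add: G_simps[OF xU] power2_eq_square)
    finally show ?thesis using False by (simp add: field_simps)
  qed (use that assms G_nonneg in auto)
  ultimately show ?thesis by blast
qed (auto intro: exI[of _ 1])

lemma G_upper_bound:
  assumes "compact K" "K \<subseteq> U"
  shows "\<exists>M>0. \<forall>x\<in>K. \<forall>v. G x v v \<le> M * (norm v)\<^sup>2"
proof (cases "K = {}")
  case False
  have c: "continuous_on (K \<times> sphere 0 1) (\<lambda>z. G (fst z) (snd z) (snd z))"
    using assms by (intro continuous_on_G continuous_intros) auto
  have ne: "K \<times> sphere (0::'e) 1 \<noteq> {}"
    using False nonempty_Basis by (auto simp: times_eq_iff)
  obtain z where z: "z \<in> K \<times> sphere 0 1" "\<And>y. y \<in> K \<times> sphere 0 1 \<Longrightarrow> G (fst z) (snd z) (snd z) \<ge> G (fst y) (snd y) (snd y)"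
    using continuous_attains_sup[OF _ ne c] assms(1) compact_Times compact_sphere by metis
  define m where "m = G (fst z) (snd z) (snd z)"
  have "snd z \<noteq> 0" using z(1) by (auto simp: sphere_def)
  then have "m > 0" unfolding m_def using z(1) assms by (intro G_pos) auto
  moreover have "G x v v \<le> m * (norm v)\<^sup>2" if "x \<in> K" for x v
  proof (cases "v = 0")
    case False
    have xU: "x \<in> U" using that assms by auto
    have "m \<ge> G x ((1 / norm v) *\<^sub>R v) ((1 / norm v) *\<^sub>R v)"
      unfolding m_def using z(2)[of "(x, (1 / norm v) *\<^sub>R v)"] that False by simp
    moreover have "G x ((1 / norm v) *\<^sub>R v) ((1 / norm v) *\<^sub>R v) = G x v v / (norm v)\<^sup>2" by (simp add: G_simps[OF xU] power2_eq_square)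
    ultimately show ?thesis using False by (simp add: field_simps)
  next
    case True
    have "x \<in> U" using that assms by auto
    then show ?thesis using True by (simp add: G_simps)
  qed
  ultimately show ?thesis by blast
qed (auto intro: exI[of _ 1])

text \<open>Expand \<open>G x u u\<close> in the second argument and cancel one factor
  \<open>norm u\<close>. This turns an estimate of the lowered vector on the basis into one of
  \<open>u\<close> itself, with a constant uniform over compact sets; it takes the role of the
  inverse matrix below.\<close>

lemma G_norm_bound:
  assumes "x \<in> U" "m > 0" "G x u u \<ge> m * (norm u)\<^sup>2"
  shows "norm u \<le> (\<Sum>b\<in>Basis. \<bar>G x u b\<bar>) / m"
proof (cases "u = 0")
  case False
  have "m * (norm u)\<^sup>2 \<le> (\<Sum>b\<in>Basis. (u \<bullet> b) * G x u b)"
    using assms(3) linear_basis_expansion[OF G_linear_right[OF assms(1)], of u u] by simp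
  also have "\<dots> \<le> (\<Sum>b\<in>Basis. norm u * \<bar>G x u b\<bar>)"
  proof (rule sum_mono)
    fix b :: 'e assume "b \<in> Basis"
    then have "\<bar>u \<bullet> b\<bar> * \<bar>G x u b\<bar> \<le> norm u * \<bar>G x u b\<bar>"
      by (intro mult_right_mono Basis_le_norm) auto
    then show "(u \<bullet> b) * G x u b \<le> norm u * \<bar>G x u b\<bar>"
      by (metis abs_ge_self abs_mult order_trans)
  qed
  finally have "norm u * (m * norm u) \<le> norm u * (\<Sum>b\<in>Basis. \<bar>G x u b\<bar>)"
    by (simp add: power2_eq_square sum_distrib_left mult_ac)
  then show ?thesis using False assms(2) by (simp add: field_simps)
qed (use assms in \<open>auto intro: divide_nonneg_pos sum_nonneg\<close>)

lemma shp_tendsto_bound: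
  assumes "x \<in> U" shows "\<exists>m>0. \<forall>\<^sub>F y in at x. y \<in> U \<and> (\<forall>u. norm u \<le> (\<Sum>b\<in>Basis. \<bar>G y u b\<bar>) / m)"
proof -
  obtain r where r: "r > 0" "cball x r \<subseteq> U" using open_contains_cball assms open_U by blast
  obtain m where m: "m > 0" "\<forall>y\<in>cball x r. \<forall>v. G y v v \<ge> m * (norm v)\<^sup>2"
    using G_lower_bound[OF compact_cball r(2)] by blast
  have "\<forall>\<^sub>F y in at x. y \<in> ball x r" using r(1) by (metis centre_in_ball open_ball eventually_at_topological)
  then show ?thesis using m r(2)
    by (intro exI[of _ m] conjI) (auto elim!: eventually_mono intro!: G_norm_bound)
qed

text \<open>With \<open>u\<close> the value at \<open>x\<close>, lowering
  \<open>shp y (\<alpha> y) - u\<close> at \<open>y\<close> gives \<open>\<alpha> y - G y u\<close>,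
  which tends to 0 on every basis vector.\<close>

lemma continuous_on_shp:
  assumes lin: "\<And>x. x \<in> U \<Longrightarrow> linear (\<alpha> x)" and c: "\<And>b. continuous_on U (\<lambda>x. \<alpha> x b)"
  shows "continuous_on U (\<lambda>x. shp x (\<alpha> x))"
proof (rule continuous_at_imp_continuous_on, rule ballI)
  fix x assume x: "x \<in> U"
  define u where "u = shp x (\<alpha> x)"
  obtain m where m: "m > 0" "\<forall>\<^sub>F y in at x. y \<in> U \<and> (\<forall>u. norm u \<le> (\<Sum>b\<in>Basis. \<bar>G y u b\<bar>) / m)"
    using shp_tendsto_bound[OF x] by blast
  have "((\<lambda>y. (\<Sum>b\<in>Basis. \<bar>\<alpha> y b - G y u b\<bar>) / m) \<longlongrightarrow> (\<Sum>b\<in>Basis. \<bar>\<alpha> x b - G x u b\<bar>) / m) (at x)"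
    using c smooth_onD(1)[OF G_smooth] open_U x m(1)
    by (intro tendsto_intros) (auto simp: continuous_on_eq_continuous_at isCont_def)
  then have lim: "((\<lambda>y. (\<Sum>b\<in>Basis. \<bar>\<alpha> y b - G y u b\<bar>) / m) \<longlongrightarrow> 0) (at x)"
    by (simp add: u_def G_shp[OF x lin[OF x]])
  have "\<forall>\<^sub>F y in at x. norm (shp y (\<alpha> y) - u) \<le> (\<Sum>b\<in>Basis. \<bar>\<alpha> y b - G y u b\<bar>) / m"
    using m(2)
  proof eventually_elim
    case (elim y)
    have "G y (shp y (\<alpha> y) - u) b = \<alpha> y b - G y u b" for b using elim G_shp[OF _ lin, of y] by (simp add: G_simps)
    then show ?case using elim by (metis (no_types, lifting) sum.cong)
  qed
  then have "((\<lambda>y. shp y (\<alpha> y) - u) \<longlongrightarrow> 0) (at x)"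
    using lim by (rule Lim_null_comparison)
  then show "isCont (\<lambda>x. shp x (\<alpha> x)) x" unfolding isCont_def u_def[symmetric] by (simp add: LIM_zero_iff)
qed

lemma shp_linear_combination:
  assumes "x \<in> U" "linear \<alpha>" "linear \<beta>"
  shows "shp x (\<lambda>w. \<alpha> w + \<beta> w) = shp x \<alpha> + shp x \<beta>" "shp x (\<lambda>w. c * \<alpha> w) = c *\<^sub>R shp x \<alpha>"
  using assms by (auto intro!: shp_eqI simp: G_simps G_shp)

text \<open>Implicit differentiation of \<open>G y (shp y (\<alpha> y)) w = \<alpha> y w\<close>
  forces \<open>G x (D h) w = \<beta> h w\<close> for the derivative \<open>D\<close>. The candidate
  is then verified by lowering the remainder at \<open>y\<close>.\<close>

lemma shp_has_derivative:
  assumes lin: "\<And>y. y \<in> U \<Longrightarrow> linear (\<alpha> y)" and diff: "\<And>b. (\<lambda>y. \<alpha> y b) differentiable (at x)" and x: "x \<in> U"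
  shows "((\<lambda>y. shp y (\<alpha> y)) has_derivative
     (\<lambda>h. shp x (\<lambda>w. dir_deriv (\<lambda>y. \<alpha> y w) x h - dG x h (shp x (\<alpha> x)) w))) (at x)"
proof -
  define u where "u = shp x (\<alpha> x)"
  define \<beta> where "\<beta> = (\<lambda>h w. dir_deriv (\<lambda>y. \<alpha> y w) x h - dG x h u w)"
  define D where "D = (\<lambda>h. shp x (\<beta> h))"
  have l\<beta>: "linear (\<beta> h)" for h unfolding \<beta>_def
    by (intro linear_compose_sub linear_dir_deriv_family[OF open_U x lin diff] dG_linear(3)[OF x])
  have l\<beta>2: "\<beta> (h + k) w = \<beta> h w + \<beta> k w" "\<beta> (c *\<^sub>R h) w = c * \<beta> h w" for h k c w
    using linear_add[OF linear_dir_deriv[OF diff]] linear_cmul[OF linear_dir_deriv[OF diff]]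
    by (auto simp: \<beta>_def dG_simps[OF x] algebra_simps)
  have lD: "linear D"
  proof (rule linearI)
    show "D (h + k) = D h + D k" for h k
      unfolding D_def shp_linear_combination(1)[OF x l\<beta> l\<beta>, symmetric] l\<beta>2(1)[symmetric] ..
    show "D (c *\<^sub>R h) = c *\<^sub>R D h" for c h
      unfolding D_def shp_linear_combination(2)[OF x l\<beta> l\<beta>, symmetric] l\<beta>2(2)[symmetric] ..
  qed
  then have bD: "bounded_linear D" using linear_conv_bounded_linear by blast
  obtain m where m: "m > 0" "\<forall>\<^sub>F y in at x. y \<in> U \<and> (\<forall>u. norm u \<le> (\<Sum>b\<in>Basis. \<bar>G y u b\<bar>) / m)"
    using shp_tendsto_bound[OF x] by blast
  \<comment> \<open>\<open>ra\<close> and \<open>rg\<close> are the first-order remainders of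
    \<open>\<alpha>\<close> and of \<open>G\<close> applied to the fixed vector \<open>u\<close>;
    \<open>q\<close> measures the error of lowering at \<open>y\<close> what should be lowered at
    \<open>x\<close>.\<close>
  define ra where "ra = (\<lambda>b y. \<alpha> y b - \<alpha> x b - dir_deriv (\<lambda>y. \<alpha> y b) x (y - x))"
  define rg where "rg = (\<lambda>b y. G y u b - G x u b - dG x (y - x) u b)"
  define q where "q = (\<lambda>i b y. G y i b - G x i b)"
  have ra: "((\<lambda>y. norm (ra b y) / norm (y - x)) \<longlongrightarrow> 0) (at x)" for b
    using has_derivative_dir_deriv[OF diff[of b]] unfolding ra_def has_derivative_iff_norm by simp
  have rg: "((\<lambda>y. norm (rg b y) / norm (y - x)) \<longlongrightarrow> 0) (at x)" for b
    using has_derivative_dir_deriv[OF G_differentiable[OF x, of u b]] unfolding rg_def has_derivative_iff_norm dG_def by simp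
  have q: "((\<lambda>y. q i b y) \<longlongrightarrow> 0) (at x)" for i b
    using smooth_onD(1)[OF G_smooth] open_U x unfolding q_def
    by (auto simp: continuous_on_eq_continuous_at isCont_def LIM_zero_iff)
  define bnd where "bnd = (\<lambda>y. (\<Sum>b\<in>Basis. norm (ra b y) / norm (y - x) + norm (rg b y) / norm (y - x)
      + onorm D * (\<Sum>i\<in>Basis. \<bar>q i b y\<bar>)) / m)"
  have "(bnd \<longlongrightarrow> (\<Sum>b\<in>(Basis::'e set). 0 + 0 + onorm D * (\<Sum>i\<in>(Basis::'e set). \<bar>0\<bar>)) / m) (at x)"
    unfolding bnd_def using m(1) by (intro tendsto_intros ra rg q) auto
  then have bnd0: "(bnd \<longlongrightarrow> 0) (at x)" by simp
  have "\<forall>\<^sub>F y in at x. norm (norm (shp y (\<alpha> y) - u - D (y - x)) / norm (y - x)) \<le> bnd y"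
    using m(2) eventually_neq_at_within[of x x UNIV]
  proof eventually_elim
    case (elim y)
    then have y: "y \<in> U" and n: "norm (y - x) > 0" by auto
    \<comment> \<open>The first-order terms cancel by the choice of \<open>D\<close>; everything
      left is \<open>o(norm (y - x))\<close>.\<close>
    have e: "G y (shp y (\<alpha> y) - u - D (y - x)) b = ra b y - rg b y - (\<Sum>i\<in>Basis. (D (y - x) \<bullet> i) * q i b y)" for b
    proof -
      have "G y (D (y - x)) b - G x (D (y - x)) b = (\<Sum>i\<in>Basis. (D (y - x) \<bullet> i) * q i b y)"
        using linear_basis_expansion[OF G_linear_left[OF y], of "D (y - x)" b]
          linear_basis_expansion[OF G_linear_left[OF x], of "D (y - x)" b]
        by (simp add: q_def sum_subtractf algebra_simps)
      moreover have "G x (D (y - x)) b = dir_deriv (\<lambda>y. \<alpha> y b) x (y - x) - dG x (y - x) u b"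
        unfolding D_def G_shp[OF x l\<beta>] by (simp add: \<beta>_def)
      moreover have "G x u b = \<alpha> x b" unfolding u_def G_shp[OF x lin[OF x]] ..
      moreover have "G y (shp y (\<alpha> y)) b = \<alpha> y b" by (rule G_shp[OF y lin[OF y]])
      ultimately show ?thesis by (simp add: G_simps[OF y] ra_def rg_def)
    qed
    have eb: "\<bar>G y (shp y (\<alpha> y) - u - D (y - x)) b\<bar> \<le>
        norm (ra b y) + norm (rg b y) + onorm D * norm (y - x) * (\<Sum>i\<in>Basis. \<bar>q i b y\<bar>)" for b
    proof -
      have "\<bar>\<Sum>i\<in>Basis. (D (y - x) \<bullet> i) * q i b y\<bar> \<le> (\<Sum>i\<in>Basis. \<bar>(D (y - x) \<bullet> i) * q i b y\<bar>)"
        by (rule sum_abs)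
      also have "\<dots> \<le> (\<Sum>i\<in>Basis. (onorm D * norm (y - x)) * \<bar>q i b y\<bar>)"
      proof (rule sum_mono)
        fix i :: 'e assume "i \<in> Basis"
        then have "\<bar>D (y - x) \<bullet> i\<bar> \<le> onorm D * norm (y - x)"
          using onorm[OF bD, of "y - x"] Basis_le_norm[of i "D (y - x)"] by linarith
        then show "\<bar>(D (y - x) \<bullet> i) * q i b y\<bar> \<le> (onorm D * norm (y - x)) * \<bar>q i b y\<bar>"
          by (simp add: abs_mult mult_right_mono)
      qed
      also have "\<dots> = onorm D * norm (y - x) * (\<Sum>i\<in>Basis. \<bar>q i b y\<bar>)" by (simp add: sum_distrib_left)
      finally show ?thesis unfolding e real_norm_def by linarith
    qed
    have "norm (shp y (\<alpha> y) - u - D (y - x)) \<le> (\<Sum>b\<in>Basis. \<bar>G y (shp y (\<alpha> y) - u - D (y - x)) b\<bar>) / m"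
      using elim by blast
    also have "\<dots> \<le> (\<Sum>b\<in>Basis. norm (ra b y) + norm (rg b y) + onorm D * norm (y - x) * (\<Sum>i\<in>Basis. \<bar>q i b y\<bar>)) / m"
      using m(1) by (intro divide_right_mono sum_mono eb) auto
    finally have "norm (shp y (\<alpha> y) - u - D (y - x)) / norm (y - x) \<le> (\<Sum>b\<in>Basis. norm (ra b y) + norm (rg b y) + onorm D * norm (y - x) * (\<Sum>i\<in>Basis. \<bar>q i b y\<bar>)) / m / norm (y - x)"
      using n by (intro divide_right_mono) auto
    also have "\<dots> = (\<Sum>b\<in>Basis. (norm (ra b y) + norm (rg b y) + onorm D * norm (y - x) * (\<Sum>i\<in>Basis. \<bar>q i b y\<bar>)) / norm (y - x)) / m"
      by (simp add: sum_divide_distrib mult.commute)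
    also have "\<dots> = bnd y" unfolding bnd_def using n
      by (intro arg_cong2[where f = divide] sum.cong) (auto simp: add_divide_distrib)
    finally show ?case by simp
  qed
  then have "((\<lambda>y. norm (shp y (\<alpha> y) - u - D (y - x)) / norm (y - x)) \<longlongrightarrow> 0) (at x)"
    using bnd0 by (rule Lim_null_comparison)
  then show ?thesis
    unfolding has_derivative_iff_norm using bD by (simp add: D_def \<beta>_def u_def)
qed

end

context metric_patch begin

section \<open>Christoffel symbols, the covariant product rule and curvature\<close>

lemma koszul_differentiable: "x \<in> U \<Longrightarrow> (\<lambda>y. koszul y v w z) differentiable (at x)"
  unfolding koszul_def by (intro derivative_intros dG_differentiable) auto

lemma Gam_has_derivative:
  assumes "x \<in> U"
  shows "((\<lambda>y. Gam y v w) has_derivative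
     (\<lambda>h. shp x (\<lambda>z. dir_deriv (\<lambda>y. koszul y v w z) x h - dG x h (Gam x v w) z))) (at x)"
  using shp_has_derivative[of "\<lambda>y. koszul y v w", OF koszul_linear koszul_differentiable[OF assms] assms]
  unfolding Gam_def .

lemma Gam_differentiable: "x \<in> U \<Longrightarrow> (\<lambda>y. Gam y v w) differentiable (at x)"
  using Gam_has_derivative unfolding differentiable_def by blast

lemma continuous_on_Gam_point: "continuous_on U (\<lambda>y. Gam y v w)"
  using Gam_differentiable open_U
  by (simp add: continuous_on_eq_continuous_at differentiable_imp_continuous_within)

lemma dGam_linear:
  assumes "x \<in> U"
  shows "linear (\<lambda>z. dGam x z v w)" "linear (\<lambda>v. dGam x z v w)" "linear (dGam x z v)"
  unfolding dGam_def
  by (rule linear_dir_deriv[OF Gam_differentiable[OF assms]],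
      rule linear_dir_deriv_family[OF open_U assms Gam_linear(1) Gam_differentiable[OF assms]], assumption,
      rule linear_dir_deriv_family[OF open_U assms Gam_linear(2) Gam_differentiable[OF assms]], assumption)

lemma dGam_simps:
  assumes "x \<in> U"
  shows "dGam x (u + v) w z = dGam x u w z + dGam x v w z" "dGam x (a *\<^sub>R v) w z = a *\<^sub>R dGam x v w z"
    "dGam x w (u + v) z = dGam x w u z + dGam x w v z" "dGam x w (a *\<^sub>R v) z = a *\<^sub>R dGam x w v z"
    "dGam x w z (u + v) = dGam x w z u + dGam x w z v" "dGam x w z (a *\<^sub>R v) = a *\<^sub>R dGam x w z v"
  using linear_add[OF dGam_linear(1)[OF assms]] linear_cmul[OF dGam_linear(1)[OF assms]]
    linear_add[OF dGam_linear(2)[OF assms]] linear_cmul[OF dGam_linear(2)[OF assms]]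
    linear_add[OF dGam_linear(3)[OF assms]] linear_cmul[OF dGam_linear(3)[OF assms]]
  by auto

lemma dGam_sym: "x \<in> U \<Longrightarrow> dGam x z v w = dGam x z w v"
  unfolding dGam_def by (subst dir_deriv_cong_open[OF open_U _ Gam_sym]) auto

lemma continuous_on_Gam:
  assumes "continuous_on T x" "x ` T \<subseteq> U" "continuous_on T v" "continuous_on T w"
  shows "continuous_on T (\<lambda>s. Gam (x s) (v s) (w s))"
  by (rule continuous_on_bilinear_family[OF Gam_linear continuous_on_Gam_point assms])

text \<open>The derivative formula for \<open>shp\<close> shows \<open>dGam\<close> to be again a
  raised covector, with continuous components, so continuity of \<open>shp\<close> applies once
  more.\<close>

lemma continuous_on_dGam_point: "continuous_on U (\<lambda>x. dGam x h v w)"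
proof -
  have e: "dGam x h v w = shp x (\<lambda>z. dir_deriv (\<lambda>y. koszul y v w z) x h - dG x h (Gam x v w) z)" if "x \<in> U" for x
    unfolding dGam_def dir_deriv_eqI[OF Gam_has_derivative[OF that]] ..
  have "continuous_on U (\<lambda>x. shp x (\<lambda>z. dir_deriv (\<lambda>y. koszul y v w z) x h - dG x h (Gam x v w) z))"
  proof (rule continuous_on_shp)
    fix x assume x: "x \<in> U"
    show "linear (\<lambda>z. dir_deriv (\<lambda>y. koszul y v w z) x h - dG x h (Gam x v w) z)"
      by (intro linear_compose_sub linear_dir_deriv_family[OF open_U x koszul_linear koszul_differentiable[OF x]] dG_linear(3)[OF x])
  next
    fix b
    have e: "dir_deriv (\<lambda>y. koszul y v w b) x h =
       (dir_deriv (\<lambda>y. dG y v w b) x h + dir_deriv (\<lambda>y. dG y w v b) x h - dir_deriv (\<lambda>y. dG y b v w) x h) / 2"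
      if "x \<in> U" for x
    proof -
      have "((\<lambda>y. koszul y v w b) has_derivative (\<lambda>h.
        (dir_deriv (\<lambda>y. dG y v w b) x h + dir_deriv (\<lambda>y. dG y w v b) x h - dir_deriv (\<lambda>y. dG y b v w) x h) / 2)) (at x)"
        unfolding koszul_def
        by (rule bounded_linear.has_derivative[OF bounded_linear_divide])
           (intro has_derivative_diff has_derivative_add has_derivative_dir_deriv dG_differentiable that)
      then show ?thesis by (simp add: dir_deriv_eqI)
    qed
    have c: "continuous_on U (\<lambda>x. dir_deriv (\<lambda>y. dG y v w b) x h)" for v w b
      by (rule smooth_onD(1)[OF smooth_onD(3)[OF dG_smooth]])
    have "continuous_on U (\<lambda>x. (dir_deriv (\<lambda>y. dG y v w b) x h + dir_deriv (\<lambda>y. dG y w v b) x h - dir_deriv (\<lambda>y. dG y b v w) x h) / 2)"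
      by (intro continuous_intros c) auto
    then have 1: "continuous_on U (\<lambda>x. dir_deriv (\<lambda>y. koszul y v w b) x h)"
      by (rule continuous_on_eq) (simp add: e)
    have "continuous_on U (\<lambda>x. dG x h (Gam x v w) b)"
      by (rule continuous_on_linear_family[where L = "\<lambda>x u. dG x h u b", OF dG_linear(2) smooth_onD(1)[OF dG_smooth]])
         (auto intro: continuous_on_Gam_point continuous_on_id)
    with 1 show "continuous_on U (\<lambda>x. dir_deriv (\<lambda>y. koszul y v w b) x h - dG x h (Gam x v w) b)"
      by (intro continuous_intros)
  qed
  then show ?thesis by (rule continuous_on_eq) (rule e[symmetric])
qed

lemma continuous_on_dGam:
  assumes "continuous_on T x" "x ` T \<subseteq> U" "continuous_on T u" "continuous_on T v" "continuous_on T w"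
  shows "continuous_on T (\<lambda>s. dGam (x s) (u s) (v s) (w s))"
  by (rule continuous_on_trilinear_family[OF dGam_linear continuous_on_dGam_point assms])

text \<open>Compatibility with the metric along a curve: \<open>dG_eq_Gam\<close> distributes the
  derivative of \<open>G\<close> over its two arguments and so completes \<open>v'\<close> and
  \<open>w'\<close> to covariant derivatives.\<close>

lemma G_has_vector_derivative:
  assumes x: "(x has_vector_derivative x') (at t within S)" "x t \<in> U" "t \<in> S"
    and "(v has_vector_derivative v') (at t within S)"
    and "(w has_vector_derivative w') (at t within S)"
  shows "((\<lambda>s. G (x s) (v s) (w s)) has_vector_derivative
      G (x t) (v' + Gam (x t) x' (v t)) (w t) + G (x t) (v t) (w' + Gam (x t) x' (w t))) (at t within S)"
  using has_vector_derivative_bilinear_family[of U G, OF open_U G_linear_left G_linear_right G_differentiable[OF x(2)] assms]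
  unfolding dG_def[symmetric] dG_eq_Gam[OF x(2)] by (simp add: G_simps[OF x(2)] algebra_simps)

lemma Gam_has_vector_derivative:
  assumes x: "(x has_vector_derivative x') (at t within S)" "x t \<in> U" "t \<in> S"
    and "(v has_vector_derivative v') (at t within S)"
    and "(w has_vector_derivative w') (at t within S)"
  shows "((\<lambda>s. Gam (x s) (v s) (w s)) has_vector_derivative
      dGam (x t) x' (v t) (w t) + Gam (x t) v' (w t) + Gam (x t) (v t) w') (at t within S)"
  using has_vector_derivative_bilinear_family[of U Gam, OF open_U Gam_linear Gam_differentiable[OF x(2)] assms]
  unfolding dGam_def[symmetric] .

text \<open>The identity \<open>dG_eq_Gam\<close> is differentiated along the line through
  \<open>x\<close> in direction \<open>a\<close>, by means of the covariant product rule.\<close>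

lemma ddG_eq:
  assumes "x \<in> U"
  shows "dir_deriv (\<lambda>y. dG y b v w) x a =
     G x (dGam x a b v + Gam x a (Gam x b v)) w + G x (Gam x b v) (Gam x a w)
     + G x (Gam x a v) (Gam x b w) + G x v (dGam x a b w + Gam x a (Gam x b w))"
proof -
  let ?l = "\<lambda>s. x + s *\<^sub>R a"
  have l: "(?l has_vector_derivative a) (at 0)" "?l 0 \<in> U"
    using assms unfolding has_vector_derivative_def by (auto intro!: derivative_eq_intros)
  have c: "((\<lambda>s. u) has_vector_derivative 0) (at t within S)" for u :: 'e and t :: real and S by simp
  have g: "((\<lambda>s. Gam (?l s) b u) has_vector_derivative dGam x a b u) (at 0)" for u
    using Gam_has_vector_derivative[OF l UNIV_I c c, of b u] assms by (simp add: Gam_simps)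
  have 1: "((\<lambda>s. G (?l s) (Gam (?l s) b v) w + G (?l s) v (Gam (?l s) b w)) has_vector_derivative
     (G x (dGam x a b v + Gam x a (Gam x b v)) w + G x (Gam x b v) (0 + Gam x a w)
     + (G x (0 + Gam x a v) (Gam x b w) + G x v (dGam x a b w + Gam x a (Gam x b w))))) (at 0)"
    using G_has_vector_derivative[OF l UNIV_I g c] G_has_vector_derivative[OF l UNIV_I c g]
    by (intro has_vector_derivative_add) auto
  have 2: "((\<lambda>s. dG (?l s) b v w) has_vector_derivative dir_deriv (\<lambda>y. dG y b v w) x a) (at 0)"
    using dir_deriv_line[OF dG_differentiable[OF l(2), of b v w]] by simp
  have 3: "\<forall>\<^sub>F s in at 0. G (?l s) (Gam (?l s) b v) w + G (?l s) v (Gam (?l s) b w) = dG (?l s) b v w"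
  proof -
    have "(?l \<longlongrightarrow> ?l 0) (at 0)" by (intro tendsto_intros)
    then have "\<forall>\<^sub>F s in at 0. ?l s \<in> U" using open_U l(2) by (auto dest: topological_tendstoD)
    then show ?thesis by eventually_elim (simp add: dG_eq_Gam)
  qed
  have "((\<lambda>s. dG (?l s) b v w) has_vector_derivative
     (G x (dGam x a b v + Gam x a (Gam x b v)) w + G x (Gam x b v) (0 + Gam x a w)
     + (G x (0 + Gam x a v) (Gam x b w) + G x v (dGam x a b w + Gam x a (Gam x b w))))) (at 0)"
    unfolding has_vector_derivative_def
    by (rule has_derivative_transform_eventually[OF 1[unfolded has_vector_derivative_def] 3])
       (simp_all add: dG_eq_Gam assms)
  from vector_derivative_unique_at[OF 2 this] show ?thesis by simp
qed

text \<open>Second derivatives of \<open>G\<close> commute. In \<open>ddG_eq\<close> the two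
  products of Christoffel terms are together symmetric in \<open>a\<close> and \<open>b\<close> and
  cancel; the surviving terms are the curvature paired with \<open>w\<close> and with
  \<open>v\<close>.\<close>

lemma Rm_antisym:
  assumes "x \<in> U" shows "G x (Rm x a b v) w = - G x v (Rm x a b w)"
proof -
  have "dir_deriv (\<lambda>y. dG y b v w) x a = dir_deriv (\<lambda>y. dG y a v w) x b"
    unfolding dG_def by (rule dir_deriv_symmetric[OF open_U assms G_smooth])
  then show ?thesis unfolding ddG_eq[OF assms] Rm_def by (simp add: G_simps[OF assms])
qed

section \<open>Orthonormal frames and traces\<close>

definition orthonormal_frame :: "'e \<Rightarrow> ('e \<Rightarrow> 'e) \<Rightarrow> bool" where
  "orthonormal_frame x E \<longleftrightarrow> (\<forall>i\<in>Basis. \<forall>j\<in>Basis. G x (E i) (E j) = (if i = j then 1 else 0))"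

lemma G_sum_left: "x \<in> U \<Longrightarrow> G x (sum g S) w = (\<Sum>a\<in>S. G x (g a) w)"
  by (rule linear_sum[OF G_linear_left])

text \<open>\<open>S\<close> builds a vector from coefficients and \<open>T\<close> reads them off;
  orthonormality is \<open>T (S v) = v\<close>. Finite dimension makes this one-sided inverse
  two-sided.\<close>

lemma frame_expansion:
  assumes x: "x \<in> U" and E: "orthonormal_frame x E"
  shows "v = (\<Sum>j\<in>Basis. G x v (E j) *\<^sub>R E j)"
proof -
  define T where "T = (\<lambda>v. \<Sum>b\<in>Basis. G x v (E b) *\<^sub>R b)"
  define S where "S = (\<lambda>v. \<Sum>b\<in>Basis. (v \<bullet> b) *\<^sub>R E b)"
  have "linear T" unfolding T_def
    by (rule linearI) (simp_all add: G_simps[OF x] scaleR_add_left sum.distrib scaleR_sum_right)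
  have "linear S" unfolding S_def
    by (rule linearI) (simp_all add: inner_add_left scaleR_add_left sum.distrib scaleR_sum_right)
  have "G x (S v) (E b) = v \<bullet> b" if "b \<in> Basis" for v b
  proof -
    have "G x (S v) (E b) = (\<Sum>i\<in>Basis. (v \<bullet> i) * G x (E i) (E b))"
      unfolding S_def by (simp add: G_sum_left[OF x] G_simps[OF x])
    also have "\<dots> = (\<Sum>i\<in>Basis. if i = b then v \<bullet> b else 0)"
      using E that unfolding orthonormal_frame_def by (intro sum.cong) auto
    also have "\<dots> = v \<bullet> b" using that by simp
    finally show ?thesis .
  qed
  then have TS: "T (S v) = v" for v unfolding T_def by (simp add: euclidean_representation)
  then have "inj S" by (metis injI)
  then have "surj S" using linear_injective_imp_surjective[OF \<open>linear S\<close>] by simp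
  then obtain u where u: "S u = v" by (metis surjD)
  have "S (T v) = v" using TS[of u] u by simp
  moreover have "T v \<bullet> b = G x v (E b)" if "b \<in> Basis" for b
    using that by (simp add: T_def inner_sum_left inner_Basis if_distrib cong: if_cong)
  ultimately show ?thesis unfolding S_def by simp
qed

text \<open>Each \<open>b\<close> is expanded in the frame, the sums are exchanged, and the sum over
  \<open>b\<close> reassembles \<open>T (E j)\<close>. This converts the coordinate traces in the
  Ricci tensor and in the Laplacian.\<close>

lemma trace_frame:
  assumes x: "x \<in> U" and E: "orthonormal_frame x E" and T: "linear T"
  shows "(\<Sum>b\<in>Basis. T b \<bullet> b) = (\<Sum>j\<in>Basis. G x (T (E j)) (E j))"
proof -
  have "T b \<bullet> b = (\<Sum>j\<in>Basis. G x b (E j) * (T (E j) \<bullet> b))" for b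
  proof -
    have "T b = (\<Sum>j\<in>Basis. G x b (E j) *\<^sub>R T (E j))"
      by (subst frame_expansion[OF x E, of b]) (simp add: linear_sum[OF T] linear_cmul[OF T])
    then show ?thesis by (simp add: inner_sum_left)
  qed
  then have "(\<Sum>b\<in>Basis. T b \<bullet> b) = (\<Sum>b\<in>Basis. \<Sum>j\<in>Basis. G x b (E j) * (T (E j) \<bullet> b))" by simp
  also have "\<dots> = (\<Sum>j\<in>Basis. \<Sum>b\<in>Basis. (T (E j) \<bullet> b) * G x b (E j))"
    by (subst sum.swap) (simp add: mult.commute)
  also have "\<dots> = (\<Sum>j\<in>Basis. G x (T (E j)) (E j))"
    by (intro sum.cong refl) (subst (2) linear_basis_expansion[OF G_linear_left[OF x]], simp)
  finally show ?thesis .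
qed

text \<open>An orthonormal set of greatest cardinality containing \<open>e\<close> spans: otherwise
  a vector outside its span could be projected off it and normalised. \<open>Basis\<close> serves as
  an index set of the right size, with the index \<open>b0\<close> reserved for
  \<open>e\<close>.\<close>

lemma ex_orthonormal_frame:
  assumes x: "x \<in> U" and e: "G x e e = 1" and b0: "b0 \<in> Basis"
  shows "\<exists>E. orthonormal_frame x E \<and> E b0 = e"
proof -
  define ON where "ON = (\<lambda>S. (\<forall>u\<in>S. \<forall>v\<in>S. G x u v = (if u = v then 1 else 0)))"
  have ind: "independent S" "card S \<le> DIM('e)" if fS: "finite S" and oS: "ON S" for S
  proof -
    show "independent S"
    proof (rule ccontr)
      assume "\<not> independent S"
      then obtain u where u: "(\<Sum>v\<in>S. u v *\<^sub>R v) = 0" "\<exists>v\<in>S. u v \<noteq> 0"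
        using iffD1[OF real_vector.dependent_finite[OF fS]] by blast
      then obtain w where w: "w \<in> S" "u w \<noteq> 0" by blast
      have "0 = G x (\<Sum>v\<in>S. u v *\<^sub>R v) w" using u x by (simp add: G_simps)
      also have "\<dots> = (\<Sum>v\<in>S. u v * G x v w)"
        by (simp add: G_sum_left[OF x] G_simps[OF x])
      also have "\<dots> = (\<Sum>v\<in>S. if v = w then u w else 0)"
        using oS w by (intro sum.cong) (auto simp: ON_def)
      also have "\<dots> = u w" using w fS by simp
      finally show False using w by simp
    qed
    then show "card S \<le> DIM('e)" using independent_bound by blast
  qed
  let ?P = "\<lambda>k. \<exists>S. finite S \<and> ON S \<and> e \<in> S \<and> card S = k"
  have "?P 1" using e by (intro exI[of _ "{e}"]) (auto simp: ON_def)
  moreover have "k \<le> DIM('e)" if "?P k" for k using that ind(2) by blast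
  ultimately obtain k where k: "?P k" "\<And>j. ?P j \<Longrightarrow> j \<le> k"
    using Nat.ex_has_greatest_nat[of ?P 1 "DIM('e)"] by (metis (no_types, lifting))
  then obtain S where S: "finite S" "ON S" "e \<in> S" "card S = k" by blast
  have "k = DIM('e)"
  proof (rule ccontr)
    assume "k \<noteq> DIM('e)"
    then have "span S \<noteq> UNIV"
      using ind[OF S(1,2)] S(4) dim_eq_card_independent[of S] dim_span[of S] by (metis dim_UNIV)
    then obtain y where y: "y \<notin> span S" by blast
    define z where "z = y - (\<Sum>s\<in>S. G x y s *\<^sub>R s)"
    have zs: "G x z w = 0" if "w \<in> S" for w
    proof -
      have "G x (\<Sum>s\<in>S. G x y s *\<^sub>R s) w = (\<Sum>s\<in>S. G x y s * G x s w)"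
        by (simp add: G_sum_left[OF x] G_simps[OF x])
      also have "\<dots> = (\<Sum>s\<in>S. if s = w then G x y w else 0)"
        using S(2) that by (intro sum.cong) (auto simp: ON_def)
      also have "\<dots> = G x y w" using that S(1) by simp
      finally show ?thesis by (simp add: z_def G_simps[OF x])
    qed
    have "z \<noteq> 0"
    proof
      assume "z = 0"
      then have "y = (\<Sum>s\<in>S. G x y s *\<^sub>R s)" by (simp add: z_def)
      also have "\<dots> \<in> span S" by (intro span_sum span_scale span_base)
      finally show False using y by simp
    qed
    define n where "n = (1 / sqrt (G x z z)) *\<^sub>R z"
    have nn: "G x n n = 1" using G_pos[OF x \<open>z \<noteq> 0\<close>] by (simp add: n_def G_simps[OF x])
    have ns: "G x n w = 0" "G x w n = 0" if "w \<in> S" for w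
      using zs[OF that] G_sym[OF x, of w n] by (simp_all add: n_def G_simps[OF x])
    have "n \<notin> S" using nn ns by force
    have "?P (Suc k)" using S nn ns \<open>n \<notin> S\<close> by (intro exI[of _ "insert n S"]) (auto simp: ON_def)
    then show False using k(2) by fastforce
  qed
  then have "card (Basis - {b0}) = card (S - {e})" using S b0 by (simp add: card_Diff_singleton)
  then obtain h where h: "bij_betw h (Basis - {b0}) (S - {e})"
    using finite_same_card_bij[of "Basis - {b0}" "S - {e}"] S by auto
  define E where "E = (\<lambda>b. if b = b0 then e else h b)"
  have "bij_betw E (Basis - {b0}) (S - {e})" using h bij_betw_cong[of "Basis - {b0}" E h] by (simp add: E_def)
  then have inE: "E i \<in> S" "i \<noteq> b0 \<Longrightarrow> E i \<noteq> e" if "i \<in> Basis" for i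
    using that S(3) bij_betwE[of E "Basis - {b0}" "S - {e}"] by (auto simp: E_def split: if_splits)
  have injE: "E i = E j \<longleftrightarrow> i = j" if "i \<in> Basis" "j \<in> Basis" for i j
  proof (cases "i = b0 \<or> j = b0")
    case True then show ?thesis using inE(2)[OF that(1)] inE(2)[OF that(2)] by (auto simp: E_def)
  next
    case False then show ?thesis
      using \<open>bij_betw E (Basis - {b0}) (S - {e})\<close> that by (auto simp: bij_betw_def inj_on_def)
  qed
  have "orthonormal_frame x E" unfolding orthonormal_frame_def
    using S(2) inE(1) injE unfolding ON_def by simp
  then show ?thesis by (intro exI[of _ E]) (simp add: E_def)
qed

end

section \<open>Second variation in a chart\<close>

text \<open>Picard iteration: the integral operator contracts with constant 1/2 because the interval
  is short compared with \<open>M\<close>.\<close>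

lemma linear_ode_short_interval:
  fixes A :: "real \<Rightarrow> 'e::euclidean_space \<Rightarrow> 'e"
  assumes "a \<le> b" and lin: "\<And>t. t \<in> {a..b} \<Longrightarrow> linear (A t)"
    and cont: "\<And>x. continuous_on {a..b} (\<lambda>t. A t x)"
    and M: "\<And>t x. t \<in> {a..b} \<Longrightarrow> norm (A t x) \<le> M * norm x" "0 \<le> M" "(b - a) * M \<le> 1 / 2"
  shows "\<exists>E. E a = e \<and> (\<forall>t\<in>{a..b}. (E has_vector_derivative A t (E t)) (at t within {a..b}))"
proof -
  have cA: "continuous_on {a..b} (\<lambda>t. A t (x t))" if "continuous_on {a..b} x" for x
    by (rule continuous_on_linear_family[of "{a..b}" A, OF lin cont continuous_on_id _ that]) auto
  define F where "F = (\<lambda>x t. e + integral {a..t} (\<lambda>s. A s (apply_bcontfun x s)))"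
  have iA: "(\<lambda>s. A s (apply_bcontfun x s)) integrable_on {a..t}" if "t \<in> {a..b}" for x t
    using that by (intro integrable_continuous_real continuous_on_subset[OF cA]) auto
  \<comment> \<open>Clamping the argument to the interval extends the integral expression to a
    bounded continuous function on the whole line, so that the fixed point is sought in a complete
    space.\<close>
  have "\<exists>g. \<forall>t. apply_bcontfun g t = F x (clamp a b t)" for x
  proof -
    have "continuous_on (cbox a b) (F x)" unfolding F_def using iA[of b x] \<open>a \<le> b\<close>
      by (auto intro!: continuous_intros indefinite_integral_continuous_1)
    then show ?thesis by (metis continuous_on_cbox_bcontfunE)
  qed
  then obtain T where T: "apply_bcontfun (T x) t = F x (clamp a b t)" for x t by metis
  have cl: "clamp a b t \<in> {a..b}" for t using clamp_in_interval[of a b t] \<open>a \<le> b\<close> by simp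
  have "dist (T x) (T y) \<le> (1/2) * dist x y" for x y
  proof (rule dist_bound)
    fix t
    let ?c = "clamp a b t"
    have "apply_bcontfun (T x) t - apply_bcontfun (T y) t = integral {a..?c} (\<lambda>s. A s (x s) - A s (y s))"
      unfolding T F_def by (simp add: integral_diff[OF iA iA] cl[simplified])
    moreover have "norm (integral {a..?c} (\<lambda>s. A s (x s) - A s (y s))) \<le> (M * dist x y) * (?c - a)"
    proof (rule integral_bound)
      show "a \<le> ?c" using cl[of t] by simp
      show "continuous_on {a..?c} (\<lambda>s. A s (x s) - A s (y s))"
        using cl[of t] by (intro continuous_intros continuous_on_subset[OF cA]) auto
      fix s assume "s \<in> {a..?c}"
      then have s: "s \<in> {a..b}" using cl[of t] by auto
      have "norm (A s (x s) - A s (y s)) = norm (A s (x s - y s))" by (simp add: linear_diff[OF lin[OF s]])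
      also have "\<dots> \<le> M * norm (x s - y s)" by (rule M(1)[OF s])
      also have "\<dots> \<le> M * dist x y" using dist_bounded[of x s y] M(2)
        by (intro mult_left_mono) (auto simp: dist_norm)
      finally show "norm (A s (x s) - A s (y s)) \<le> M * dist x y" .
    qed
    moreover have "(M * dist x y) * (?c - a) \<le> (M * dist x y) * (b - a)"
      using cl[of t] M(2) by (intro mult_left_mono) auto
    moreover have "(M * dist x y) * (b - a) \<le> (1/2) * dist x y"
      using mult_right_mono[OF M(3), of "dist x y"] by (simp add: mult_ac)
    ultimately show "dist (apply_bcontfun (T x) t) (apply_bcontfun (T y) t) \<le> (1/2) * dist x y"
      by (simp add: dist_norm)
  qed
  then obtain x where x: "T x = x" using banach_fix_type[of "1/2" T] by auto
  have Fx: "apply_bcontfun x t = F x t" if "t \<in> {a..b}" for t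
    using T[of x t] x that by simp
  show ?thesis
  proof (intro exI[of _ "F x"] conjI ballI)
    show "F x a = e" by (simp add: F_def)
    fix t assume t: "t \<in> {a..b}"
    have "continuous_on {a..b} (\<lambda>s. A s (x s))" by (intro cA) auto
    then have "((\<lambda>u. integral {a..u} (\<lambda>s. A s (x s))) has_vector_derivative A t (x t)) (at t within {a..b})"
      using t by (rule integral_has_vector_derivative)
    then show "(F x has_vector_derivative A t (F x t)) (at t within {a..b})"
      using Fx[OF t] unfolding F_def[of] by (auto intro!: derivative_eq_intros)
  qed
qed

text \<open>Taylor's formula with Lagrange remainder; the intermediate point is unknown, hence the
  bound \<open>c\<close> on the whole interval of radius \<open>|s|\<close>.\<close>

lemma second_order_upper_bound:
  fixes f :: "real \<Rightarrow> real"
  assumes f: "\<And>y. \<bar>y\<bar> \<le> \<bar>s\<bar> \<Longrightarrow> (f has_real_derivative f' y) (at y)"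
    and f': "\<And>y. \<bar>y\<bar> \<le> \<bar>s\<bar> \<Longrightarrow> (f' has_real_derivative f'' y) (at y)"
    and c: "\<And>y. \<bar>y\<bar> \<le> \<bar>s\<bar> \<Longrightarrow> f'' y \<le> c" and "f' 0 = 0"
  shows "f s \<le> f 0 + s\<^sup>2 / 2 * c"
proof -
  define d where "d = (\<lambda>m. if m = 0 then f else if m = Suc 0 then f' else f'')"
  have "\<exists>t. \<bar>t\<bar> \<le> \<bar>s\<bar> \<and> f s = (\<Sum>m<2. d m 0 / fact m * s ^ m) + d 2 t / fact 2 * s ^ 2"
    by (rule Maclaurin_bi_le) (auto simp: d_def less_2_cases_iff f f')
  then obtain t where t: "\<bar>t\<bar> \<le> \<bar>s\<bar>" "f s = (\<Sum>m<2. d m 0 / fact m * s ^ m) + d 2 t / fact 2 * s ^ 2" by blast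
  then have "f s = f 0 + f'' t / 2 * s\<^sup>2" using \<open>f' 0 = 0\<close> by (simp add: d_def numeral_2_eq_2)
  then show ?thesis using mult_right_mono[OF c[OF t(1)], of "s\<^sup>2 / 2"] by (simp add: algebra_simps)
qed

context metric_patch begin

text \<open>At a fixed parameter of the base curve, \<open>X\<close> is the transversal curve and
  \<open>Y\<close> the velocity of the varied curve as a function of \<open>s\<close>, so
  \<open>G (X s) (Y s) (Y s)\<close> is the squared speed. \<open>Z\<close> is the covariant
  derivative of \<open>Y\<close> along \<open>X\<close>, and \<open>Z'\<close> the ordinary
  derivative of \<open>Z\<close>.\<close>

lemma variation_energy_derivatives:
  fixes x v w y v1 w1 :: 'e and s :: real
  assumes u: "x + s *\<^sub>R v + (s\<^sup>2 / 2) *\<^sub>R w \<in> U"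
  defines "X \<equiv> \<lambda>s. x + s *\<^sub>R v + (s\<^sup>2 / 2) *\<^sub>R w" and "X' \<equiv> \<lambda>s. v + s *\<^sub>R w"
    and "Y \<equiv> \<lambda>s. y + s *\<^sub>R v1 + (s\<^sup>2 / 2) *\<^sub>R w1" and "Y' \<equiv> \<lambda>s. v1 + s *\<^sub>R w1"
  defines "Z \<equiv> \<lambda>s. Y' s + Gam (X s) (X' s) (Y s)"
  defines "Z' \<equiv> \<lambda>s. w1 + dGam (X s) (X' s) (X' s) (Y s) + Gam (X s) w (Y s) + Gam (X s) (X' s) (Y' s)"
  shows "((\<lambda>s. G (X s) (Y s) (Y s)) has_real_derivative 2 * G (X s) (Z s) (Y s)) (at s)"
    "((\<lambda>s. 2 * G (X s) (Z s) (Y s)) has_real_derivative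
       2 * (G (X s) (Z' s + Gam (X s) (X' s) (Z s)) (Y s) + G (X s) (Z s) (Z s))) (at s)"
proof -
  have X: "X s \<in> U" using u by (simp add: X_def)
  have dq: "((\<lambda>s. a + s *\<^sub>R b + (s\<^sup>2 / 2) *\<^sub>R c) has_vector_derivative b + s *\<^sub>R c) (at s)" for a b c :: 'e
    unfolding has_vector_derivative_def by (auto intro!: derivative_eq_intros ext simp: algebra_simps)
  have dl: "((\<lambda>s. b + s *\<^sub>R c) has_vector_derivative c) (at s)" for b c :: 'e
    unfolding has_vector_derivative_def by (auto intro!: derivative_eq_intros ext simp: algebra_simps)
  have dX: "(X has_vector_derivative X' s) (at s)" and dX': "(X' has_vector_derivative w) (at s)"
    and dY: "(Y has_vector_derivative Y' s) (at s)" and dY': "(Y' has_vector_derivative w1) (at s)"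
    unfolding X_def X'_def Y_def Y'_def by (rule dq dl)+
  have dZ: "(Z has_vector_derivative Z' s) (at s)"
    using has_vector_derivative_add[OF dY' Gam_has_vector_derivative[OF dX X UNIV_I dX' dY]]
    unfolding Z_def Z'_def by (simp add: add_ac)
  show "((\<lambda>s. G (X s) (Y s) (Y s)) has_real_derivative 2 * G (X s) (Z s) (Y s)) (at s)"
    using G_has_vector_derivative[OF dX X UNIV_I dY dY] G_sym[OF X, of "Y s" "Z s"]
    unfolding has_real_derivative_iff_has_vector_derivative by (simp add: Z_def)
  have "((\<lambda>s. G (X s) (Z s) (Y s)) has_real_derivative
      (G (X s) (Z' s + Gam (X s) (X' s) (Z s)) (Y s) + G (X s) (Z s) (Z s))) (at s)"
    using G_has_vector_derivative[OF dX X UNIV_I dZ dY]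
    unfolding has_real_derivative_iff_has_vector_derivative by (simp add: Z_def)
  then show "((\<lambda>s. 2 * G (X s) (Z s) (Y s)) has_real_derivative
       2 * (G (X s) (Z' s + Gam (X s) (X' s) (Z s)) (Y s) + G (X s) (Z s) (Z s))) (at s)"
    by (rule DERIV_cmult)
qed

text \<open>The transversal curves \<open>s \<mapsto> u + s V - s\<^sup>2/2 \<Gamma>(V, V)\<close> have vanishing covariant acceleration
  at \<open>s = 0\<close>, so that the second variation has no boundary terms.\<close>

lemma second_variation:
  assumes t12: "t1 < t2" and uU: "\<And>t. t \<in> {t1..t2} \<Longrightarrow> u t \<in> U"
    and u: "\<And>t. t \<in> {t1..t2} \<Longrightarrow> (u has_vector_derivative u1 t) (at t within {t1..t2})"
    and cu1: "continuous_on {t1..t2} u1"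
    and V: "\<And>t. t \<in> {t1..t2} \<Longrightarrow> (V has_vector_derivative V1 t) (at t within {t1..t2})"
    and cV1: "continuous_on {t1..t2} V1"
    and unit: "\<And>t. t \<in> {t1..t2} \<Longrightarrow> G (u t) (u1 t) (u1 t) = 1"
    and orth: "\<And>t. t \<in> {t1..t2} \<Longrightarrow> G (u t) (V1 t + Gam (u t) (V t) (u1 t)) (u1 t) = 0"
    and "\<epsilon> > 0"
  defines "\<kappa> \<equiv> \<lambda>t. G (u t) (V1 t + Gam (u t) (V t) (u1 t)) (V1 t + Gam (u t) (V t) (u1 t))
       + G (u t) (Rm (u t) (V t) (u1 t) (V t)) (u1 t)"
  defines "w \<equiv> \<lambda>s t. u t + s *\<^sub>R V t - (s\<^sup>2 / 2) *\<^sub>R Gam (u t) (V t) (V t)"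
  shows "continuous_on {t1..t2} \<kappa>" (is ?cont)
    "\<exists>\<delta>>0. \<forall>s. \<bar>s\<bar> < \<delta> \<longrightarrow> (\<exists>w1. (\<forall>t\<in>{t1..t2}. w s t \<in> U) \<and>
       (\<forall>t\<in>{t1..t2}. (w s has_vector_derivative w1 t) (at t within {t1..t2})) \<and>
       continuous_on {t1..t2} w1 \<and>
       integral {t1..t2} (\<lambda>t. sqrt (G (w s t) (w1 t) (w1 t)))
         \<le> (t2 - t1) + s\<^sup>2 / 2 * (integral {t1..t2} \<kappa> + \<epsilon>))"
proof -
  let ?I = "{t1..t2}"
  \<comment> \<open>The coordinate acceleration of the transversal curves. Below, \<open>X\<close>,
    \<open>Xs\<close>, \<open>Y\<close> and \<open>Ys\<close> are the variation, its
    \<open>s\<close>-derivative, its \<open>t\<close>-derivative and its mixed derivative.\<close>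
  define W where "W = (\<lambda>t. - Gam (u t) (V t) (V t))"
  define W1 where "W1 = (\<lambda>t. - (dGam (u t) (u1 t) (V t) (V t) + Gam (u t) (V1 t) (V t) + Gam (u t) (V t) (V1 t)))"
  have cu: "continuous_on ?I u" and cV: "continuous_on ?I V"
    by (rule continuous_on_vector_derivative[OF u] continuous_on_vector_derivative[OF V]; assumption)+
  have uI: "u ` ?I \<subseteq> U" using uU by auto
  have dW: "(W has_vector_derivative W1 t) (at t within ?I)" if "t \<in> ?I" for t
    unfolding W_def W1_def
    by (intro has_vector_derivative_minus Gam_has_vector_derivative u V uU that)
  have cW: "continuous_on ?I W" unfolding W_def
    by (intro continuous_intros continuous_on_Gam cu uI cV)
  have cW1: "continuous_on ?I W1" unfolding W1_def
    by (intro continuous_intros continuous_on_Gam continuous_on_dGam cu uI cV cu1 cV1)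
  define X where "X = (\<lambda>t s. u t + s *\<^sub>R V t + (s\<^sup>2 / 2) *\<^sub>R W t)"
  define Xs where "Xs = (\<lambda>t s. V t + s *\<^sub>R W t)"
  define Y where "Y = (\<lambda>t s. u1 t + s *\<^sub>R V1 t + (s\<^sup>2 / 2) *\<^sub>R W1 t)"
  define Ys where "Ys = (\<lambda>t s. V1 t + s *\<^sub>R W1 t)"
  define Z where "Z = (\<lambda>t s. Ys t s + Gam (X t s) (Xs t s) (Y t s))"
  define Zs where "Zs = (\<lambda>t s. W1 t + dGam (X t s) (Xs t s) (Xs t s) (Y t s) + Gam (X t s) (W t) (Y t s) + Gam (X t s) (Xs t s) (Ys t s))"
  define k2 where "k2 = (\<lambda>t s. 2 * (G (X t s) (Zs t s + Gam (X t s) (Xs t s) (Z t s)) (Y t s) + G (X t s) (Z t s) (Z t s)))"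
  define K where "K = (\<lambda>t s. G (X t s) (Y t s) (Y t s))"
  have X0: "X t 0 = u t" "Xs t 0 = V t" "Y t 0 = u1 t" "Ys t 0 = V1 t" for t
    by (simp_all add: X_def Xs_def Y_def Ys_def)
  \<comment> \<open>Exchanging covariant derivatives in \<open>s\<close> and \<open>t\<close> costs
    a curvature term; the remaining term is the \<open>t\<close>-derivative of the covariant
    acceleration, which \<open>W\<close> makes zero at \<open>s = 0\<close> for all
    \<open>t\<close>.\<close>
  have k20: "k2 t 0 = 2 * \<kappa> t" if "t \<in> ?I" for t
    using uU[OF that] Gam_sym[OF uU[OF that], of "u1 t" "V t"]
      Gam_sym[OF uU[OF that], of "u1 t" "Gam (u t) (V t) (V t)"] dGam_sym[OF uU[OF that], of _ "u1 t"]
    by (simp add: k2_def \<kappa>_def X0 Z_def Zs_def Rm_def W_def W1_def G_simps Gam_simps Gam_sym[of "u t" "V1 t" "V t"] algebra_simps)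
  have K0: "K t 0 = 1" and Z0: "G (X t 0) (Z t 0) (Y t 0) = 0" if "t \<in> ?I" for t
    using unit[OF that] orth[OF that] by (simp_all add: K_def Z_def X0)
  \<comment> \<open>Compactness of the image of \<open>u\<close> provides one range of
    \<open>s\<close> that keeps the variation in \<open>U\<close> for all \<open>t\<close>.\<close>
  have "\<exists>\<rho>>0. \<forall>t\<in>?I. \<forall>s. \<bar>s\<bar> \<le> \<rho> \<longrightarrow> X t s \<in> U"
  proof -
    obtain e where e: "e > 0" "(\<Union>x\<in>u ` ?I. ball x e) \<subseteq> U"
      using compact_subset_open_imp_ball_epsilon_subset[OF compact_continuous_image[OF cu compact_Icc] open_U uI] by blast
    obtain C1 where C1: "\<And>t. t \<in> ?I \<Longrightarrow> norm (V t) \<le> C1"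
      using compact_imp_bounded[OF compact_continuous_image[OF cV compact_Icc]] unfolding bounded_iff by (metis imageI)
    obtain C2 where C2: "\<And>t. t \<in> ?I \<Longrightarrow> norm (W t) \<le> C2"
      using compact_imp_bounded[OF compact_continuous_image[OF cW compact_Icc]] unfolding bounded_iff by (metis imageI)
    define C where "C = \<bar>C1\<bar> + \<bar>C2\<bar> + 1"
    define \<rho> where "\<rho> = min 1 (e / (2 * C))"
    have C: "C > 0" by (simp add: C_def)
    have "X t s \<in> U" if t: "t \<in> ?I" and s: "\<bar>s\<bar> \<le> \<rho>" for t s
    proof -
      have s1: "\<bar>s\<bar> \<le> 1" "\<bar>s\<bar> \<le> e / (2 * C)" using s by (auto simp: \<rho>_def)
      have "s\<^sup>2 = \<bar>s\<bar> * \<bar>s\<bar>" by (simp add: power2_eq_square)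
      also have "\<dots> \<le> \<bar>s\<bar> * 1" using s1 by (intro mult_left_mono) auto
      finally have s2: "s\<^sup>2 / 2 \<le> \<bar>s\<bar>" by simp
      have "norm (s *\<^sub>R V t + (s\<^sup>2 / 2) *\<^sub>R W t) \<le> \<bar>s\<bar> * norm (V t) + s\<^sup>2 / 2 * norm (W t)"
        by (rule order_trans[OF norm_triangle_ineq]) simp
      also have "\<dots> \<le> \<bar>s\<bar> * \<bar>C1\<bar> + \<bar>s\<bar> * \<bar>C2\<bar>"
        using s2 C1[OF t] C2[OF t] by (intro add_mono mult_mono) auto
      also have "\<dots> \<le> \<bar>s\<bar> * C" by (simp add: C_def algebra_simps)
      also have "\<dots> \<le> e / (2 * C) * C" using s1 C by (intro mult_right_mono) auto
      also have "\<dots> = e / 2" using C by simp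
      also have "\<dots> < e" using e by simp
      finally have "norm (s *\<^sub>R V t + (s\<^sup>2 / 2) *\<^sub>R W t) < e" .
      moreover have "X t s - u t = s *\<^sub>R V t + (s\<^sup>2 / 2) *\<^sub>R W t" by (simp add: X_def)
      ultimately have "X t s \<in> ball (u t) e" by (simp add: dist_norm norm_minus_commute[of "u t"])
      then show ?thesis using e(2) t by blast
    qed
    moreover have "\<rho> > 0" using e C by (simp add: \<rho>_def)
    ultimately show ?thesis by blast
  qed
  then obtain \<rho> where \<rho>: "\<rho> > 0" "\<And>t s. t \<in> ?I \<Longrightarrow> \<bar>s\<bar> \<le> \<rho> \<Longrightarrow> X t s \<in> U" by blast
  let ?Q = "?I \<times> {-\<rho>..\<rho>}"
  have comp: "continuous_on ?Q (\<lambda>z. h (fst z))" if "continuous_on ?I h" for h :: "real \<Rightarrow> 'e"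
    by (rule continuous_on_compose2[OF that continuous_on_fst[OF continuous_on_id]]) auto
  have cX: "continuous_on ?Q (\<lambda>z. X (fst z) (snd z))" "continuous_on ?Q (\<lambda>z. Xs (fst z) (snd z))"
    "continuous_on ?Q (\<lambda>z. Y (fst z) (snd z))" "continuous_on ?Q (\<lambda>z. Ys (fst z) (snd z))"
    unfolding X_def Xs_def Y_def Ys_def
    by (intro continuous_intros comp cu cV cW cu1 cV1 cW1 | simp)+
  have XU: "(\<lambda>z. X (fst z) (snd z)) ` ?Q \<subseteq> U" using \<rho>(2) by auto
  have cZ: "continuous_on ?Q (\<lambda>z. Z (fst z) (snd z))" unfolding Z_def
    by (intro continuous_intros continuous_on_Gam cX XU)
  have cZs: "continuous_on ?Q (\<lambda>z. Zs (fst z) (snd z))" unfolding Zs_def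
    by (intro continuous_intros continuous_on_Gam continuous_on_dGam cX XU comp cW cW1)
  have ck2: "continuous_on ?Q (\<lambda>z. k2 (fst z) (snd z))" unfolding k2_def
    by (intro continuous_intros continuous_on_G continuous_on_Gam cX XU cZ cZs)
  have "continuous_on ?I (\<lambda>t. k2 t 0)"
  proof -
    have c: "continuous_on ?I (\<lambda>t. (t, 0::real))" by (intro continuous_intros)
    have i: "(\<lambda>t. (t, 0)) ` ?I \<subseteq> ?Q" using \<rho>(1) by auto
    from continuous_on_compose2[OF ck2 c i] show ?thesis by simp
  qed
  then have "continuous_on ?I (\<lambda>t. k2 t 0 / 2)" by (intro continuous_intros) auto
  then show c\<kappa>: ?cont by (rule continuous_on_eq) (simp add: k20)
  \<comment> \<open>An error density that integrates to \<open>\<epsilon>\<close> over the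
    interval.\<close>
  define \<epsilon>' where "\<epsilon>' = \<epsilon> / (t2 - t1)"
  have \<epsilon>': "\<epsilon>' > 0" using \<open>\<epsilon> > 0\<close> t12 by (simp add: \<epsilon>'_def)
  \<comment> \<open>Uniform continuity on the compact strip makes the error in the Taylor estimate
    of the squared speed uniform in \<open>t\<close>.\<close>
  have "uniformly_continuous_on ?Q (\<lambda>z. k2 (fst z) (snd z))"
    by (intro compact_uniformly_continuous ck2 compact_Times compact_Icc)
  then obtain d where d: "d > 0" "\<And>z z'. z \<in> ?Q \<Longrightarrow> z' \<in> ?Q \<Longrightarrow> dist z' z < d \<Longrightarrow> dist (k2 (fst z') (snd z')) (k2 (fst z) (snd z)) < 2 * \<epsilon>'"
    unfolding uniformly_continuous_on_def using \<epsilon>' by (metis zero_less_mult_iff zero_less_numeral)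
  define \<delta> where "\<delta> = min d \<rho>"
  have w_eq: "w s = (\<lambda>t. X t s)" for s by (auto simp: w_def X_def W_def)
  show "\<exists>\<delta>>0. \<forall>s. \<bar>s\<bar> < \<delta> \<longrightarrow> (\<exists>w1. (\<forall>t\<in>{t1..t2}. w s t \<in> U) \<and>
       (\<forall>t\<in>{t1..t2}. (w s has_vector_derivative w1 t) (at t within {t1..t2})) \<and>
       continuous_on {t1..t2} w1 \<and>
       integral {t1..t2} (\<lambda>t. sqrt (G (w s t) (w1 t) (w1 t)))
         \<le> (t2 - t1) + s\<^sup>2 / 2 * (integral {t1..t2} \<kappa> + \<epsilon>))"
  proof (intro exI[of _ \<delta>] conjI allI impI)
    show "\<delta> > 0" using d \<rho> by (simp add: \<delta>_def)
    fix s assume s: "\<bar>s\<bar> < \<delta>"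
    have k2b: "k2 t y \<le> 2 * (\<kappa> t + \<epsilon>')" if t: "t \<in> ?I" and "\<bar>y\<bar> \<le> \<bar>s\<bar>" for t y
    proof -
      have "dist (k2 t y) (k2 t 0) < 2 * \<epsilon>'"
        using d(2)[of "(t, 0)" "(t, y)"] that s \<rho>(1) by (simp add: \<delta>_def dist_Pair_Pair abs_le_iff) linarith
      then show ?thesis using k20[OF t] by (simp add: dist_real_def)
    qed
    have Kb: "K t s \<le> 1 + s\<^sup>2 / 2 * (2 * (\<kappa> t + \<epsilon>'))" if t: "t \<in> ?I" for t
      unfolding K0[OF t, symmetric]
    proof (rule second_order_upper_bound)
      fix y assume y: "\<bar>y\<bar> \<le> \<bar>s\<bar>"
      then have "u t + y *\<^sub>R V t + (y\<^sup>2 / 2) *\<^sub>R W t \<in> U" using \<rho>(2)[OF t, of y] s by (simp add: X_def \<delta>_def)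
      note der = variation_energy_derivatives[OF this, where y = "u1 t" and ?v1.0 = "V1 t" and ?w1.0 = "W1 t"]
      show "((\<lambda>y. K t y) has_real_derivative 2 * G (X t y) (Z t y) (Y t y)) (at y)"
        using der(1) unfolding K_def X_def Y_def Z_def Ys_def Xs_def .
      show "((\<lambda>y. 2 * G (X t y) (Z t y) (Y t y)) has_real_derivative k2 t y) (at y)"
        using der(2) unfolding k2_def Zs_def X_def Y_def Z_def Ys_def Xs_def .
      show "k2 t y \<le> 2 * (\<kappa> t + \<epsilon>')" by (rule k2b[OF t y])
    next
      show "2 * G (X t 0) (Z t 0) (Y t 0) = 0" using Z0[OF t] by simp
    qed
    have sI: "X t s \<in> U" if "t \<in> ?I" for t using \<rho>(2)[OF that] s by (simp add: \<delta>_def)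
    have slice: "continuous_on ?I (\<lambda>t. h t s)" if "continuous_on ?Q (\<lambda>z. h (fst z) (snd z))" for h :: "real \<Rightarrow> real \<Rightarrow> 'e"
    proof -
      have c: "continuous_on ?I (\<lambda>t. (t, s))" by (intro continuous_intros)
      have i: "(\<lambda>t. (t, s)) ` ?I \<subseteq> ?Q" using s by (auto simp: \<delta>_def)
      from continuous_on_compose2[OF that c i] show ?thesis by simp
    qed
    have cs: "continuous_on ?I (\<lambda>t. sqrt (K t s))" unfolding K_def
      using sI by (intro continuous_intros continuous_on_G slice[OF cX(1)] slice[OF cX(3)]) auto
    \<comment> \<open>The arithmetic-geometric mean inequality passes from energy to length. To
      second order nothing is lost, because \<open>K\<close> is 1 with vanishing
      \<open>s\<close>-derivative at \<open>s = 0\<close>.\<close>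
    have sq: "sqrt (K t s) \<le> 1 + s\<^sup>2 / 2 * (\<kappa> t + \<epsilon>')" if "t \<in> ?I" for t
    proof -
      have "sqrt (K t s) \<le> (1 + K t s) / 2"
        using arith_geo_mean_sqrt[of 1 "K t s"] G_nonneg[OF sI[OF that]] by (simp add: K_def)
      moreover have "s\<^sup>2 / 2 * (2 * (\<kappa> t + \<epsilon>')) = 2 * (s\<^sup>2 / 2 * (\<kappa> t + \<epsilon>'))" by simp
      ultimately have "sqrt (K t s) * 2 \<le> 2 + 2 * (s\<^sup>2 / 2 * (\<kappa> t + \<epsilon>'))" using Kb[OF that] by argo
      then show ?thesis by argo
    qed
    show "\<exists>w1. (\<forall>t\<in>{t1..t2}. w s t \<in> U) \<and>
       (\<forall>t\<in>{t1..t2}. (w s has_vector_derivative w1 t) (at t within {t1..t2})) \<and>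
       continuous_on {t1..t2} w1 \<and>
       integral {t1..t2} (\<lambda>t. sqrt (G (w s t) (w1 t) (w1 t)))
         \<le> (t2 - t1) + s\<^sup>2 / 2 * (integral {t1..t2} \<kappa> + \<epsilon>)"
    proof (intro exI[of _ "\<lambda>t. Y t s"] conjI ballI)
      show "w s t \<in> U" if "t \<in> ?I" for t using sI[OF that] by (simp add: w_eq)
      show "(w s has_vector_derivative Y t s) (at t within ?I)" if t: "t \<in> ?I" for t
        unfolding w_eq X_def Y_def
        by (intro has_vector_derivative_add u[OF t] bounded_linear.has_vector_derivative[OF bounded_linear_scaleR_right] V[OF t] dW[OF t])
      show "continuous_on ?I (\<lambda>t. Y t s)" by (rule slice[OF cX(3)])
      have "integral ?I (\<lambda>t. sqrt (K t s)) \<le> integral ?I (\<lambda>t. 1 + s\<^sup>2 / 2 * (\<kappa> t + \<epsilon>'))"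
        using sq by (intro integral_le integrable_continuous_real cs continuous_intros c\<kappa>) auto
      also have "\<dots> = (t2 - t1) + s\<^sup>2 / 2 * (integral ?I \<kappa> + \<epsilon>' * (t2 - t1))"
      proof -
        have i: "\<kappa> integrable_on ?I" by (rule integrable_continuous_real[OF c\<kappa>])
        have "((\<lambda>t. 1 + s\<^sup>2 / 2 * (\<kappa> t + \<epsilon>')) has_integral (t2 - t1) *\<^sub>R 1 + s\<^sup>2 / 2 * (integral ?I \<kappa> + (t2 - t1) *\<^sub>R \<epsilon>')) ?I"
          using t12 by (intro has_integral_add has_integral_mult_right has_integral_const_real[THEN has_integral_eq_rhs] integrable_integral i) auto
        then show ?thesis by (simp add: integral_unique mult.commute)
      qed
      also have "\<epsilon>' * (t2 - t1) = \<epsilon>" using t12 by (simp add: \<epsilon>'_def)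
      finally show "integral ?I (\<lambda>t. sqrt (G (w s t) (Y t s) (Y t s))) \<le> (t2 - t1) + s\<^sup>2 / 2 * (integral ?I \<kappa> + \<epsilon>)"
        by (simp add: K_def w_eq)
    qed
  qed
qed

section \<open>The Ricci trace and parallel frames\<close>

definition Ric :: "'e \<Rightarrow> 'e \<Rightarrow> 'e \<Rightarrow> real" where
  "Ric x v w = (\<Sum>b\<in>Basis. Rm x b v w \<bullet> b)"

lemma Rm_linear: "x \<in> U \<Longrightarrow> linear (\<lambda>a. Rm x a v w)"
  by (rule linearI) (simp_all add: Rm_def dGam_simps Gam_simps algebra_simps)

text \<open>The term of index \<open>b0\<close> drops out of the trace because \<open>Rm\<close> is
  alternating in its first two vectors; \<open>Rm_antisym\<close> exchanges the last two arguments
  and brings the sign.\<close>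

lemma sum_frame_Rm:
  assumes x: "x \<in> U" and E: "orthonormal_frame x E" and b0: "b0 \<in> Basis"
  shows "(\<Sum>j\<in>Basis - {b0}. G x (Rm x (E j) (E b0) (E j)) (E b0)) = - Ric x (E b0) (E b0)"
proof -
  have "Ric x (E b0) (E b0) = (\<Sum>j\<in>Basis. G x (Rm x (E j) (E b0) (E b0)) (E j))"
    unfolding Ric_def by (rule trace_frame[OF x E Rm_linear[OF x]])
  also have "\<dots> = (\<Sum>j\<in>Basis - {b0}. G x (Rm x (E j) (E b0) (E b0)) (E j))"
    using b0 by (subst sum.remove[of _ b0]) (auto simp: Rm_def G_simps[OF x])
  also have "\<dots> = (\<Sum>j\<in>Basis - {b0}. - G x (Rm x (E j) (E b0) (E j)) (E b0))"
    by (intro sum.cong refl) (simp only: Rm_antisym[OF x] G_sym[OF x, of "E b0"])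
  finally show ?thesis by (simp add: sum_negf)
qed

text \<open>Inner products of parallel fields are constant by the covariant product rule, so
  orthonormality at \<open>t1\<close> persists.\<close>

lemma parallel_frame:
  assumes t12: "t1 \<le> t2" and uU: "\<And>t. t \<in> {t1..t2} \<Longrightarrow> u t \<in> U"
    and u: "\<And>t. t \<in> {t1..t2} \<Longrightarrow> (u has_vector_derivative u1 t) (at t within {t1..t2})"
    and cu1: "continuous_on {t1..t2} u1"
    and geo: "\<And>t. t \<in> {t1..t2} \<Longrightarrow> (u1 has_vector_derivative - Gam (u t) (u1 t) (u1 t)) (at t within {t1..t2})"
    and M: "\<And>t x. t \<in> {t1..t2} \<Longrightarrow> norm (Gam (u t) (u1 t) x) \<le> M * norm x" "0 \<le> M" "(t2 - t1) * M \<le> 1 / 2"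
    and E0: "orthonormal_frame (u t1) E0" "E0 b0 = u1 t1" and b0: "b0 \<in> Basis"
  shows "\<exists>E. (\<forall>j. E j t1 = E0 j) \<and> E b0 = u1 \<and>
     (\<forall>j. \<forall>t\<in>{t1..t2}. (E j has_vector_derivative - Gam (u t) (u1 t) (E j t)) (at t within {t1..t2})) \<and>
     (\<forall>t\<in>{t1..t2}. orthonormal_frame (u t) (\<lambda>j. E j t))"
proof -
  let ?I = "{t1..t2}"
  have cu: "continuous_on ?I u"
    by (rule continuous_on_vector_derivative[OF u])
  have uI: "u ` ?I \<subseteq> U" using uU by auto
  have "\<exists>E. E t1 = e \<and> (\<forall>t\<in>?I. (E has_vector_derivative - Gam (u t) (u1 t) (E t)) (at t within ?I))" for e
  proof (rule linear_ode_short_interval[where A = "\<lambda>t x. - Gam (u t) (u1 t) x", OF t12 _ _ _ M(2,3)])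
    show "linear (\<lambda>x. - Gam (u t) (u1 t) x)" if "t \<in> ?I" for t
      by (intro linear_compose_neg Gam_linear uU that)
    show "continuous_on ?I (\<lambda>t. - Gam (u t) (u1 t) x)" for x
      by (intro continuous_intros continuous_on_Gam cu uI cu1)
    show "norm (- Gam (u t) (u1 t) x) \<le> M * norm x" if "t \<in> ?I" for t x using M(1)[OF that] by simp
  qed
  then obtain P where P: "P e t1 = e" "\<And>t. t \<in> ?I \<Longrightarrow> (P e has_vector_derivative - Gam (u t) (u1 t) (P e t)) (at t within ?I)" for e
    by metis
  \<comment> \<open>The geodesic equation says that the velocity is itself parallel, so it is taken
    directly as the frame vector of index \<open>b0\<close>.\<close>
  define E where "E = (\<lambda>j. if j = b0 then u1 else P (E0 j))"
  have E: "E j t1 = E0 j" "\<And>t. t \<in> ?I \<Longrightarrow> (E j has_vector_derivative - Gam (u t) (u1 t) (E j t)) (at t within ?I)" for j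
    using P geo E0(2) by (auto simp: E_def)
  have "G (u t) (E i t) (E j t) = G (u t1) (E i t1) (E j t1)" if t: "t \<in> ?I" for t i j
  proof -
    have "((\<lambda>s. G (u s) (E i s) (E j s)) has_vector_derivative 0) (at s within ?I)" if "s \<in> ?I" for s
      using G_has_vector_derivative[OF u[OF that] uU[OF that] that E(2)[OF that] E(2)[OF that], of i j]
      by (simp add: G_simps[OF uU[OF that]])
    then have "\<exists>c. \<forall>s\<in>?I. G (u s) (E i s) (E j s) = c"
      using has_derivative_zero_constant[of ?I "\<lambda>s. G (u s) (E i s) (E j s)"]
      by (fastforce simp: has_vector_derivative_def)
    then show ?thesis using t t12 by force
  qed
  then have "orthonormal_frame (u t) (\<lambda>j. E j t)" if "t \<in> ?I" for t
    using E0(1) that unfolding orthonormal_frame_def by (simp add: E(1))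
  then show ?thesis using E by (intro exI[of _ E]) (auto simp: E_def)
qed

end

section \<open>Change of charts\<close>

lemma dir_deriv_symmetric_vec:
  fixes F :: "'e::euclidean_space \<Rightarrow> 'b::euclidean_space"
  assumes "open U" "x \<in> U" "smooth_on U F"
  shows "dir_deriv (\<lambda>y. dir_deriv F y a) x b = dir_deriv (\<lambda>y. dir_deriv F y b) x a"
proof (rule euclidean_eqI)
  fix i :: 'b
  have d: "dir_deriv (\<lambda>y. H y \<bullet> i) x v = dir_deriv H x v \<bullet> i" if "smooth_on U H" "x \<in> U" for H x v
  proof -
    have "((\<lambda>y. H y \<bullet> i) has_derivative (\<lambda>v. dir_deriv H x v \<bullet> i)) (at x)"
      by (intro has_derivative_inner_left has_derivative_dir_deriv smooth_onD(2)[OF that])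
    then show ?thesis by (simp add: dir_deriv_eqI)
  qed
  have "dir_deriv (\<lambda>y. dir_deriv F y a) x b \<bullet> i = dir_deriv (\<lambda>y. dir_deriv F y a \<bullet> i) x b" for a b
    by (rule d[OF smooth_onD(3)[OF assms(3)] assms(2), symmetric])
  also have "dir_deriv (\<lambda>y. dir_deriv F y a \<bullet> i) x b = dir_deriv (\<lambda>y. dir_deriv (\<lambda>z. F z \<bullet> i) y a) x b" for a b
    by (rule arg_cong[where f = "\<lambda>f. f b"], rule dir_deriv_cong_open[OF assms(1,2)]) (simp add: d[OF assms(3)])
  finally have e: "dir_deriv (\<lambda>y. dir_deriv F y a) x b \<bullet> i = dir_deriv (\<lambda>y. dir_deriv (\<lambda>z. F z \<bullet> i) y a) x b" for a b .
  show "dir_deriv (\<lambda>y. dir_deriv F y a) x b \<bullet> i = dir_deriv (\<lambda>y. dir_deriv F y b) x a \<bullet> i"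
    unfolding e by (rule dir_deriv_symmetric[OF assms(1,2) smooth_on_inner_left[OF assms(1,3)]])
qed

lemma has_vector_derivative_quadratic:
  fixes a b c :: "'e::real_normed_vector"
  shows "((\<lambda>s. a + s *\<^sub>R b - (s\<^sup>2 / 2) *\<^sub>R c) has_vector_derivative b - s *\<^sub>R c) (at s within S)"
  unfolding has_vector_derivative_def by (auto intro!: derivative_eq_intros ext simp: algebra_simps)

text \<open>For \<open>w = Gam x v v\<close> the second derivative at 0 is the covariant Hessian of
  \<open>F\<close> on \<open>v\<close>. This is applied to transition maps as well as to the
  distance function.\<close>

lemma smooth_composition_quadratic:
  fixes F :: "'e::euclidean_space \<Rightarrow> 'b::euclidean_space" and v w :: 'e
  assumes U: "open U" "x \<in> U" and F: "smooth_on U F"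
  defines "\<sigma> \<equiv> \<lambda>s. x + s *\<^sub>R v - (s\<^sup>2 / 2) *\<^sub>R w"
  defines "h \<equiv> \<lambda>s. dir_deriv F (\<sigma> s) (v - s *\<^sub>R w)"
  shows "\<exists>r>0. \<forall>s. \<bar>s\<bar> < r \<longrightarrow> \<sigma> s \<in> U \<and> ((\<lambda>s. F (\<sigma> s)) has_vector_derivative h s) (at s)"
    "h 0 = dir_deriv F x v"
    "(h has_vector_derivative (dir_deriv (\<lambda>y. dir_deriv F y v) x v - dir_deriv F x w)) (at 0)"
proof -
  have d\<sigma>: "(\<sigma> has_vector_derivative (v - s *\<^sub>R w)) (at s)" for s
    unfolding \<sigma>_def by (rule has_vector_derivative_quadratic)
  have "isCont \<sigma> 0" using d\<sigma>[of 0] has_vector_derivative_continuous by blast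
  then have "\<forall>\<^sub>F s in at 0. \<sigma> s \<in> U"
    using U by (auto simp: isCont_def \<sigma>_def dest: topological_tendstoD)
  then obtain r where r: "r > 0" "\<And>s. s \<noteq> 0 \<Longrightarrow> \<bar>s\<bar> < r \<Longrightarrow> \<sigma> s \<in> U"
    unfolding eventually_at dist_real_def by auto
  have in_U: "\<sigma> s \<in> U" if "\<bar>s\<bar> < r" for s using r(2)[of s] that U(2) by (cases "s = 0") (auto simp: \<sigma>_def)
  show "\<exists>r>0. \<forall>s. \<bar>s\<bar> < r \<longrightarrow> \<sigma> s \<in> U \<and> ((\<lambda>s. F (\<sigma> s)) has_vector_derivative h s) (at s)"
    unfolding h_def using r(1) in_U
    by (intro exI[of _ r] conjI allI impI has_vector_derivative_chain_dir_deriv[OF _ d\<sigma>] smooth_onD(2)[OF F]) auto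
  show "h 0 = dir_deriv F x v" by (simp add: h_def \<sigma>_def)
  have dl: "((\<lambda>s. v - s *\<^sub>R w) has_vector_derivative - w) (at 0)"
    unfolding has_vector_derivative_def by (auto intro!: derivative_eq_intros)
  have "(h has_vector_derivative (dir_deriv (\<lambda>y. dir_deriv F y (v - 0 *\<^sub>R w)) (\<sigma> 0) (v - 0 *\<^sub>R w) + dir_deriv F (\<sigma> 0) (- w))) (at 0)"
    unfolding h_def
  proof (rule has_vector_derivative_linear_family[OF U(1) _ _ d\<sigma> _ _ dl])
    show "linear (dir_deriv F y)" if "y \<in> U" for y by (rule linear_dir_deriv[OF smooth_onD(2)[OF F that]])
    show "(\<lambda>y. dir_deriv F y w) differentiable (at (\<sigma> 0))" for w
      by (rule smooth_onD(2)[OF smooth_onD(3)[OF F]]) (simp add: \<sigma>_def U)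
  qed (auto simp: \<sigma>_def U)
  then show "(h has_vector_derivative (dir_deriv (\<lambda>y. dir_deriv F y v) x v - dir_deriv F x w)) (at 0)"
    using linear_neg[OF linear_dir_deriv[OF smooth_onD(2)[OF F U(2)]]] by (simp add: \<sigma>_def)
qed

locale chart_change = P: metric_patch U G + P': metric_patch U' G'
  for U :: "'e::euclidean_space set" and G and U' :: "'e set" and G' +
  fixes T :: "'e \<Rightarrow> 'e" and D :: "'e set"
  assumes open_D: "open D" and D_sub: "D \<subseteq> U" and T_im: "T ` D \<subseteq> U'" and T_smooth: "smooth_on D T"
    and isometry: "\<And>x v w. x \<in> D \<Longrightarrow> G x v w = G' (T x) (dir_deriv T x v) (dir_deriv T x w)"
begin

lemma dT_linear: "x \<in> D \<Longrightarrow> linear (dir_deriv T x)"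
  by (rule linear_dir_deriv[OF smooth_onD(2)[OF T_smooth]])

lemma dT_surj:
  assumes "x \<in> D" shows "surj (dir_deriv T x)"
proof -
  have "inj (dir_deriv T x)"
  proof (rule linear_injective_0[OF dT_linear[OF assms], THEN iffD2, rule_format])
    fix v assume "dir_deriv T x v = 0"
    then have "G x v v = 0" using isometry[OF assms, of v v] P'.G_simps T_im assms by (auto simp: image_subset_iff)
    then show "v = 0" using P.G_pos[of x v] D_sub assms by force
  qed
  then show ?thesis using linear_injective_imp_surjective[OF dT_linear[OF assms]] by simp
qed

text \<open>The right side \<open>C\<close> is symmetric and compatible with the metric, and these
  two properties determine the Koszul expression; hence both sides have the same inner products with
  all vectors in the image of the differential of \<open>T\<close>.\<close>

lemma Gam_transform:
  assumes x: "x \<in> D"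
  shows "dir_deriv T x (P.Gam x v w) =
     dir_deriv (\<lambda>y. dir_deriv T y w) x v + P'.Gam (T x) (dir_deriv T x v) (dir_deriv T x w)"
proof -
  have xU: "x \<in> U" and xU': "T x \<in> U'" using x D_sub T_im by auto
  let ?T = "dir_deriv T x"
  define C where "C = (\<lambda>v w. dir_deriv (\<lambda>y. dir_deriv T y w) x v + P'.Gam (T x) (?T v) (?T w))"
  have Csym: "C v w = C w v" for v w
    unfolding C_def using dir_deriv_symmetric_vec[OF open_D x T_smooth] P'.Gam_sym[OF xU'] by metis
  have dG: "P.dG x z v w = G' (T x) (C z v) (?T w) + G' (T x) (?T v) (C z w)" for z v w
  proof -
    let ?l = "\<lambda>s. x + s *\<^sub>R z"
    have l0: "?l 0 \<in> D" using x by simp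
    have 1: "((\<lambda>s. T (?l s)) has_vector_derivative ?T z) (at 0)"
      using dir_deriv_line[OF smooth_onD(2)[OF T_smooth l0]] by simp
    have 2: "((\<lambda>s. dir_deriv T (?l s) a) has_vector_derivative dir_deriv (\<lambda>y. dir_deriv T y a) x z) (at 0)" for a
      using dir_deriv_line[OF smooth_onD(2)[OF smooth_onD(3)[OF T_smooth] l0]] by simp
    have 3: "((\<lambda>s. G' (T (?l s)) (dir_deriv T (?l s) v) (dir_deriv T (?l s) w)) has_vector_derivative
        G' (T x) (C z v) (?T w) + G' (T x) (?T v) (C z w)) (at 0)"
      using P'.G_has_vector_derivative[OF 1 _ UNIV_I 2 2, of v w] xU' by (simp add: C_def)
    have "(?l \<longlongrightarrow> ?l 0) (at 0)" by (intro tendsto_intros)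
    then have "\<forall>\<^sub>F s in at 0. ?l s \<in> D" using open_D l0 by (auto dest: topological_tendstoD)
    then have ev: "\<forall>\<^sub>F s in at 0. G' (T (?l s)) (dir_deriv T (?l s) v) (dir_deriv T (?l s) w) = G (?l s) v w"
      by eventually_elim (simp add: isometry)
    have 4: "((\<lambda>s. G (?l s) v w) has_vector_derivative G' (T x) (C z v) (?T w) + G' (T x) (?T v) (C z w)) (at 0)"
      unfolding has_vector_derivative_def
      by (rule has_derivative_transform_eventually[OF 3[unfolded has_vector_derivative_def] ev])
         (simp_all add: isometry[OF x])
    have "((\<lambda>s. G (?l s) v w) has_vector_derivative P.dG x z v w) (at 0)"
      using dir_deriv_line[OF P.G_differentiable, of x 0 z v w] xU by (simp add: P.dG_def)
    from vector_derivative_unique_at[OF this 4] show ?thesis .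
  qed
  have "G' (T x) (?T (P.Gam x v w)) (?T z) = G' (T x) (C v w) (?T z)" for z
  proof -
    have "G' (T x) (?T (P.Gam x v w)) (?T z) = P.koszul x v w z"
      using isometry[OF x] P.G_Gam[OF xU] by metis
    also have "\<dots> = G' (T x) (C v w) (?T z)"
      unfolding P.koszul_def dG Csym[of z] Csym[of w v] P'.G_sym[OF xU', of "?T w"] P'.G_sym[OF xU', of "?T v"]
      by simp
    finally show ?thesis .
  qed
  \<comment> \<open>An isometric differential is injective and so onto: its image consists of all
    test vectors.\<close>
  then have "G' (T x) (?T (P.Gam x v w)) z = G' (T x) (C v w) z" for z
    using surjD[OF dT_surj[OF x], of z] by metis
  then have "?T (P.Gam x v w) = C v w" using P'.G_nondegenerate[OF xU'] by blast
  then show ?thesis by (simp add: C_def)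
qed

text \<open>By the transformation law the image curve has second derivative
  \<open>- P'.Gam (T x) v' v'\<close> at 0, as does the quadratic curve of the other chart; the
  Peano expansion bounds the difference.\<close>

lemma transform_quadratic:
  fixes x v :: 'e
  assumes x: "x \<in> D" and "\<epsilon> > 0"
  defines "v' \<equiv> dir_deriv T x v"
  shows "\<exists>\<delta>>0. \<forall>s. \<bar>s\<bar> < \<delta> \<longrightarrow> x + s *\<^sub>R v - (s\<^sup>2 / 2) *\<^sub>R P.Gam x v v \<in> D \<and>
     norm (T (x + s *\<^sub>R v - (s\<^sup>2 / 2) *\<^sub>R P.Gam x v v)
        - (T x + s *\<^sub>R v' - (s\<^sup>2 / 2) *\<^sub>R P'.Gam (T x) v' v')) \<le> \<epsilon> * s\<^sup>2"
proof -
  let ?\<sigma> = "\<lambda>s. x + s *\<^sub>R v - (s\<^sup>2 / 2) *\<^sub>R P.Gam x v v"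
  note q = smooth_composition_quadratic[OF open_D x T_smooth, of v "P.Gam x v v"]
  obtain r where r: "r > 0" "\<And>s. \<bar>s\<bar> < r \<Longrightarrow> ?\<sigma> s \<in> D"
    "\<And>s. \<bar>s\<bar> < r \<Longrightarrow> ((\<lambda>s. T (?\<sigma> s)) has_vector_derivative dir_deriv T (?\<sigma> s) (v - s *\<^sub>R P.Gam x v v)) (at s)"
    using q(1) by blast
  have e: "dir_deriv (\<lambda>y. dir_deriv T y v) x v - dir_deriv T x (P.Gam x v v) = - P'.Gam (T x) v' v'"
    unfolding Gam_transform[OF x] v'_def by simp
  obtain d where d: "d > 0" "\<And>s. \<bar>s\<bar> < d \<Longrightarrow> norm (T (?\<sigma> s) - T (?\<sigma> 0) - s *\<^sub>R dir_deriv T (?\<sigma> 0) (v - 0 *\<^sub>R P.Gam x v v) - (s\<^sup>2 / 2) *\<^sub>R (- P'.Gam (T x) v' v')) \<le> \<epsilon> * s\<^sup>2"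
    using Peano_second_order[OF r(1) r(3) q(3)[unfolded e] \<open>\<epsilon> > 0\<close>] by blast
  show ?thesis
  proof (intro exI[of _ "min r d"] conjI allI impI)
    fix s assume s: "\<bar>s\<bar> < min r d"
    then show "?\<sigma> s \<in> D" using r(2) by simp
    show "norm (T (?\<sigma> s) - (T x + s *\<^sub>R v' - (s\<^sup>2 / 2) *\<^sub>R P'.Gam (T x) v' v')) \<le> \<epsilon> * s\<^sup>2"
      using d(2)[of s] s by (simp add: v'_def algebra_simps)
  qed (use r d in auto)
qed

lemma transform_frame:
  assumes "x \<in> D" "P.orthonormal_frame x E"
  shows "P'.orthonormal_frame (T x) (\<lambda>j. dir_deriv T x (E j))"
  using assms(2) unfolding P.orthonormal_frame_def P'.orthonormal_frame_def isometry[OF assms(1)] .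

end

section \<open>Curves and distances on the manifold\<close>

lemma tendsto_eventually_open:
  "continuous (at t within S) f \<Longrightarrow> open W \<Longrightarrow> f t \<in> W \<Longrightarrow> \<forall>\<^sub>F s in at t within S. f s \<in> W"
  unfolding continuous_within by (rule topological_tendstoD)

locale riemannian_atlas =
  fixes A :: "('a::{t2_space,second_countable_topology}, 'e::euclidean_space) chart set"
    and g :: "'a metric"
  assumes mfd: "riemannian_manifold A g"
begin

abbreviation cdom :: "('a, 'e) chart \<Rightarrow> 'e set" where "cdom c \<equiv> snd c ` fst c"
abbreviation lm :: "('a, 'e) chart \<Rightarrow> 'e \<Rightarrow> 'e \<Rightarrow> 'e \<Rightarrow> real" where "lm c \<equiv> local_metric A g c"
abbreviation tr :: "('a, 'e) chart \<Rightarrow> ('a, 'e) chart \<Rightarrow> 'e \<Rightarrow> 'e" where "tr c d \<equiv> snd d \<circ> chart_inv c"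
abbreviation trdom :: "('a, 'e) chart \<Rightarrow> ('a, 'e) chart \<Rightarrow> 'e set" where "trdom c d \<equiv> snd c ` (fst c \<inter> fst d)"

section \<open>Charts as metric patches; tangent vectors and velocities in coordinates\<close>

lemma atlas: "smooth_atlas A" and metric: "riemannian_metric A g"
  using mfd by (auto simp: riemannian_manifold_def)

lemma chart:
  assumes "c \<in> A"
  shows "open (fst c)" "open (cdom c)" "homeomorphism (fst c) (cdom c) (snd c) (chart_inv c)"
  using atlas assms by (auto simp: smooth_atlas_def is_chart_def)

lemma chart_inverse:
  assumes "c \<in> A"
  shows "m \<in> fst c \<Longrightarrow> chart_inv c (snd c m) = m" "x \<in> cdom c \<Longrightarrow> snd c (chart_inv c x) = x"
    "x \<in> cdom c \<Longrightarrow> chart_inv c x \<in> fst c"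
  using chart(3)[OF assms] by (auto simp: homeomorphism_def)

lemma chart_continuous:
  assumes "c \<in> A"
  shows "continuous_on (fst c) (snd c)" "continuous_on (cdom c) (chart_inv c)"
  using chart(3)[OF assms] by (auto simp: homeomorphism_def)

lemma ex_chart: "\<exists>c\<in>A. m \<in> fst c"
  using atlas by (auto simp: smooth_atlas_def)

lemma open_chart_image:
  assumes "c \<in> A" "open W" shows "open (snd c ` (fst c \<inter> W))"
proof -
  have "snd c ` (fst c \<inter> W) = cdom c \<inter> chart_inv c -` W"
    using chart_inverse[OF assms(1)] by (auto simp: image_iff)
  then show ?thesis
    using continuous_open_preimage[OF chart_continuous(2)[OF assms(1)] chart(2)[OF assms(1)] assms(2)] by simp
qed

lemma tr_smooth: "c \<in> A \<Longrightarrow> d \<in> A \<Longrightarrow> smooth_on (trdom c d) (tr c d)"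
  using atlas by (auto simp: smooth_atlas_def)

lemma open_trdom: "c \<in> A \<Longrightarrow> d \<in> A \<Longrightarrow> open (trdom c d)"
  by (intro open_chart_image chart)

lemma smooth_at_differentiable:
  assumes "c \<in> A" "m \<in> fst c" "smooth_at A h m"
  shows "(h \<circ> chart_inv c) differentiable (at (snd c m))"
proof -
  obtain W where "open W" "m \<in> W" "smooth_fun_on A W h" using assms(3) by (auto simp: smooth_at_def)
  then show ?thesis using assms
    by (intro smooth_onD(2)[of "snd c ` (fst c \<inter> W)"]) (auto simp: smooth_fun_on_def)
qed

lemma tangent_vec_change:
  assumes "c \<in> A" "d \<in> A" "m \<in> fst c" "m \<in> fst d"
  shows "tangent_vec A c m v = tangent_vec A d m (dir_deriv (tr c d) (snd c m) v)"
proof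
  fix h
  show "tangent_vec A c m v h = tangent_vec A d m (dir_deriv (tr c d) (snd c m) v) h"
  proof (cases "smooth_at A h m")
    case True
    have m: "snd c m \<in> trdom c d" "tr c d (snd c m) = snd d m"
      using assms chart_inverse[OF assms(1)] by auto
    have "((h \<circ> chart_inv d) has_derivative dir_deriv (h \<circ> chart_inv d) (snd d m)) (at (tr c d (snd c m)))"
      unfolding m(2) by (rule has_derivative_dir_deriv[OF smooth_at_differentiable[OF assms(2,4) True]])
    then have 1: "((h \<circ> chart_inv d) \<circ> tr c d has_derivative
        dir_deriv (h \<circ> chart_inv d) (snd d m) \<circ> dir_deriv (tr c d) (snd c m)) (at (snd c m))"
      by (rule diff_chain_at[rotated])
         (rule has_derivative_dir_deriv[OF smooth_onD(2)[OF tr_smooth[OF assms(1,2)] m(1)]])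
    have 2: "((h \<circ> chart_inv d) \<circ> tr c d) y = (h \<circ> chart_inv c) y" if "y \<in> trdom c d" for y
      using that chart_inverse[OF assms(1)] chart_inverse[OF assms(2)] by auto
    have "(h \<circ> chart_inv c has_derivative
        dir_deriv (h \<circ> chart_inv d) (snd d m) \<circ> dir_deriv (tr c d) (snd c m)) (at (snd c m))"
      by (rule has_derivative_transform_within_open[OF 1 open_trdom[OF assms(1,2)] m(1) 2])
    then show ?thesis using True by (simp add: tangent_vec_def dir_deriv_eqI)
  qed (simp add: tangent_vec_def)
qed

lemma tangent_vec_linear:
  assumes "c \<in> A" "m \<in> fst c"
  shows "tangent_vec A c m (a *\<^sub>R v + b *\<^sub>R w) = (\<lambda>h. a * tangent_vec A c m v h + b * tangent_vec A c m w h)"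
proof
  fix h
  show "tangent_vec A c m (a *\<^sub>R v + b *\<^sub>R w) h = a * tangent_vec A c m v h + b * tangent_vec A c m w h"
  proof (cases "smooth_at A h m")
    case True
    note l = linear_dir_deriv[OF smooth_at_differentiable[OF assms True]]
    show ?thesis using True by (simp add: tangent_vec_def linear_add[OF l] linear_cmul[OF l])
  qed (simp add: tangent_vec_def)
qed

text \<open>The test function is the inner product of the chart coordinate with \<open>v\<close>;
  its derivative along \<open>v\<close> is \<open>v \<bullet> v\<close>. Positivity of
  \<open>g\<close> is stated for nonzero derivations, so this is what makes the local metric
  definite.\<close>

lemma tangent_vec_nonzero:
  assumes c: "c \<in> A" "m \<in> fst c" and "v \<noteq> 0" shows "tangent_vec A c m v \<noteq> (\<lambda>h. 0)"
proof
  assume 0: "tangent_vec A c m v = (\<lambda>h. 0)"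
  define h where "h = (\<lambda>m. snd c m \<bullet> v)"
  have "smooth_fun_on A (fst c) h" unfolding smooth_fun_on_def
  proof
    fix d assume d: "d \<in> A"
    have "h \<circ> chart_inv d = (\<lambda>x. tr d c x \<bullet> v)" by (auto simp: h_def)
    then show "smooth_on (snd d ` (fst d \<inter> fst c)) (h \<circ> chart_inv d)"
      using smooth_on_inner_left[OF open_trdom[OF d c(1)] tr_smooth[OF d c(1)]] by simp
  qed
  then have sm: "smooth_at A h m" unfolding smooth_at_def using chart[OF c(1)] c(2) by blast
  have "((\<lambda>x. x \<bullet> v) has_derivative (\<lambda>w. w \<bullet> v)) (at (snd c m))" by (auto intro!: derivative_eq_intros)
  then have "(h \<circ> chart_inv c has_derivative (\<lambda>w. w \<bullet> v)) (at (snd c m))"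
    by (rule has_derivative_transform_within_open[OF _ chart(2)[OF c(1)]])
       (use c chart_inverse[OF c(1)] in \<open>auto simp: h_def\<close>)
  then have "tangent_vec A c m v h = v \<bullet> v" using sm by (simp add: tangent_vec_def dir_deriv_eqI)
  then show False using 0 \<open>v \<noteq> 0\<close> by simp
qed

lemma tangent_vec_in: "c \<in> A \<Longrightarrow> m \<in> fst c \<Longrightarrow> tangent_vec A c m v \<in> tangent_space A m"
  unfolding tangent_space_def by blast

lemma patch: assumes c: "c \<in> A" shows "metric_patch (cdom c) (lm c)"
proof (rule metric_patch.intro)
  show "open (cdom c)" by (rule chart(2)[OF c])
next
  fix x w assume x: "x \<in> cdom c"
  let ?m = "chart_inv c x"
  have m: "?m \<in> fst c" by (rule chart_inverse(3)[OF c x])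
  have lin: "g ?m (\<lambda>h. a * X h + b * Y h) Z = a * g ?m X Z + b * g ?m Y Z"
    if "X \<in> tangent_space A ?m" "Y \<in> tangent_space A ?m" "Z \<in> tangent_space A ?m" for X Y Z a b
    using metric that unfolding riemannian_metric_def by blast
  have l: "lm c x (a *\<^sub>R u + b *\<^sub>R v) w = a * lm c x u w + b * lm c x v w" for a b u v
    unfolding local_metric_def tangent_vec_linear[OF c m] by (intro lin tangent_vec_in c m)
  show "linear (\<lambda>v. lm c x v w)"
    using l[of 1 _ 1] l[of _ _ 0 0] by (intro linearI) auto
next
  fix x v w assume x: "x \<in> cdom c"
  show "lm c x v w = lm c x w v" unfolding local_metric_def
    using metric tangent_vec_in[OF c chart_inverse(3)[OF c x]] unfolding riemannian_metric_def by blast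
next
  fix x and v :: 'e assume x: "x \<in> cdom c" and v: "v \<noteq> 0"
  show "lm c x v v > 0" unfolding local_metric_def
    using metric tangent_vec_in[OF c chart_inverse(3)[OF c x]]
      tangent_vec_nonzero[OF c chart_inverse(3)[OF c x] v] unfolding riemannian_metric_def by blast
next
  show "smooth_on (cdom c) (\<lambda>x. lm c x v w)" for v w
    using metric c unfolding riemannian_metric_def by blast
qed

text \<open>Both local metrics evaluate \<open>g\<close> on the same derivations, by
  \<open>tangent_vec_change\<close>.\<close>

lemma change:
  assumes c: "c \<in> A" and d: "d \<in> A"
  shows "chart_change (cdom c) (lm c) (cdom d) (lm d) (tr c d) (trdom c d)"
proof (intro chart_change.intro patch c d chart_change_axioms.intro)
  show "open (trdom c d)" by (rule open_trdom[OF c d])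
  show "trdom c d \<subseteq> cdom c" by auto
  show "tr c d ` trdom c d \<subseteq> cdom d" using chart_inverse(1)[OF c] by auto
  show "smooth_on (trdom c d) (tr c d)" by (rule tr_smooth[OF c d])
  fix x v w assume "x \<in> trdom c d"
  then obtain m where m: "m \<in> fst c" "m \<in> fst d" "x = snd c m" by auto
  have e: "chart_inv c x = m" "chart_inv d (tr c d x) = m"
    using m chart_inverse(1)[OF c] chart_inverse(1)[OF d] by auto
  show "lm c x v w = lm d (tr c d x) (dir_deriv (tr c d) x v) (dir_deriv (tr c d) x w)"
    unfolding local_metric_def e tangent_vec_change[OF c d m(1,2)] m(3)[symmetric] ..
qed

lemma
  assumes c: "c \<in> A"
  shows sharp_eq: "sharp A g c = metric_patch.shp (lm c)"
    and christoffel_eq: "christoffel A g c = metric_patch.Gam (lm c)"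
    and ricci_eq: "ricci A g c = metric_patch.Ric (lm c)"
proof -
  interpret metric_patch "cdom c" "lm c" by (rule patch[OF c])
  show 1: "sharp A g c = shp" by (intro ext) (simp only: sharp_def shp_def)
  have k: "koszul x v w = (\<lambda>z. (dir_deriv (\<lambda>y. lm c y w z) x v + dir_deriv (\<lambda>y. lm c y v z) x w
      - dir_deriv (\<lambda>y. lm c y v w) x z) / 2)" for x v w
    by (rule ext) (simp only: koszul_def dG_def)
  show 2: "christoffel A g c = Gam" by (intro ext) (simp only: christoffel_def Gam_def 1 k)
  have 3: "curvature A g c = Rm" by (intro ext) (simp only: curvature_def Rm_def dGam_def 2)
  show "ricci A g c = Ric" by (intro ext) (simp only: ricci_def Ric_def 3)
qed

lemma velocity_eq:
  assumes c: "c \<in> A" "\<gamma> t \<in> fst c" and cont: "isCont \<gamma> t"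
    and v: "(snd c \<circ> \<gamma> has_vector_derivative v) (at t)"
  shows "velocity A \<gamma> t = tangent_vec A c (\<gamma> t) v"
proof
  fix h
  show "velocity A \<gamma> t h = tangent_vec A c (\<gamma> t) v h"
  proof (cases "smooth_at A h (\<gamma> t)")
    case True
    have 1: "((\<lambda>s. (h \<circ> chart_inv c) ((snd c \<circ> \<gamma>) s)) has_vector_derivative dir_deriv (h \<circ> chart_inv c) ((snd c \<circ> \<gamma>) t) v) (at t)"
      by (rule has_vector_derivative_chain_dir_deriv[OF _ v]) (use smooth_at_differentiable[OF c True] in \<open>simp add: o_def\<close>)
    have 2: "\<forall>\<^sub>F s in at t. (h \<circ> chart_inv c) ((snd c \<circ> \<gamma>) s) = (h \<circ> \<gamma>) s"
      using tendsto_eventually_open[of t UNIV \<gamma> "fst c", OF cont chart(1)[OF c(1)] c(2)]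
      by eventually_elim (simp add: chart_inverse[OF c(1)])
    have "(h \<circ> \<gamma> has_vector_derivative dir_deriv (h \<circ> chart_inv c) (snd c (\<gamma> t)) v) (at t)"
      unfolding has_vector_derivative_def
      by (rule has_derivative_transform_eventually[OF 1[unfolded has_vector_derivative_def, simplified o_apply] 2[simplified o_apply], unfolded o_def[symmetric]])
         (simp_all add: chart_inverse[OF c(1)] c(2))
    then show ?thesis using True by (simp add: velocity_def tangent_vec_def vector_derivative_at)
  qed (simp add: velocity_def tangent_vec_def)
qed

lemma speed_eq:
  assumes c: "c \<in> A" "\<gamma> t \<in> fst c" and cont: "isCont \<gamma> t"
    and v: "(snd c \<circ> \<gamma> has_vector_derivative v) (at t)"
  shows "speed A g \<gamma> t = sqrt (lm c (snd c (\<gamma> t)) v v)"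
  unfolding speed_def velocity_eq[OF assms] local_metric_def chart_inverse(1)[OF c] ..

section \<open>Curves of class C1, integrability of the speed and length estimates\<close>

lemma C1_curve_cong:
  assumes "\<And>t. t \<in> {a..b} \<Longrightarrow> \<gamma> t = \<eta> t" "C1_curve A \<gamma> a b" shows "C1_curve A \<eta> a b"
  unfolding C1_curve_def
proof (intro conjI ballI)
  show "continuous_on {a..b} \<eta>"
    by (rule continuous_on_eq[of _ \<gamma>]) (use assms in \<open>auto simp: C1_curve_def\<close>)
  fix c assume "c \<in> A"
  then obtain D where D: "continuous_on {t \<in> {a..b}. \<gamma> t \<in> fst c} D"
    "\<And>t. t\<in>{a..b} \<Longrightarrow> \<gamma> t \<in> fst c \<Longrightarrow> (snd c \<circ> \<gamma> has_vector_derivative D t) (at t within {a..b})"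
    using assms(2) by (auto simp: C1_curve_def)
  have e: "{t \<in> {a..b}. \<eta> t \<in> fst c} = {t \<in> {a..b}. \<gamma> t \<in> fst c}" using assms(1) by auto
  show "\<exists>D. continuous_on {t \<in> {a..b}. \<eta> t \<in> fst c} D \<and>
    (\<forall>t\<in>{a..b}. \<eta> t \<in> fst c \<longrightarrow> (snd c \<circ> \<eta> has_vector_derivative D t) (at t within {a..b}))"
  proof (intro exI[of _ D] conjI ballI impI)
    show "continuous_on {t \<in> {a..b}. \<eta> t \<in> fst c} D" unfolding e by (rule D(1))
    fix t assume t: "t \<in> {a..b}" "\<eta> t \<in> fst c"
    then have "(snd c \<circ> \<gamma> has_vector_derivative D t) (at t within {a..b})" using D(2) assms(1) by auto
    then show "(snd c \<circ> \<eta> has_vector_derivative D t) (at t within {a..b})"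
      by (rule has_vector_derivative_transform[OF t(1), rotated]) (simp add: assms(1))
  qed
qed

lemma C1_curve_scale:
  assumes "k > 0" "C1_curve A \<gamma> (k * a) (k * b)" shows "C1_curve A (\<lambda>t. \<gamma> (k * t)) a b"
  unfolding C1_curve_def
proof (intro conjI ballI)
  have im: "(\<lambda>t. k * t) ` {a..b} = {k * a..k * b}" using \<open>k > 0\<close> by (simp add: image_mult_atLeastAtMost)
  have ink: "k * t \<in> {k * a..k * b}" if "t \<in> {a..b}" for t using that \<open>k > 0\<close> by auto
  show "continuous_on {a..b} (\<lambda>t. \<gamma> (k * t))"
  proof (rule continuous_on_compose2[of "{k * a..k * b}" \<gamma>])
    show "continuous_on {k * a..k * b} \<gamma>" using assms(2) by (simp add: C1_curve_def)
    show "continuous_on {a..b} (\<lambda>t. k * t)" by (intro continuous_intros)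
    show "(\<lambda>t. k * t) ` {a..b} \<subseteq> {k * a..k * b}" using im by simp
  qed
  fix c assume "c \<in> A"
  then obtain D where D: "continuous_on {t \<in> {k * a..k * b}. \<gamma> t \<in> fst c} D"
    "\<And>t. t\<in>{k * a..k * b} \<Longrightarrow> \<gamma> t \<in> fst c \<Longrightarrow> (snd c \<circ> \<gamma> has_vector_derivative D t) (at t within {k * a..k * b})"
    using assms(2) by (auto simp: C1_curve_def)
  show "\<exists>D. continuous_on {t \<in> {a..b}. \<gamma> (k * t) \<in> fst c} D \<and>
    (\<forall>t\<in>{a..b}. \<gamma> (k * t) \<in> fst c \<longrightarrow> (snd c \<circ> (\<lambda>t. \<gamma> (k * t)) has_vector_derivative D t) (at t within {a..b}))"
  proof (intro exI[of _ "\<lambda>t. k *\<^sub>R D (k * t)"] conjI ballI impI)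
    show "continuous_on {t \<in> {a..b}. \<gamma> (k * t) \<in> fst c} (\<lambda>t. k *\<^sub>R D (k * t))"
    proof (intro continuous_on_scaleR continuous_on_const, rule continuous_on_compose2[OF D(1)])
      show "continuous_on {t \<in> {a..b}. \<gamma> (k * t) \<in> fst c} (\<lambda>t. k * t)" by (intro continuous_intros)
    qed (use ink in auto)
    fix t assume t: "t \<in> {a..b}" "\<gamma> (k * t) \<in> fst c"
    have "((\<lambda>t. k * t) has_real_derivative k) (at t within {a..b})" by (auto intro!: derivative_eq_intros)
    moreover have "(snd c \<circ> \<gamma> has_vector_derivative D (k * t)) (at (k * t) within (\<lambda>t. k * t) ` {a..b})"
      unfolding im using D(2)[OF ink[OF t(1)] t(2)] .
    ultimately have "((snd c \<circ> \<gamma>) \<circ> (\<lambda>t. k * t) has_vector_derivative k *\<^sub>R D (k * t)) (at t within {a..b})"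
      unfolding has_real_derivative_iff_has_vector_derivative by (rule vector_diff_chain_within)
    then show "(snd c \<circ> (\<lambda>t. \<gamma> (k * t)) has_vector_derivative k *\<^sub>R D (k * t)) (at t within {a..b})"
      by (simp add: o_def)
  qed
qed

text \<open>In another chart the derivative is the image of \<open>u1\<close> under the differential
  of the transition map, which varies continuously along the curve.\<close>

lemma C1_curve_chart:
  assumes c: "c \<in> A" and u: "\<And>t. t \<in> {a..b} \<Longrightarrow> u t \<in> cdom c"
    and du: "\<And>t. t \<in> {a..b} \<Longrightarrow> (u has_vector_derivative u1 t) (at t within {a..b})"
    and cu1: "continuous_on {a..b} u1"
  shows "C1_curve A (\<lambda>t. chart_inv c (u t)) a b"
  unfolding C1_curve_def
proof (intro conjI ballI)
  have cu: "continuous_on {a..b} u" by (rule continuous_on_vector_derivative[OF du])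
  show "continuous_on {a..b} (\<lambda>t. chart_inv c (u t))"
    by (rule continuous_on_compose2[OF chart_continuous(2)[OF c] cu]) (use u in auto)
  fix d assume d: "d \<in> A"
  interpret chart_change "cdom c" "lm c" "cdom d" "lm d" "tr c d" "trdom c d" by (rule change[OF c d])
  have dm: "u t \<in> trdom c d" if "t \<in> {a..b}" "chart_inv c (u t) \<in> fst d" for t
    using that chart_inverse[OF c] u[OF that(1)] by (auto simp: image_iff)
  show "\<exists>D. continuous_on {t \<in> {a..b}. chart_inv c (u t) \<in> fst d} D \<and>
    (\<forall>t\<in>{a..b}. chart_inv c (u t) \<in> fst d \<longrightarrow> (snd d \<circ> (\<lambda>t. chart_inv c (u t)) has_vector_derivative D t) (at t within {a..b}))"
  proof (intro exI[of _ "\<lambda>t. dir_deriv (tr c d) (u t) (u1 t)"] conjI ballI impI)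
    show "continuous_on {t \<in> {a..b}. chart_inv c (u t) \<in> fst d} (\<lambda>t. dir_deriv (tr c d) (u t) (u1 t))"
      by (rule continuous_on_linear_family[where U = "trdom c d" and L = "dir_deriv (tr c d)", OF dT_linear smooth_onD(1)[OF smooth_onD(3)[OF T_smooth]]])
         (use dm in \<open>auto intro: continuous_on_subset[OF cu] continuous_on_subset[OF cu1]\<close>)
    fix t assume t: "t \<in> {a..b}" "chart_inv c (u t) \<in> fst d"
    show "(snd d \<circ> (\<lambda>t. chart_inv c (u t)) has_vector_derivative dir_deriv (tr c d) (u t) (u1 t)) (at t within {a..b})"
      using has_vector_derivative_chain_dir_deriv[OF smooth_onD(2)[OF T_smooth dm[OF t]] du[OF t(1)]] by (simp add: o_def)
  qed
qed

text \<open>\<open>speed\<close> is built from two-sided derivatives, whereas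
  \<open>C1_curve\<close> provides derivatives within the interval; the two agree in the
  interior.\<close>

lemma C1_curve_velocity:
  assumes "C1_curve A \<gamma> a b" "t \<in> {a<..<b}" "c \<in> A" "\<gamma> t \<in> fst c"
    and "(snd c \<circ> \<gamma> has_vector_derivative D) (at t within {a..b})"
  shows "isCont \<gamma> t" "(snd c \<circ> \<gamma> has_vector_derivative D) (at t)"
    "speed A g \<gamma> t = sqrt (lm c (snd c (\<gamma> t)) D D)"
proof -
  have n: "at t within {a..b} = at t" using assms(2) by (intro at_within_interior) auto
  show "isCont \<gamma> t" using assms(1,2) n unfolding C1_curve_def
    by (metis continuous_on_eq_continuous_within greaterThanLessThan_iff atLeastAtMost_iff less_imp_le)
  moreover show "(snd c \<circ> \<gamma> has_vector_derivative D) (at t)" using assms(5) n by simp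
  ultimately show "speed A g \<gamma> t = sqrt (lm c (snd c (\<gamma> t)) D D)" using assms by (intro speed_eq)
qed

text \<open>Near each parameter a single chart shows the speed as a continuous function, up to the
  end points of the subinterval; integrability on small subintervals then gives it on the whole
  interval.\<close>

lemma C1_curve_speed_integrable:
  assumes C: "C1_curve A \<gamma> a b" shows "speed A g \<gamma> integrable_on {a..b}"
proof -
  have "speed A g \<gamma> integrable_on cbox a b"
  proof (rule integrable_on_little_subintervals, intro ballI)
    fix t assume t: "t \<in> cbox a b"
    obtain c where c: "c \<in> A" "\<gamma> t \<in> fst c" using ex_chart by blast
    interpret metric_patch "cdom c" "lm c" by (rule patch[OF c(1)])
    obtain D where D: "continuous_on {t \<in> {a..b}. \<gamma> t \<in> fst c} D"
      "\<And>t. t\<in>{a..b} \<Longrightarrow> \<gamma> t \<in> fst c \<Longrightarrow> (snd c \<circ> \<gamma> has_vector_derivative D t) (at t within {a..b})"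
      using C c(1) by (auto simp: C1_curve_def)
    have c\<gamma>: "continuous_on {a..b} \<gamma>" using C by (simp add: C1_curve_def)
    then have "continuous (at t within {a..b}) \<gamma>" using t by (simp add: continuous_on_eq_continuous_within)
    then have "\<forall>\<^sub>F s in at t within {a..b}. \<gamma> s \<in> fst c"
      using tendsto_eventually_open[of t "{a..b}" \<gamma> "fst c"] chart(1)[OF c(1)] c(2) by blast
    then obtain r where r: "r > 0" "\<And>s. s \<in> {a..b} \<Longrightarrow> dist s t < r \<Longrightarrow> \<gamma> s \<in> fst c"
      using c(2) unfolding eventually_at by metis
    show "\<exists>d>0. \<forall>u v. t \<in> cbox u v \<and> cbox u v \<subseteq> ball t d \<and> cbox u v \<subseteq> cbox a b \<longrightarrow> speed A g \<gamma> integrable_on cbox u v"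
    proof (intro exI[of _ r] conjI allI impI r(1))
      fix u v assume uv: "t \<in> cbox u v \<and> cbox u v \<subseteq> ball t r \<and> cbox u v \<subseteq> cbox a b"
      have sub: "{u..v} \<subseteq> {s \<in> {a..b}. \<gamma> s \<in> fst c}"
      proof
        fix s assume s: "s \<in> {u..v}"
        then have "s \<in> ball t r" "s \<in> {a..b}" using uv by auto
        then show "s \<in> {s \<in> {a..b}. \<gamma> s \<in> fst c}" using r(2)[of s] by (simp add: dist_commute)
      qed
      have 1: "continuous_on {u..v} (\<lambda>s. sqrt (lm c (snd c (\<gamma> s)) (D s) (D s)))"
      proof (intro continuous_intros continuous_on_G)
        have "continuous_on {u..v} \<gamma>" by (rule continuous_on_subset[OF c\<gamma>]) (use sub in auto)
        then show "continuous_on {u..v} (\<lambda>s. snd c (\<gamma> s))"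
          by (rule continuous_on_compose2[OF chart_continuous(1)[OF c(1)]]) (use sub in auto)
        show "(\<lambda>s. snd c (\<gamma> s)) ` {u..v} \<subseteq> cdom c" using sub by auto
        show "continuous_on {u..v} D" "continuous_on {u..v} D" by (rule continuous_on_subset[OF D(1) sub])+
      qed
      have "speed A g \<gamma> integrable_on {u..v}"
      proof (rule integrable_spike_finite[OF _ _ integrable_continuous_real[OF 1]])
        show "finite {u, v}" by simp
        fix s assume s: "s \<in> {u..v} - {u, v}"
        have "u \<in> {u..v}" "v \<in> {u..v}" using s by auto
        then have "u \<in> {a..b}" "v \<in> {a..b}" using sub by blast+
        then have "s \<in> {a<..<b}" using s by auto
        moreover have "\<gamma> s \<in> fst c" using sub s by auto
        ultimately show "speed A g \<gamma> s = sqrt (lm c (snd c (\<gamma> s)) (D s) (D s))"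
          using D(2)[of s] by (intro C1_curve_velocity(3)[OF C _ c(1)]) auto
      qed
      then show "speed A g \<gamma> integrable_on cbox u v" by simp
    qed
  qed
  then show ?thesis by simp
qed

text \<open>The differential is bounded by \<open>K\<close> in the norm dual to \<open>g\<close>.
  Mere differentiability is asked for, so that a bump function of class C1 qualifies. Such functions
  bound lengths from below.\<close>

definition lipschitz_fun :: "('a \<Rightarrow> real) \<Rightarrow> real \<Rightarrow> bool" where
  "lipschitz_fun h K \<longleftrightarrow> (\<forall>c\<in>A. \<forall>x\<in>cdom c. \<exists>D.
     ((h \<circ> chart_inv c) has_derivative D) (at x) \<and> (\<forall>v. \<bar>D v\<bar> \<le> K * sqrt (lm c x v v)))"

text \<open>The fundamental theorem of calculus for \<open>h \<circ> \<gamma>\<close>, whose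
  derivative is at most \<open>K\<close> times the speed.\<close>

lemma C1_curve_lipschitz:
  assumes C: "C1_curve A \<gamma> a b" and ab: "a \<le> b" and h: "lipschitz_fun h K"
  shows "\<bar>h (\<gamma> b) - h (\<gamma> a)\<bar> \<le> K * integral {a..b} (speed A g \<gamma>)"
proof -
  have "\<exists>d. ((h \<circ> \<gamma>) has_vector_derivative d) (at t within {a..b}) \<and> (t \<in> {a<..<b} \<longrightarrow> \<bar>d\<bar> \<le> K * speed A g \<gamma> t)"
    if t: "t \<in> {a..b}" for t
  proof -
    obtain c where c: "c \<in> A" "\<gamma> t \<in> fst c" using ex_chart by blast
    obtain D where D: "(snd c \<circ> \<gamma> has_vector_derivative D) (at t within {a..b})"
      using C c t unfolding C1_curve_def by blast
    have x: "snd c (\<gamma> t) \<in> cdom c" using c by auto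
    obtain D' where D': "((h \<circ> chart_inv c) has_derivative D') (at (snd c (\<gamma> t)))"
      "\<And>v. \<bar>D' v\<bar> \<le> K * sqrt (lm c (snd c (\<gamma> t)) v v)" using h c x unfolding lipschitz_fun_def by metis
    have 1: "((\<lambda>s. (h \<circ> chart_inv c) (snd c (\<gamma> s))) has_vector_derivative D' D) (at t within {a..b})"
      using has_vector_derivative_chain_dir_deriv[of "h \<circ> chart_inv c" "\<lambda>s. snd c (\<gamma> s)" t D "{a..b}"] D D'(1)
      by (auto simp: o_def differentiable_def dir_deriv_eqI)
    have "continuous (at t within {a..b}) \<gamma>" using C t by (simp add: C1_curve_def continuous_on_eq_continuous_within)
    then have "\<forall>\<^sub>F s in at t within {a..b}. \<gamma> s \<in> fst c"
      using tendsto_eventually_open[of t "{a..b}" \<gamma> "fst c"] chart(1)[OF c(1)] c(2) by blast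
    then have 2: "\<forall>\<^sub>F s in at t within {a..b}. (h \<circ> chart_inv c) (snd c (\<gamma> s)) = (h \<circ> \<gamma>) s"
      by eventually_elim (simp add: chart_inverse[OF c(1)])
    have "((h \<circ> \<gamma>) has_vector_derivative D' D) (at t within {a..b})"
      unfolding has_vector_derivative_def
      by (rule has_derivative_transform_eventually[OF 1[unfolded has_vector_derivative_def] 2])
         (simp_all add: chart_inverse[OF c(1)] c(2) t[simplified])
    moreover have "\<bar>D' D\<bar> \<le> K * speed A g \<gamma> t" if "t \<in> {a<..<b}"
      unfolding C1_curve_velocity(3)[OF C that c D] by (rule D'(2))
    ultimately show ?thesis by blast
  qed
  then obtain d where d: "\<And>t. t \<in> {a..b} \<Longrightarrow> ((h \<circ> \<gamma>) has_vector_derivative d t) (at t within {a..b})"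
    "\<And>t. t \<in> {a<..<b} \<Longrightarrow> \<bar>d t\<bar> \<le> K * speed A g \<gamma> t" by (metis greaterThanLessThan_iff atLeastAtMost_iff less_imp_le)
  have "(d has_integral (h \<circ> \<gamma>) b - (h \<circ> \<gamma>) a) {a..b}"
    by (rule fundamental_theorem_of_calculus[OF ab d(1)])
  \<comment> \<open>The derivative is compared with the speed in the interior only, hence the
    passage to the open interval.\<close>
  then have 1: "(d has_integral h (\<gamma> b) - h (\<gamma> a)) {a<..<b}" by (simp add: has_integral_Icc_iff_Ioo)
  have "((\<lambda>t. K * speed A g \<gamma> t) has_integral K * integral {a..b} (speed A g \<gamma>)) {a..b}"
    by (intro has_integral_mult_right integrable_integral C1_curve_speed_integrable C)
  then have 2: "((\<lambda>t. K * speed A g \<gamma> t) has_integral K * integral {a..b} (speed A g \<gamma>)) {a<..<b}"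
    by (simp add: has_integral_Icc_iff_Ioo)
  have "norm (integral {a<..<b} d) \<le> integral {a<..<b} (\<lambda>t. K * speed A g \<gamma> t)"
    by (rule Henstock_Kurzweil_Integration.integral_norm_bound_integral) (use 1 2 d(2) in \<open>auto simp: has_integral_integrable\<close>)
  then show ?thesis unfolding integral_unique[OF 1] integral_unique[OF 2] real_norm_def .
qed

lemma piecewise_C1_curve_length:
  assumes "piecewise_C1_curve A \<gamma> a b"
  shows "a \<le> b" "speed A g \<gamma> integrable_on {a..b}"
    "lipschitz_fun h K \<Longrightarrow> \<bar>h (\<gamma> b) - h (\<gamma> a)\<bar> \<le> K * integral {a..b} (speed A g \<gamma>)"
proof -
  obtain \<tau> :: "nat \<Rightarrow> real" and k where \<tau>: "\<tau> 0 = a" "\<tau> k = b" "\<And>i. i < k \<Longrightarrow> \<tau> i < \<tau> (Suc i)"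
    "\<And>i. i < k \<Longrightarrow> C1_curve A \<gamma> (\<tau> i) (\<tau> (Suc i))"
    using assms unfolding piecewise_C1_curve_def by blast
  have "j \<le> k \<Longrightarrow> \<tau> 0 \<le> \<tau> j \<and> speed A g \<gamma> integrable_on {\<tau> 0..\<tau> j} \<and>
    (lipschitz_fun h K \<longrightarrow> \<bar>h (\<gamma> (\<tau> j)) - h (\<gamma> (\<tau> 0))\<bar> \<le> K * integral {\<tau> 0..\<tau> j} (speed A g \<gamma>))" for j
  proof (induction j)
    case (Suc j)
    then have IH: "\<tau> 0 \<le> \<tau> j" "speed A g \<gamma> integrable_on {\<tau> 0..\<tau> j}"
      "lipschitz_fun h K \<Longrightarrow> \<bar>h (\<gamma> (\<tau> j)) - h (\<gamma> (\<tau> 0))\<bar> \<le> K * integral {\<tau> 0..\<tau> j} (speed A g \<gamma>)" by auto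
    have lt: "\<tau> j \<le> \<tau> (Suc j)" and C: "C1_curve A \<gamma> (\<tau> j) (\<tau> (Suc j))" using \<tau>(3)[of j] \<tau>(4)[of j] Suc by auto
    have i: "speed A g \<gamma> integrable_on {\<tau> 0..\<tau> (Suc j)}"
      using Henstock_Kurzweil_Integration.integrable_combine[OF IH(1) lt IH(2) C1_curve_speed_integrable[OF C]] .
    have "integral {\<tau> 0..\<tau> (Suc j)} (speed A g \<gamma>) = integral {\<tau> 0..\<tau> j} (speed A g \<gamma>) + integral {\<tau> j..\<tau> (Suc j)} (speed A g \<gamma>)"
      using Henstock_Kurzweil_Integration.integral_combine[OF IH(1) lt i] by simp
    moreover have "\<bar>h (\<gamma> (\<tau> (Suc j))) - h (\<gamma> (\<tau> j))\<bar> \<le> K * integral {\<tau> j..\<tau> (Suc j)} (speed A g \<gamma>)" if "lipschitz_fun h K"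
      by (rule C1_curve_lipschitz[OF C lt that])
    ultimately show ?case using IH lt i by (fastforce simp: algebra_simps)
  qed (use integrable_on_refl[of "speed A g \<gamma>" "\<tau> 0"] in simp)
  from this[of k] show "a \<le> b" "speed A g \<gamma> integrable_on {a..b}"
    "lipschitz_fun h K \<Longrightarrow> \<bar>h (\<gamma> b) - h (\<gamma> a)\<bar> \<le> K * integral {a..b} (speed A g \<gamma>)"
    using \<tau>(1,2) by auto
qed

text \<open>For the zero function the Lipschitz inequality says that lengths are nonnegative, so the
  infimum defining \<open>riem_dist\<close> is over a set bounded below.\<close>

lemma lipschitz_fun_0: "lipschitz_fun (\<lambda>m. 0) 1"
  unfolding lipschitz_fun_def
proof (intro ballI exI[of _ "\<lambda>v. 0"] conjI allI)
  fix c x assume c: "c \<in> A" "x \<in> cdom c"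
  interpret metric_patch "cdom c" "lm c" by (rule patch[OF c(1)])
  show "((\<lambda>m. 0) \<circ> chart_inv c has_derivative (\<lambda>v. 0)) (at x)" by (simp add: o_def)
  show "\<bar>0\<bar> \<le> 1 * sqrt (lm c x v v)" for v using G_nonneg[OF c(2)] by simp
qed

section \<open>Upper bounds for the distance by explicit paths\<close>

lemma riem_dist_le:
  assumes "piecewise_C1_curve A \<gamma> 0 1" shows "riem_dist A g (\<gamma> 0) (\<gamma> 1) \<le> curve_length A g \<gamma> 0 1"
  unfolding riem_dist_def
proof (rule cInf_lower)
  show "curve_length A g \<gamma> 0 1 \<in> {curve_length A g \<eta> 0 1 |\<eta>. piecewise_C1_curve A \<eta> 0 1 \<and> \<eta> 0 = \<gamma> 0 \<and> \<eta> 1 = \<gamma> 1}"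
    using assms by blast
  show "bdd_below {curve_length A g \<eta> 0 1 |\<eta>. piecewise_C1_curve A \<eta> 0 1 \<and> \<eta> 0 = \<gamma> 0 \<and> \<eta> 1 = \<gamma> 1}"
    using piecewise_C1_curve_length(3)[OF _ lipschitz_fun_0] unfolding curve_length_def
    by (intro bdd_belowI[of _ 0]) auto
qed

text \<open>A free parameter interval and an upper bound for the length allow paths to be prolonged
  without rescaling; \<open>reach_dist\<close> rescales once, at the end.\<close>

definition reach :: "'a \<Rightarrow> 'a \<Rightarrow> real \<Rightarrow> bool" where
  "reach p x L \<longleftrightarrow> (\<exists>\<gamma> b. b > 0 \<and> piecewise_C1_curve A \<gamma> 0 b \<and> \<gamma> 0 = p \<and> \<gamma> b = x \<and> curve_length A g \<gamma> 0 b \<le> L)"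

lemma reach_dist:
  assumes "reach p x L" shows "riem_dist A g p x \<le> L"
proof -
  obtain \<gamma> b where \<gamma>: "b > 0" "piecewise_C1_curve A \<gamma> 0 b" "\<gamma> 0 = p" "\<gamma> b = x" "curve_length A g \<gamma> 0 b \<le> L"
    using assms unfolding reach_def by blast
  obtain \<tau> :: "nat \<Rightarrow> real" and k where \<tau>: "\<tau> 0 = 0" "\<tau> k = b" "\<And>i. i < k \<Longrightarrow> \<tau> i < \<tau> (Suc i)"
    "\<And>i. i < k \<Longrightarrow> C1_curve A \<gamma> (\<tau> i) (\<tau> (Suc i))"
    using \<gamma>(2) unfolding piecewise_C1_curve_def by blast
  define \<eta> where "\<eta> = (\<lambda>t. \<gamma> (b * t))"
  have pw: "piecewise_C1_curve A \<eta> 0 1" unfolding piecewise_C1_curve_def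
  proof (intro exI[of _ "\<lambda>i. \<tau> i / b"] exI[of _ k] conjI allI impI)
    fix i assume i: "i < k"
    show "\<tau> i / b < \<tau> (Suc i) / b" using \<tau>(3)[OF i] \<gamma>(1) by (simp add: divide_strict_right_mono)
    show "C1_curve A \<eta> (\<tau> i / b) (\<tau> (Suc i) / b)" unfolding \<eta>_def
      using \<tau>(4)[OF i] \<gamma>(1) by (intro C1_curve_scale) auto
  qed (use \<tau> \<gamma> in auto)
  \<comment> \<open>Away from the finitely many break points a parameter is interior to some piece,
    where the speed is computed by a two-sided derivative.\<close>
  have cover: "\<exists>i<k. t \<in> {\<tau> i<..<\<tau> (Suc i)}" if "t \<in> {0..b}" "t \<notin> \<tau> ` {..k}" for t
  proof -
    have "j \<le> k \<Longrightarrow> t < \<tau> j \<Longrightarrow> \<exists>i<k. t \<in> {\<tau> i<..<\<tau> (Suc i)}" for j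
    proof (induction j)
      case 0 then show ?case using that \<tau>(1) by auto
    next
      case (Suc j)
      show ?case
      proof (cases "t < \<tau> j")
        case False
        moreover have "t \<noteq> \<tau> j" using that(2) Suc.prems by auto
        ultimately show ?thesis using Suc.prems by (intro exI[of _ j]) auto
      qed (use Suc in auto)
    qed
    moreover have "t < \<tau> k" using that \<tau>(2) by (metis atLeastAtMost_iff atMost_iff image_eqI le_less order_refl)
    ultimately show ?thesis by blast
  qed
  have sp: "speed A g \<eta> t = b * speed A g \<gamma> (b * t)" if t: "t \<in> {0..1} - (\<lambda>s. s / b) ` \<tau> ` {..k}" for t
  proof -
    have "b * t \<in> {0..b}" using t \<gamma>(1) by (auto simp: mult_left_le)
    moreover have "b * t \<notin> \<tau> ` {..k}"
    proof
      assume "b * t \<in> \<tau> ` {..k}"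
      then have "t \<in> (\<lambda>s. s / b) ` \<tau> ` {..k}" using \<gamma>(1) by (intro image_eqI[of _ _ "b * t"]) auto
      then show False using t by blast
    qed
    ultimately obtain i where i: "i < k" "b * t \<in> {\<tau> i<..<\<tau> (Suc i)}" using cover by blast
    obtain c where c: "c \<in> A" "\<gamma> (b * t) \<in> fst c" using ex_chart by blast
    interpret metric_patch "cdom c" "lm c" by (rule patch[OF c(1)])
    have x: "snd c (\<gamma> (b * t)) \<in> cdom c" using c by auto
    have bt: "b * t \<in> {\<tau> i..\<tau> (Suc i)}" using i(2) by auto
    obtain D where D: "(snd c \<circ> \<gamma> has_vector_derivative D) (at (b * t) within {\<tau> i..\<tau> (Suc i)})"
      using \<tau>(4)[OF i(1)] c bt unfolding C1_curve_def by blast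
    note v = C1_curve_velocity[OF \<tau>(4)[OF i(1)] i(2) c D]
    have "isCont (\<lambda>s. \<gamma> (b * s)) t"
      by (rule continuous_at_compose[of t "\<lambda>s. b * s" \<gamma>, unfolded o_def]) (auto intro!: v(1) continuous_intros)
    moreover have "((snd c \<circ> \<gamma>) \<circ> (\<lambda>t. b * t) has_vector_derivative b *\<^sub>R D) (at t)"
    proof (rule vector_diff_chain_at)
      show "((\<lambda>t. b * t) has_vector_derivative b) (at t)"
        by (auto intro!: derivative_eq_intros simp: has_real_derivative_iff_has_vector_derivative[symmetric])
      show "(snd c \<circ> \<gamma> has_vector_derivative D) (at (b * t))" by (rule v(2))
    qed
    ultimately have "speed A g \<eta> t = sqrt (lm c (snd c (\<gamma> (b * t))) (b *\<^sub>R D) (b *\<^sub>R D))"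
      unfolding \<eta>_def using c by (intro speed_eq) (auto simp: o_def)
    also have "\<dots> = b * speed A g \<gamma> (b * t)" unfolding v(3) using \<gamma>(1)
      by (simp add: G_simps[OF x] mult.assoc[symmetric] real_sqrt_mult)
    finally show ?thesis .
  qed
  have "(speed A g \<gamma> has_integral curve_length A g \<gamma> 0 b) (cbox 0 b)"
    unfolding curve_length_def using piecewise_C1_curve_length(2)[OF \<gamma>(2)] by (simp add: integrable_integral)
  then have "((\<lambda>t. speed A g \<gamma> (b * t)) has_integral (1 / b) * curve_length A g \<gamma> 0 b) {0..1}"
    using has_integral_affinity[of "speed A g \<gamma>" _ 0 b b 0] \<gamma>(1) by (simp add: image_divide_atLeastAtMost divide_simps)
  then have "((\<lambda>t. b * speed A g \<gamma> (b * t)) has_integral b * ((1 / b) * curve_length A g \<gamma> 0 b)) {0..1}"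
    by (rule has_integral_mult_right)
  then have "(speed A g \<eta> has_integral b * ((1 / b) * curve_length A g \<gamma> 0 b)) {0..1}"
    by (rule has_integral_spike_finite[rotated 2, of _ _ _ "(\<lambda>s. s / b) ` \<tau> ` {..k}"]) (use sp in auto)
  then have "curve_length A g \<eta> 0 1 = curve_length A g \<gamma> 0 b"
    unfolding curve_length_def using \<gamma>(1) by (simp add: integral_unique)
  then show ?thesis using riem_dist_le[OF pw] \<gamma> by (simp add: \<eta>_def)
qed

lemma C1_curve_chart_length:
  assumes c: "c \<in> A" and ab: "a \<le> b" and u: "\<And>t. t \<in> {a..b} \<Longrightarrow> u t \<in> cdom c"
    and du: "\<And>t. t \<in> {a..b} \<Longrightarrow> (u has_vector_derivative u1 t) (at t within {a..b})"
    and cu1: "continuous_on {a..b} u1"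
  shows "curve_length A g (\<lambda>t. chart_inv c (u t)) a b = integral {a..b} (\<lambda>t. sqrt (lm c (u t) (u1 t) (u1 t)))"
proof -
  note C = C1_curve_chart[OF c u du cu1]
  have "speed A g (\<lambda>t. chart_inv c (u t)) t = sqrt (lm c (u t) (u1 t) (u1 t))" if t: "t \<in> {a..b} - {a, b}" for t
  proof -
    have t': "t \<in> {a..b}" "t \<in> {a<..<b}" using t by auto
    have "(snd c \<circ> (\<lambda>t. chart_inv c (u t)) has_vector_derivative u1 t) (at t within {a..b})"
      by (rule has_vector_derivative_transform[OF t'(1) _ du[OF t'(1)]]) (simp add: chart_inverse[OF c] u)
    from C1_curve_velocity(3)[OF C t'(2) c _ this] show ?thesis
      using chart_inverse[OF c] u[OF t'(1)] by simp
  qed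
  then show ?thesis unfolding curve_length_def
    by (intro integral_spike[OF negligible_finite, of "{a, b}"]) auto
qed

text \<open>The chart curve, shifted to start at parameter \<open>e\<close>, becomes one more piece;
  the junction is a single parameter and does not contribute to the integral.\<close>

lemma reach_extend:
  assumes r: "reach p (chart_inv c (u a)) L" and c: "c \<in> A" and ab: "a < b" and u: "\<And>t. t \<in> {a..b} \<Longrightarrow> u t \<in> cdom c"
    and du: "\<And>t. t \<in> {a..b} \<Longrightarrow> (u has_vector_derivative u1 t) (at t within {a..b})"
    and cu1: "continuous_on {a..b} u1"
    and L': "integral {a..b} (\<lambda>t. sqrt (lm c (u t) (u1 t) (u1 t))) \<le> L'"
  shows "reach p (chart_inv c (u b)) (L + L')"
proof -
  obtain \<gamma> e where \<gamma>: "e > 0" "piecewise_C1_curve A \<gamma> 0 e" "\<gamma> 0 = p" "\<gamma> e = chart_inv c (u a)" "curve_length A g \<gamma> 0 e \<le> L"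
    using r unfolding reach_def by blast
  obtain \<tau> :: "nat \<Rightarrow> real" and k where \<tau>: "\<tau> 0 = 0" "\<tau> k = e" "\<And>i. i < k \<Longrightarrow> \<tau> i < \<tau> (Suc i)"
    "\<And>i. i < k \<Longrightarrow> C1_curve A \<gamma> (\<tau> i) (\<tau> (Suc i))"
    using \<gamma>(2) unfolding piecewise_C1_curve_def by blast
  let ?f = "e + (b - a)"
  define w where "w = (\<lambda>t. u (t - e + a))"
  define w1 where "w1 = (\<lambda>t. u1 (t - e + a))"
  have sh: "t - e + a \<in> {a..b}" if "t \<in> {e..?f}" for t using that by auto
  have w: "w t \<in> cdom c" if "t \<in> {e..?f}" for t unfolding w_def by (rule u[OF sh[OF that]])
  have dw: "(w has_vector_derivative w1 t) (at t within {e..?f})" if t: "t \<in> {e..?f}" for t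
  proof -
    have im: "(\<lambda>t. t - e + a) ` {e..?f} \<subseteq> {a..b}" by auto
    have "((\<lambda>t. t - e + a) has_real_derivative 1) (at t within {e..?f})" by (auto intro!: derivative_eq_intros)
    moreover have "(u has_vector_derivative u1 (t - e + a)) (at (t - e + a) within (\<lambda>t. t - e + a) ` {e..?f})"
      by (rule has_vector_derivative_within_subset[OF du[OF sh[OF t]] im])
    ultimately have "(u \<circ> (\<lambda>t. t - e + a) has_vector_derivative 1 *\<^sub>R u1 (t - e + a)) (at t within {e..?f})"
      unfolding has_real_derivative_iff_has_vector_derivative by (rule vector_diff_chain_within)
    then show ?thesis by (simp add: o_def w_def w1_def)
  qed
  have cw1: "continuous_on {e..?f} w1" unfolding w1_def
    by (rule continuous_on_compose2[OF cu1]) (auto intro!: continuous_intros)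
  have ef: "e \<le> ?f" using ab by simp
  note C = C1_curve_chart[OF c w dw cw1]
  define \<eta> where "\<eta> = (\<lambda>t. if t \<le> e then \<gamma> t else chart_inv c (w t))"
  have \<eta>1: "\<eta> t = \<gamma> t" if "t \<le> e" for t using that by (simp add: \<eta>_def)
  have \<eta>2: "\<eta> t = chart_inv c (w t)" if "t \<ge> e" for t using that \<gamma>(4) by (auto simp: \<eta>_def w_def)
  have \<tau>le: "j \<le> k \<Longrightarrow> i \<le> j \<Longrightarrow> \<tau> i \<le> \<tau> j" for i j
  proof (induction j)
    case (Suc j) then show ?case using \<tau>(3)[of j] by (cases "i = Suc j") auto
  qed auto
  have pw: "piecewise_C1_curve A \<eta> 0 ?f" unfolding piecewise_C1_curve_def
  proof (intro exI[of _ "\<lambda>i. if i \<le> k then \<tau> i else ?f"] exI[of _ "Suc k"] conjI allI impI)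
    fix i assume i: "i < Suc k"
    show "(if i \<le> k then \<tau> i else ?f) < (if Suc i \<le> k then \<tau> (Suc i) else ?f)"
      using i \<tau>(2,3) ab by (cases "i = k") auto
    show "C1_curve A \<eta> (if i \<le> k then \<tau> i else ?f) (if Suc i \<le> k then \<tau> (Suc i) else ?f)"
    proof (cases "i = k")
      case True
      have "C1_curve A \<eta> e ?f" by (rule C1_curve_cong[OF _ C]) (use \<eta>2 in auto)
      then show ?thesis using True \<tau>(2) by simp
    next
      case False
      then have ik: "i < k" using i by simp
      have "C1_curve A \<eta> (\<tau> i) (\<tau> (Suc i))"
        by (rule C1_curve_cong[OF _ \<tau>(4)[OF ik]]) (use \<tau>le[of k "Suc i"] \<tau>(2) ik \<eta>1 in auto)
      then show ?thesis using ik by simp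
    qed
  qed (use \<tau> in auto)
  \<comment> \<open>Speed depends only on the germ of the curve. This identifies the speed of the
    joined curve with that of its two parts away from \<open>e\<close>.\<close>
  have loc: "speed A g \<alpha> t = speed A g \<beta> t" if "open S" "t \<in> S" "\<And>s. s \<in> S \<Longrightarrow> \<alpha> s = \<beta> s" for \<alpha> \<beta> S t
  proof -
    have e: "(h \<circ> \<alpha> has_vector_derivative d) (at t) \<longleftrightarrow> (h \<circ> \<beta> has_vector_derivative d) (at t)" for h :: "'a \<Rightarrow> real" and d
      unfolding has_vector_derivative_def by (rule has_derivative_cong_open[OF that(1,2)]) (use that(3) in auto)
    show ?thesis unfolding speed_def velocity_def vector_derivative_def e that(3)[OF that(2)] ..
  qed
  have i: "speed A g \<eta> integrable_on {0..?f}" by (rule piecewise_C1_curve_length(2)[OF pw])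
  have "curve_length A g \<eta> 0 ?f = curve_length A g \<eta> 0 e + curve_length A g \<eta> e ?f"
    unfolding curve_length_def using Henstock_Kurzweil_Integration.integral_combine[of 0 e ?f "speed A g \<eta>"] \<gamma>(1) ef i by simp
  moreover have "curve_length A g \<eta> 0 e = curve_length A g \<gamma> 0 e"
    unfolding curve_length_def
    by (rule integral_spike[OF negligible_sing[of e]], rule loc[of "{..<e}"]) (auto simp: \<eta>1)
  moreover have "curve_length A g \<eta> e ?f = curve_length A g (\<lambda>t. chart_inv c (w t)) e ?f"
    unfolding curve_length_def
    by (rule integral_spike[OF negligible_sing[of e]], rule loc[of "{e<..}"]) (auto simp: \<eta>2)
  moreover have "curve_length A g (\<lambda>t. chart_inv c (w t)) e ?f = integral {e..?f} (\<lambda>t. sqrt (lm c (w t) (w1 t) (w1 t)))"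
    by (rule C1_curve_chart_length[OF c ef w dw cw1])
  moreover have "integral {e..?f} (\<lambda>t. sqrt (lm c (w t) (w1 t) (w1 t))) = integral {a..b} (\<lambda>t. sqrt (lm c (u t) (u1 t) (u1 t)))"
  proof -
    have "continuous_on {a..b} (\<lambda>t. sqrt (lm c (u t) (u1 t) (u1 t)))"
      using u continuous_on_vector_derivative[OF du] cu1
      by (intro continuous_intros metric_patch.continuous_on_G[OF patch[OF c]]) auto
    moreover have "(\<lambda>x. x + e - a) ` {a..b} = {e..b + e - a}"
      using image_add_atLeastAtMost'[of "e - a" a b] by (simp add: algebra_simps)
    moreover note integrable_integral[OF integrable_continuous_real[OF calculation(1)]]
    ultimately
    have "((\<lambda>t. sqrt (lm c (u (1 * t + (a - e))) (u1 (1 * t + (a - e))) (u1 (1 * t + (a - e))))) has_integral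
        integral {a..b} (\<lambda>t. sqrt (lm c (u t) (u1 t) (u1 t)))) {e..?f}"
      using has_integral_affinity[of "\<lambda>t. sqrt (lm c (u t) (u1 t) (u1 t))" _ a b 1 "a - e"] ab
      by (simp add: image_add_atLeastAtMost algebra_simps)
    then show ?thesis by (simp add: w_def w1_def integral_unique algebra_simps)
  qed
  ultimately have "curve_length A g \<eta> 0 ?f \<le> L + L'" using \<gamma>(5) L' by linarith
  moreover have "\<eta> 0 = p" "\<eta> ?f = chart_inv c (u b)" using \<gamma>(1,3) ab \<eta>1[of 0] \<eta>2[of ?f] by (auto simp: w_def)
  ultimately show ?thesis unfolding reach_def using pw \<gamma>(1) ab by (intro exI[of _ \<eta>] exI[of _ ?f]) auto
qed

lemma reach_mono: "reach p x L \<Longrightarrow> L \<le> L' \<Longrightarrow> reach p x L'"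
  unfolding reach_def by (blast intro: order_trans)

lemma reach_refl: "reach p p 0"
proof -
  obtain c where c: "c \<in> A" "p \<in> fst c" using ex_chart by blast
  interpret metric_patch "cdom c" "lm c" by (rule patch[OF c(1)])
  have x: "snd c p \<in> cdom c" using c by auto
  have "C1_curve A (\<lambda>t. chart_inv c (snd c p)) 0 1"
    by (rule C1_curve_chart[where u = "\<lambda>_. snd c p" and ?u1.0 = "\<lambda>_. 0"]) (use c x in auto)
  then have "piecewise_C1_curve A (\<lambda>t. p) 0 1"
    unfolding piecewise_C1_curve_def chart_inverse(1)[OF c]
    by (intro exI[of _ "\<lambda>i. real i"] exI[of _ 1]) auto
  moreover have "curve_length A g (\<lambda>t. chart_inv c (snd c p)) 0 1 = integral {0..1::real} (\<lambda>t. sqrt (lm c (snd c p) 0 0))"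
    using C1_curve_chart_length[OF c(1), of 0 1 "\<lambda>_. snd c p" "\<lambda>_. 0"] x by simp
  ultimately show ?thesis unfolding reach_def chart_inverse(1)[OF c]
    by (intro exI[of _ "\<lambda>t. p"] exI[of _ 1]) (simp add: G_simps[OF x])
qed

end

section \<open>Barriers along the geodesic\<close>

context riemannian_atlas begin

text \<open>In the coordinates of \<open>c\<close>, the second-order Taylor polynomial at 0 of the
  geodesic with initial velocity \<open>v\<close>.\<close>

definition crv :: "('a, 'e) chart \<Rightarrow> 'e \<Rightarrow> 'e \<Rightarrow> real \<Rightarrow> 'e" where
  "crv c x v s = x + s *\<^sub>R v - (s\<^sup>2 / 2) *\<^sub>R metric_patch.Gam (lm c) x v v"

text \<open>A coordinate ball is convex, so the straight segment stays inside, and the bound on the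
  metric limits its length. It closes the gap between the curves prescribed by two charts.\<close>

lemma reach_segment:
  assumes r: "reach p (chart_inv c y1) L" and c: "c \<in> A" and y: "y1 \<in> cball x \<rho>" "y2 \<in> cball x \<rho>"
    and sub: "cball x \<rho> \<subseteq> cdom c" and M: "\<And>y v. y \<in> cball x \<rho> \<Longrightarrow> lm c y v v \<le> M * (norm v)\<^sup>2"
  shows "reach p (chart_inv c y2) (L + sqrt M * norm (y1 - y2))"
proof -
  define u where "u = (\<lambda>t. y1 + t *\<^sub>R (y2 - y1))"
  have uin: "u t \<in> cball x \<rho>" if "t \<in> {0..1}" for t
  proof -
    have "u t = (1 - t) *\<^sub>R y1 + t *\<^sub>R y2" by (simp add: u_def algebra_simps)
    then show ?thesis using convexD_alt[OF convex_cball y, of t] that by simp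
  qed
  have du: "(u has_vector_derivative (y2 - y1)) (at t within S)" for t S
    unfolding u_def has_vector_derivative_def by (auto intro!: derivative_eq_intros)
  have cu: "continuous_on {0..1} u" unfolding u_def by (intro continuous_intros)
  have "integral {0..1} (\<lambda>t. sqrt (lm c (u t) (y2 - y1) (y2 - y1))) \<le> integral {0..1::real} (\<lambda>t. sqrt M * norm (y1 - y2))"
  proof (rule integral_le)
    show "(\<lambda>t. sqrt (lm c (u t) (y2 - y1) (y2 - y1))) integrable_on {0..1}"
      using uin sub cu
      by (intro integrable_continuous_real continuous_intros metric_patch.continuous_on_G[OF patch[OF c]]) auto
    show "(\<lambda>t::real. sqrt M * norm (y1 - y2)) integrable_on {0..1}"
      by (intro integrable_continuous_real continuous_intros)
    fix t :: real assume t: "t \<in> {0..1}"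
    have "sqrt (lm c (u t) (y2 - y1) (y2 - y1)) \<le> sqrt (M * (norm (y2 - y1))\<^sup>2)"
      by (rule real_sqrt_le_mono[OF M[OF uin[OF t]]])
    then show "sqrt (lm c (u t) (y2 - y1) (y2 - y1)) \<le> sqrt M * norm (y1 - y2)"
      by (simp add: real_sqrt_mult norm_minus_commute)
  qed
  then have le: "integral {0..1} (\<lambda>t. sqrt (lm c (u t) (y2 - y1) (y2 - y1))) \<le> sqrt M * norm (y1 - y2)" by simp
  have "reach p (chart_inv c (u 1)) (L + sqrt M * norm (y1 - y2))"
  proof (rule reach_extend[where a = 0 and ?u1.0 = "\<lambda>t. y2 - y1", OF _ c _ _ du _ le])
    show "reach p (chart_inv c (u 0)) L" using r by (simp add: u_def)
  qed (use uin sub in auto)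
  then show ?thesis by (simp add: u_def)
qed

end

lemma (in metric_patch) Rm_scale: "x \<in> U \<Longrightarrow> Rm x (a *\<^sub>R v) w (a *\<^sub>R v) = a\<^sup>2 *\<^sub>R Rm x v w v"
  by (simp add: Rm_def dGam_simps Gam_simps power2_eq_square scaleR_diff_right scaleR_add_right)

locale geodesic_segment = riemannian_atlas A g
  for A :: "('a::{t2_space,second_countable_topology}, 'e::euclidean_space) chart set" and g +
  fixes \<gamma> :: "real \<Rightarrow> 'a" and \<alpha> \<beta> l :: real and p :: 'a and f :: "'a \<Rightarrow> real"
  assumes \<alpha>: "\<alpha> < 0" and \<beta>: "l < \<beta>" and l0: "0 \<le> l"
    and geo: "geodesic_on A g {\<alpha><..<\<beta>} \<gamma>"
    and unit: "\<And>t. t \<in> {0..l} \<Longrightarrow> speed A g \<gamma> t = 1"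
    and start: "\<gamma> 0 = p"
    and f_smooth: "smooth_fun_on A UNIV f"
begin

abbreviation u :: "('a, 'e) chart \<Rightarrow> real \<Rightarrow> 'e" where "u c t \<equiv> snd c (\<gamma> t)"
definition u1 :: "('a, 'e) chart \<Rightarrow> real \<Rightarrow> 'e" where "u1 c t = vector_derivative (u c) (at t)"
abbreviation J :: "real set" where "J \<equiv> {\<alpha><..<\<beta>}"
definition Jc :: "('a, 'e) chart \<Rightarrow> real set" where "Jc c = {t \<in> J. \<gamma> t \<in> fst c}"

section \<open>The geodesic and the weight function in coordinates\<close>

lemma sub_J: "{0..l} \<subseteq> J" using \<alpha> \<beta> by auto

lemma \<gamma>_cont: "t \<in> J \<Longrightarrow> isCont \<gamma> t"
  using geo unfolding geodesic_on_def by (simp add: continuous_on_eq_continuous_at)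

lemma open_Jc: assumes "c \<in> A" shows "open (Jc c)"
proof -
  have "Jc c = J \<inter> \<gamma> -` fst c" by (auto simp: Jc_def)
  moreover have "continuous_on J \<gamma>" using geo by (simp add: geodesic_on_def)
  ultimately show ?thesis using continuous_open_preimage[OF _ _ chart(1)[OF assms], of J \<gamma>] by simp
qed

lemma u_in: "t \<in> Jc c \<Longrightarrow> u c t \<in> cdom c" by (auto simp: Jc_def)

lemma u_derivatives:
  assumes c: "c \<in> A" and t: "t \<in> Jc c"
  shows "(u c has_vector_derivative u1 c t) (at t)"
    "(u1 c has_vector_derivative - metric_patch.Gam (lm c) (u c t) (u1 c t) (u1 c t)) (at t)"
proof -
  have o: "snd c \<circ> \<gamma> = u c" by auto
  have sm: "smooth_on (Jc c) (u c)" using geo c unfolding geodesic_on_def Jc_def o[symmetric] by blast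
  have d: "(u c has_vector_derivative dir_deriv (u c) t 1) (at t)" if "t \<in> Jc c" for t
    using has_vector_derivative_chain_dir_deriv[of "u c" "\<lambda>s. s" t 1 UNIV] smooth_onD(2)[OF sm that]
      has_vector_derivative_id by simp
  have e: "u1 c t = dir_deriv (u c) t 1" if "t \<in> Jc c" for t
    unfolding u1_def by (rule vector_derivative_at[OF d[OF that]])
  show "(u c has_vector_derivative u1 c t) (at t)" unfolding e[OF t] by (rule d[OF t])
  have "(\<lambda>t. dir_deriv (u c) t 1) differentiable (at t)" by (rule smooth_onD(2)[OF smooth_onD(3)[OF sm] t])
  then have "u1 c differentiable (at t)"
    by (subst differentiable_cong_open[OF open_Jc[OF c] t e]) auto
  then have "(u1 c has_vector_derivative vector_derivative (u1 c) (at t)) (at t)"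
    by (simp add: vector_derivative_works[symmetric])
  moreover have "vector_derivative (u1 c) (at t) + christoffel A g c (u c t) (u1 c t) (u1 c t) = 0"
    using geo c t unfolding geodesic_on_def Jc_def Let_def u1_def[abs_def] by (simp add: o_def)
  ultimately show "(u1 c has_vector_derivative - metric_patch.Gam (lm c) (u c t) (u1 c t) (u1 c t)) (at t)"
    unfolding christoffel_eq[OF c] by (metis eq_neg_iff_add_eq_0)
qed

lemma u_continuous: "c \<in> A \<Longrightarrow> continuous_on (Jc c) (u c)" "c \<in> A \<Longrightarrow> continuous_on (Jc c) (u1 c)"
  by (rule continuous_on_vector_derivative, rule has_vector_derivative_at_within, erule (1) u_derivatives)+

lemma speed_u:
  assumes "c \<in> A" "t \<in> Jc c" shows "speed A g \<gamma> t = sqrt (lm c (u c t) (u1 c t) (u1 c t))"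
  using assms u_derivatives(1)[OF assms] \<gamma>_cont by (intro speed_eq) (auto simp: Jc_def o_def)

lemma unit_u:
  assumes "c \<in> A" "t \<in> Jc c" "t \<in> {0..l}" shows "lm c (u c t) (u1 c t) (u1 c t) = 1"
  using speed_u[OF assms(1,2)] unit[OF assms(3)] by simp

lemma u1_change:
  assumes c: "c \<in> A" and d: "d \<in> A" and t: "t \<in> Jc c" "t \<in> Jc d"
  shows "u1 d t = dir_deriv (tr c d) (u c t) (u1 c t)"
proof -
  have x: "u c t \<in> trdom c d" using t by (auto simp: Jc_def)
  have 1: "((\<lambda>s. tr c d (u c s)) has_vector_derivative dir_deriv (tr c d) (u c t) (u1 c t)) (at t)"
    by (rule has_vector_derivative_chain_dir_deriv[OF smooth_onD(2)[OF tr_smooth[OF c d] x] u_derivatives(1)[OF c t(1)]])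
  have "(u d has_vector_derivative dir_deriv (tr c d) (u c t) (u1 c t)) (at t)"
    by (rule has_vector_derivative_transform_within_open[OF 1 open_Jc[OF c] t(1)])
       (simp add: Jc_def chart_inverse[OF c])
  from vector_derivative_unique_at[OF u_derivatives(1)[OF d t(2)] this] show ?thesis .
qed

definition F :: "real \<Rightarrow> real" where "F t = f (\<gamma> t)"
definition F1 :: "real \<Rightarrow> real" where "F1 = deriv F"
definition F2 :: "real \<Rightarrow> real" where "F2 = deriv F1"

lemma f_chart: "c \<in> A \<Longrightarrow> smooth_on (cdom c) (f \<circ> chart_inv c)"
  using f_smooth by (simp add: smooth_fun_on_def)

text \<open>The coordinate acceleration \<open>- Gam(u1, u1)\<close> of the geodesic supplies
  exactly the connection term of the Hessian, which is why \<open>F2\<close> is the Hessian on the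
  velocity.\<close>

lemma F_derivatives:
  assumes c: "c \<in> A" and t: "t \<in> Jc c"
  shows "(F has_real_derivative F1 t) (at t)" "F1 t = differential c f (u c t) (u1 c t)"
    "(F1 has_real_derivative F2 t) (at t)" "F2 t = hessian A g c f (u c t) (u1 c t) (u1 c t)"
proof -
  let ?h = "f \<circ> chart_inv c"
  have d1: "(F has_real_derivative dir_deriv ?h (u c t) (u1 c t)) (at t)" if t: "t \<in> Jc c" for t
  proof -
    have "((\<lambda>s. ?h (u c s)) has_vector_derivative dir_deriv ?h (u c t) (u1 c t)) (at t)"
      by (rule has_vector_derivative_chain_dir_deriv[OF smooth_onD(2)[OF f_chart[OF c] u_in[OF t]] u_derivatives(1)[OF c t]])
    then show ?thesis unfolding has_real_derivative_iff_has_vector_derivative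
      by (rule has_vector_derivative_transform_within_open[OF _ open_Jc[OF c] t])
         (simp add: F_def Jc_def chart_inverse[OF c])
  qed
  have e: "F1 t = dir_deriv ?h (u c t) (u1 c t)" if "t \<in> Jc c" for t
    unfolding F1_def by (rule DERIV_imp_deriv[OF d1[OF that]])
  show "(F has_real_derivative F1 t) (at t)" unfolding e[OF t] by (rule d1[OF t])
  show "F1 t = differential c f (u c t) (u1 c t)" unfolding e[OF t] differential_def ..
  interpret metric_patch "cdom c" "lm c" by (rule patch[OF c])
  have lin: "linear (dir_deriv ?h y)" if "y \<in> cdom c" for y by (rule linear_dir_deriv[OF smooth_onD(2)[OF f_chart[OF c] that]])
  have "((\<lambda>s. dir_deriv ?h (u c s) (u1 c s)) has_vector_derivative
     dir_deriv (\<lambda>y. dir_deriv ?h y (u1 c t)) (u c t) (u1 c t) + dir_deriv ?h (u c t) (- Gam (u c t) (u1 c t) (u1 c t))) (at t)"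
    by (rule has_vector_derivative_linear_family[OF open_U lin _ u_derivatives(1)[OF c t] _ _ u_derivatives(2)[OF c t]])
       (auto intro: smooth_onD(2)[OF smooth_onD(3)[OF f_chart[OF c]]] u_in[OF t])
  then have "(F1 has_vector_derivative
     dir_deriv (\<lambda>y. dir_deriv ?h y (u1 c t)) (u c t) (u1 c t) + dir_deriv ?h (u c t) (- Gam (u c t) (u1 c t) (u1 c t))) (at t)"
    by (rule has_vector_derivative_transform_within_open[OF _ open_Jc[OF c] t]) (simp add: e)
  then have d2: "(F1 has_real_derivative hessian A g c f (u c t) (u1 c t) (u1 c t)) (at t)"
    unfolding has_real_derivative_iff_has_vector_derivative hessian_def differential_def christoffel_eq[OF c]
    by (simp add: linear_neg[OF lin[OF u_in[OF t]]])
  then show "F2 t = hessian A g c f (u c t) (u1 c t) (u1 c t)" unfolding F2_def by (rule DERIV_imp_deriv)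
  with d2 show "(F1 has_real_derivative F2 t) (at t)" by simp
qed

lemma ex_chart_Jc: "t \<in> J \<Longrightarrow> \<exists>c\<in>A. t \<in> Jc c"
  using ex_chart[of "\<gamma> t"] by (auto simp: Jc_def)

end

text \<open>\<open>H t\<close> stands for the integral of the index integrand from 0 to
  \<open>t\<close>. Prescribing its derivative gives its increments over all subintervals at
  once.\<close>

locale index_form_bound = geodesic_segment A g \<gamma> \<alpha> \<beta> l p f
  for A :: "('a::{t2_space,second_countable_topology}, 'e::euclidean_space) chart set" and g \<gamma> \<alpha> \<beta> l p f +
  fixes \<phi> \<phi>1 H :: "real \<Rightarrow> real" and b0 :: 'e
  assumes CD: "CD_0_1 A g f" and b0: "b0 \<in> Basis"
    and \<phi>: "\<And>t. t \<in> {0..l} \<Longrightarrow> (\<phi> has_real_derivative \<phi>1 t) (at t within {0..l})"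
    and \<phi>1: "continuous_on {0..l} \<phi>1" and \<phi>0: "\<phi> 0 = 0"
    and H: "\<And>t. t \<in> {0..l} \<Longrightarrow> (H has_real_derivative
       (real DIM('e) - 1) * (\<phi>1 t)\<^sup>2 + (\<phi> t)\<^sup>2 * (F2 t + (F1 t)\<^sup>2 / (real DIM('e) - 1))) (at t within {0..l})"
    and H0: "H 0 = 0"
begin

text \<open>The number \<open>I j\<close> bounds the second derivative of the distance from \<open>p\<close> in the direction
  \<open>\<phi> E\<^sub>j\<close>, in the barrier sense.\<close>

definition Qc :: "('a, 'e) chart \<Rightarrow> real \<Rightarrow> bool" where
  "Qc c t \<longleftrightarrow> (\<exists>E I. metric_patch.orthonormal_frame (lm c) (u c t) E \<and> E b0 = u1 c t \<and>
     (\<Sum>j\<in>Basis - {b0}. I j) \<le> H t \<and>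
     (\<forall>j\<in>Basis - {b0}. \<forall>\<epsilon>>0. \<exists>\<delta>>0. \<forall>s. \<bar>s\<bar> < \<delta> \<longrightarrow>
        reach p (chart_inv c (crv c (u c t) (\<phi> t *\<^sub>R E j) s)) (t + s\<^sup>2 / 2 * (I j + \<epsilon>))))"

text \<open>Since \<open>\<phi> 0 = 0\<close>, all transversal curves are constant at
  \<open>p\<close> and \<open>I = 0\<close> works.\<close>

lemma Qc_start: assumes c: "c \<in> A" and t: "0 \<in> Jc c" shows "Qc c 0"
proof -
  interpret metric_patch "cdom c" "lm c" by (rule patch[OF c])
  have x: "u c 0 \<in> cdom c" by (rule u_in[OF t])
  obtain E where E: "orthonormal_frame (u c 0) E" "E b0 = u1 c 0"
    using ex_orthonormal_frame[OF x unit_u[OF c t] b0] l0 by auto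
  have "reach p p (s\<^sup>2 / 2 * \<epsilon>)" if "\<epsilon> > 0" for \<epsilon> s by (rule reach_mono[OF reach_refl]) (use that in simp)
  moreover have "chart_inv c (u c 0) = p" using t start by (simp add: Jc_def chart_inverse[OF c])
  ultimately show ?thesis unfolding Qc_def
    by (intro exI[of _ E] exI[of _ "\<lambda>_. 0"]) (auto simp: E H0 \<phi>0 crv_def Gam_simps[OF x] intro: exI[of _ 1])
qed

text \<open>The differential carries the frame over and \<open>I\<close> is kept. Each path is
  prolonged by a coordinate segment of length \<open>o(s\<^sup>2)\<close> to the curve of the new
  chart, and this length is absorbed into \<open>\<epsilon>\<close>.\<close>

lemma Qc_change:
  assumes d: "d \<in> A" "t \<in> Jc d" and c: "c \<in> A" "t \<in> Jc c" and Q: "Qc d t"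
  shows "Qc c t"
proof -
  interpret chart_change "cdom d" "lm d" "cdom c" "lm c" "tr d c" "trdom d c" by (rule change[OF d(1) c(1)])
  obtain E I where E: "P.orthonormal_frame (u d t) E" "E b0 = u1 d t" and I: "(\<Sum>j\<in>Basis - {b0}. I j) \<le> H t"
    and R: "\<And>j \<epsilon>. j\<in>Basis - {b0} \<Longrightarrow> \<epsilon> > 0 \<Longrightarrow> \<exists>\<delta>>0. \<forall>s. \<bar>s\<bar> < \<delta> \<longrightarrow>
        reach p (chart_inv d (crv d (u d t) (\<phi> t *\<^sub>R E j) s)) (t + s\<^sup>2 / 2 * (I j + \<epsilon>))"
    using Q unfolding Qc_def by blast
  let ?x = "u d t" and ?y = "u c t" and ?T = "tr d c"
  have x: "?x \<in> trdom d c" using c d by (auto simp: Jc_def)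
  have Tx: "?T ?x = ?y" using d(2) by (simp add: Jc_def chart_inverse[OF d(1)])
  have y: "?y \<in> cdom c" by (rule u_in[OF c(2)])
  define E' where "E' = (\<lambda>j. dir_deriv ?T ?x (E j))"
  have E': "P'.orthonormal_frame ?y E'" "E' b0 = u1 c t"
    using transform_frame[OF x E(1)] unfolding E'_def Tx E(2) u1_change[OF d(1) c(1) d(2) c(2)] by blast+
  obtain \<rho> where \<rho>: "\<rho> > 0" "cball ?y \<rho> \<subseteq> cdom c" using open_contains_cball y P'.open_U by blast
  obtain M where M: "M > 0" "\<And>z v. z \<in> cball ?y \<rho> \<Longrightarrow> lm c z v v \<le> M * (norm v)\<^sup>2"
    using P'.G_upper_bound[OF compact_cball \<rho>(2)] by blast
  have "\<exists>\<delta>>0. \<forall>s. \<bar>s\<bar> < \<delta> \<longrightarrow>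
        reach p (chart_inv c (crv c ?y (\<phi> t *\<^sub>R E' j) s)) (t + s\<^sup>2 / 2 * (I j + \<epsilon>))"
    if j: "j \<in> Basis - {b0}" and \<epsilon>: "\<epsilon> > 0" for j \<epsilon>
  proof -
    let ?V = "\<phi> t *\<^sub>R E j" and ?V' = "\<phi> t *\<^sub>R E' j"
    have V': "dir_deriv ?T ?x ?V = ?V'" by (simp add: E'_def linear_cmul[OF dT_linear[OF x]])
    \<comment> \<open>The segment is then at most \<open>s\<^sup>2 / 2 * (\<epsilon> / 2)\<close>
      long, which is the half of the error that the path in chart \<open>d\<close> leaves
      over.\<close>
    define \<epsilon>1 where "\<epsilon>1 = \<epsilon> / (4 * sqrt M)"
    have \<epsilon>1: "\<epsilon>1 > 0" using \<epsilon> M(1) by (simp add: \<epsilon>1_def)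
    obtain \<delta>1 where \<delta>1: "\<delta>1 > 0" "\<And>s. \<bar>s\<bar> < \<delta>1 \<Longrightarrow> crv d ?x ?V s \<in> trdom d c"
      "\<And>s. \<bar>s\<bar> < \<delta>1 \<Longrightarrow> norm (?T (crv d ?x ?V s) - crv c ?y ?V' s) \<le> \<epsilon>1 * s\<^sup>2"
      using transform_quadratic[OF x \<epsilon>1, of ?V] unfolding V' Tx crv_def by blast
    obtain \<delta>2 where \<delta>2: "\<delta>2 > 0" "\<And>s. \<bar>s\<bar> < \<delta>2 \<Longrightarrow>
        reach p (chart_inv d (crv d ?x ?V s)) (t + s\<^sup>2 / 2 * (I j + \<epsilon> / 2))"
      using R[OF j, of "\<epsilon> / 2"] \<epsilon> by auto
    have "isCont (\<lambda>s. crv c ?y ?V' s) 0" unfolding crv_def by (intro continuous_intros) auto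
    moreover have "crv c ?y ?V' 0 = ?y" by (simp add: crv_def)
    ultimately obtain \<delta>3 where \<delta>3: "\<delta>3 > 0" "\<And>s. \<bar>s\<bar> < \<delta>3 \<Longrightarrow> dist (crv c ?y ?V' s) ?y < \<rho> / 2"
      using \<rho>(1) unfolding continuous_at_eps_delta dist_real_def by (metis diff_0_right half_gt_zero)
    \<comment> \<open>For such \<open>s\<close> the two curves are at most \<open>\<rho> / 2\<close>
      apart; the other half of \<open>\<rho>\<close> is spent by \<open>\<delta>3\<close>, so both
      ends of the segment lie in the ball.\<close>
    define \<delta>4 where "\<delta>4 = min 1 (\<rho> / (2 * \<epsilon>1))"
    have \<delta>4: "\<delta>4 > 0" using \<rho>(1) \<epsilon>1 by (simp add: \<delta>4_def)
    have s4: "\<epsilon>1 * s\<^sup>2 \<le> \<rho> / 2" if "\<bar>s\<bar> < \<delta>4" for s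
    proof -
      have "s\<^sup>2 = \<bar>s\<bar> * \<bar>s\<bar>" by (simp add: power2_eq_square)
      also have "\<dots> \<le> \<bar>s\<bar> * 1" using that by (intro mult_left_mono) (auto simp: \<delta>4_def)
      also have "\<dots> \<le> \<rho> / (2 * \<epsilon>1)" using that by (simp add: \<delta>4_def)
      finally show ?thesis using \<epsilon>1 by (simp add: field_simps)
    qed
    show ?thesis
    proof (intro exI[of _ "min (min \<delta>1 \<delta>2) (min \<delta>3 \<delta>4)"] conjI allI impI)
      fix s assume s: "\<bar>s\<bar> < min (min \<delta>1 \<delta>2) (min \<delta>3 \<delta>4)"
      let ?y1 = "?T (crv d ?x ?V s)" and ?y2 = "crv c ?y ?V' s"
      have n: "norm (?y1 - ?y2) \<le> \<epsilon>1 * s\<^sup>2" using \<delta>1(3) s by simp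
      have "dist ?y2 ?y < \<rho> / 2" using \<delta>3(2) s by simp
      moreover have "dist ?y1 ?y2 \<le> \<rho> / 2" using n s4[of s] s by (simp add: dist_norm)
      ultimately have in_ball: "?y1 \<in> cball ?y \<rho>" "?y2 \<in> cball ?y \<rho>"
        using dist_triangle[of ?y1 ?y ?y2] \<rho>(1) by (auto simp: dist_commute[of ?y])
      have "chart_inv c ?y1 = chart_inv d (crv d ?x ?V s)"
      proof -
        have "crv d ?x ?V s \<in> trdom d c" using \<delta>1(2) s by simp
        then show ?thesis using chart_inverse[OF c(1)] chart_inverse[OF d(1)] by auto
      qed
      then have "reach p (chart_inv c ?y1) (t + s\<^sup>2 / 2 * (I j + \<epsilon> / 2))" using \<delta>2(2) s by simp
      from reach_segment[OF this c(1) in_ball \<rho>(2) M(2)]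
      have "reach p (chart_inv c ?y2) (t + s\<^sup>2 / 2 * (I j + \<epsilon> / 2) + sqrt M * norm (?y1 - ?y2))" .
      moreover have "sqrt M * norm (?y1 - ?y2) \<le> sqrt M * (\<epsilon>1 * s\<^sup>2)"
        using n M(1) by (intro mult_left_mono) auto
      moreover have "sqrt M * (\<epsilon>1 * s\<^sup>2) = s\<^sup>2 / 2 * (\<epsilon> / 2)" using M(1) by (simp add: \<epsilon>1_def)
      moreover have "s\<^sup>2 / 2 * (I j + \<epsilon>) = s\<^sup>2 / 2 * (I j + \<epsilon> / 2) + s\<^sup>2 / 2 * (\<epsilon> / 2)"
        by (simp add: field_simps)
      ultimately show "reach p (chart_inv c ?y2) (t + s\<^sup>2 / 2 * (I j + \<epsilon>))"
        by (elim reach_mono) linarith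
    qed (use \<delta>1 \<delta>2 \<delta>3 \<delta>4 in auto)
  qed
  then show ?thesis unfolding Qc_def using E' I by blast
qed

text \<open>The frame is transported along the interval, the paths are prolonged by the varied
  curves, and \<open>I j\<close> grows by the integral of the second variation integrand. The
  curvature condition keeps the sum below \<open>H\<close>.\<close>

lemma Qc_step:
  assumes c: "c \<in> A" and t12: "t1 < t2" and sub: "{t1..t2} \<subseteq> Jc c" "{t1..t2} \<subseteq> {0..l}"
    and M: "\<And>t x. t \<in> {t1..t2} \<Longrightarrow> norm (metric_patch.Gam (lm c) (u c t) (u1 c t) x) \<le> M * norm x"
      "0 \<le> M" "(t2 - t1) * M \<le> 1 / 2"
    and Q: "Qc c t1"
  shows "Qc c t2"
proof -
  interpret metric_patch "cdom c" "lm c" by (rule patch[OF c])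
  let ?I = "{t1..t2}" and ?n = "real DIM('e) - 1"
  obtain E0 I where E0: "orthonormal_frame (u c t1) E0" "E0 b0 = u1 c t1" and I: "(\<Sum>j\<in>Basis - {b0}. I j) \<le> H t1"
    and R: "\<And>j \<epsilon>. j\<in>Basis - {b0} \<Longrightarrow> \<epsilon> > 0 \<Longrightarrow> \<exists>\<delta>>0. \<forall>s. \<bar>s\<bar> < \<delta> \<longrightarrow>
        reach p (chart_inv c (crv c (u c t1) (\<phi> t1 *\<^sub>R E0 j) s)) (t1 + s\<^sup>2 / 2 * (I j + \<epsilon>))"
    using Q unfolding Qc_def by blast
  have tJ: "t \<in> Jc c" "t \<in> {0..l}" if "t \<in> ?I" for t using sub that by auto
  have uU: "u c t \<in> cdom c" if "t \<in> ?I" for t by (rule u_in[OF tJ(1)[OF that]])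
  have du: "(u c has_vector_derivative u1 c t) (at t within ?I)"
    "(u1 c has_vector_derivative - Gam (u c t) (u1 c t) (u1 c t)) (at t within ?I)" if "t \<in> ?I" for t
    by (rule has_vector_derivative_at_within, rule u_derivatives[OF c tJ(1)[OF that]])+
  have cu: "continuous_on ?I (u c)" "continuous_on ?I (u1 c)"
    by (rule continuous_on_subset[OF u_continuous(1)[OF c] sub(1)], rule continuous_on_subset[OF u_continuous(2)[OF c] sub(1)])
  obtain E where E: "\<And>j. E j t1 = E0 j" "E b0 = u1 c"
    "\<And>j t. t \<in> ?I \<Longrightarrow> (E j has_vector_derivative - Gam (u c t) (u1 c t) (E j t)) (at t within ?I)"
    "\<And>t. t \<in> ?I \<Longrightarrow> orthonormal_frame (u c t) (\<lambda>j. E j t)"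
    using parallel_frame[OF less_imp_le[OF t12] uU du(1) cu(2) du(2) M E0 b0] by blast
  define V where "V = (\<lambda>j t. \<phi> t *\<^sub>R E j t)"
  define V1 where "V1 = (\<lambda>j t. \<phi>1 t *\<^sub>R E j t + \<phi> t *\<^sub>R (- Gam (u c t) (u1 c t) (E j t)))"
  have d\<phi>: "(\<phi> has_real_derivative \<phi>1 t) (at t within ?I)" if "t \<in> ?I" for t
    by (rule DERIV_subset[OF \<phi>[OF tJ(2)[OF that]] sub(2)])
  have c\<phi>: "continuous_on ?I \<phi>1" "continuous_on ?I \<phi>"
    by (rule continuous_on_subset[OF \<phi>1 sub(2)], rule DERIV_continuous_on[OF d\<phi>])
  have dV: "(V j has_vector_derivative V1 j t) (at t within ?I)" if "t \<in> ?I" for j t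
    using has_vector_derivative_scaleR[OF d\<phi>[OF that] E(3)[OF that, of j]] unfolding V_def V1_def by (simp add: add.commute)
  have cE: "continuous_on ?I (E j)" for j by (rule continuous_on_vector_derivative[OF E(3)])
  have cV1: "continuous_on ?I (V1 j)" for j unfolding V1_def
    by (intro continuous_intros continuous_on_Gam c\<phi> cE cu) (use uU in auto)
  \<comment> \<open>Parallelism of \<open>E j\<close> leaves only the derivative of
    \<open>\<phi>\<close> in the covariant derivative of \<open>V j\<close>.\<close>
  have nabla: "V1 j t + Gam (u c t) (V j t) (u1 c t) = \<phi>1 t *\<^sub>R E j t" if "t \<in> ?I" for j t
    using Gam_sym[OF uU[OF that], of "V j t"] by (simp add: V1_def V_def Gam_simps[OF uU[OF that]])
  have GE: "lm c (u c t) (E i t) (E j t) = (if i = j then 1 else 0)" if "t \<in> ?I" "i \<in> Basis" "j \<in> Basis" for i j t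
    using E(4)[OF that(1)] that unfolding orthonormal_frame_def by blast
  define \<kappa> where "\<kappa> = (\<lambda>j t. lm c (u c t) (V1 j t + Gam (u c t) (V j t) (u1 c t)) (V1 j t + Gam (u c t) (V j t) (u1 c t))
       + lm c (u c t) (Rm (u c t) (V j t) (u1 c t) (V j t)) (u1 c t))"
  have \<kappa>: "\<kappa> j t = (\<phi>1 t)\<^sup>2 + (\<phi> t)\<^sup>2 * lm c (u c t) (Rm (u c t) (E j t) (u1 c t) (E j t)) (u1 c t)"
    if "t \<in> ?I" "j \<in> Basis - {b0}" for j t
    using GE[OF that(1), of j j] that(2) unfolding \<kappa>_def nabla[OF that(1)]
    unfolding V_def Rm_scale[OF uU[OF that(1)]]
    by (simp add: G_simps[OF uU[OF that(1)]] power2_eq_square)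
  have sv: "continuous_on ?I (\<kappa> j)"
    "\<epsilon> > 0 \<Longrightarrow> \<exists>\<delta>>0. \<forall>s. \<bar>s\<bar> < \<delta> \<longrightarrow> (\<exists>w1. (\<forall>t\<in>?I. crv c (u c t) (V j t) s \<in> cdom c) \<and>
       (\<forall>t\<in>?I. ((\<lambda>t. crv c (u c t) (V j t) s) has_vector_derivative w1 t) (at t within ?I)) \<and>
       continuous_on ?I w1 \<and>
       integral ?I (\<lambda>t. sqrt (lm c (crv c (u c t) (V j t) s) (w1 t) (w1 t)))
         \<le> (t2 - t1) + s\<^sup>2 / 2 * (integral ?I (\<kappa> j) + \<epsilon>))" if j: "j \<in> Basis - {b0}" for j \<epsilon>
  proof -
    \<comment> \<open>The velocity is \<open>E b0\<close>, and \<open>j\<close> differs from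
      \<open>b0\<close>: the covariant derivative of the variation field is normal to the
      curve.\<close>
    have o: "lm c (u c t) (V1 j t + Gam (u c t) (V j t) (u1 c t)) (u1 c t) = 0" if "t \<in> ?I" for t
      using GE[OF that, of j b0] b0 j unfolding nabla[OF that] by (simp add: G_simps[OF uU[OF that]] E(2))
    note s = second_variation[OF t12 uU du(1) cu(2) dV cV1 unit_u[OF c tJ] o]
    show "continuous_on ?I (\<kappa> j)" unfolding \<kappa>_def by (rule s(1)[of 1]) auto
    show "\<epsilon> > 0 \<Longrightarrow> \<exists>\<delta>>0. \<forall>s. \<bar>s\<bar> < \<delta> \<longrightarrow> (\<exists>w1. (\<forall>t\<in>?I. crv c (u c t) (V j t) s \<in> cdom c) \<and>
       (\<forall>t\<in>?I. ((\<lambda>t. crv c (u c t) (V j t) s) has_vector_derivative w1 t) (at t within ?I)) \<and>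
       continuous_on ?I w1 \<and>
       integral ?I (\<lambda>t. sqrt (lm c (crv c (u c t) (V j t) s) (w1 t) (w1 t)))
         \<le> (t2 - t1) + s\<^sup>2 / 2 * (integral ?I (\<kappa> j) + \<epsilon>))"
      unfolding \<kappa>_def crv_def by (rule s(2)) auto
  qed
  define I' where "I' = (\<lambda>j. I j + integral ?I (\<kappa> j))"
  have sumI: "(\<Sum>j\<in>Basis - {b0}. I' j) \<le> H t2"
  proof -
    let ?h = "\<lambda>t. ?n * (\<phi>1 t)\<^sup>2 + (\<phi> t)\<^sup>2 * (F2 t + (F1 t)\<^sup>2 / ?n)"
    have hint: "(?h has_integral H t2 - H t1) ?I"
    proof (rule fundamental_theorem_of_calculus[OF less_imp_le[OF t12]])
      fix t assume t: "t \<in> ?I"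
      show "(H has_vector_derivative ?h t) (at t within ?I)"
        using DERIV_subset[OF H[OF tJ(2)[OF t]] sub(2)]
        by (simp only: has_real_derivative_iff_has_vector_derivative)
    qed
    have sint: "((\<lambda>t. \<Sum>j\<in>Basis - {b0}. \<kappa> j t) has_integral (\<Sum>j\<in>Basis - {b0}. integral ?I (\<kappa> j))) ?I"
      by (intro has_integral_sum integrable_integral integrable_continuous_real sv(1)) auto
    have "(\<Sum>j\<in>Basis - {b0}. \<kappa> j t) \<le> ?h t" if t: "t \<in> ?I" for t
    proof -
      have "(\<Sum>j\<in>Basis - {b0}. \<kappa> j t) = (\<Sum>j\<in>Basis - {b0}. (\<phi>1 t)\<^sup>2 + (\<phi> t)\<^sup>2 * lm c (u c t) (Rm (u c t) (E j t) (u1 c t) (E j t)) (u1 c t))"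
        by (intro sum.cong refl \<kappa>[OF t])
      also have "\<dots> = real (card (Basis - {b0})) * (\<phi>1 t)\<^sup>2 + (\<phi> t)\<^sup>2 * (\<Sum>j\<in>Basis - {b0}. lm c (u c t) (Rm (u c t) (E j t) (u1 c t) (E j t)) (u1 c t))"
        by (simp add: sum.distrib sum_distrib_left)
      also have "(\<Sum>j\<in>Basis - {b0}. lm c (u c t) (Rm (u c t) (E j t) (u1 c t) (E j t)) (u1 c t)) = - Ric (u c t) (u1 c t) (u1 c t)"
        using sum_frame_Rm[OF uU[OF t] E(4)[OF t] b0] unfolding E(2) .
      also have "real (card (Basis - {b0})) = ?n" using b0 by (simp add: card_Diff_singleton of_nat_diff DIM_positive Suc_leI)
      finally have e: "(\<Sum>j\<in>Basis - {b0}. \<kappa> j t) = ?n * (\<phi>1 t)\<^sup>2 + (\<phi> t)\<^sup>2 * - Ric (u c t) (u1 c t) (u1 c t)" .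
      \<comment> \<open>The curvature condition enters here, in the direction of the velocity, where
        the Hessian and differential of \<open>f\<close> are \<open>F2\<close> and
        \<open>F1\<close>.\<close>
      have "ricci_f1 A g f c (u c t) (u1 c t) (u1 c t) \<ge> 0" using CD c uU[OF t] unfolding CD_0_1_def by blast
      then have "- Ric (u c t) (u1 c t) (u1 c t) \<le> F2 t + (F1 t)\<^sup>2 / ?n"
        unfolding ricci_f1_def ricci_eq[OF c] F_derivatives(2,4)[OF c tJ(1)[OF t]] by (simp add: power2_eq_square)
      then show ?thesis unfolding e by (intro add_left_mono mult_left_mono) auto
    qed
    from has_integral_le[OF sint hint this] show ?thesis using I by (simp add: I'_def sum.distrib)
  qed
  have "\<exists>\<delta>>0. \<forall>s. \<bar>s\<bar> < \<delta> \<longrightarrow>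
        reach p (chart_inv c (crv c (u c t2) (\<phi> t2 *\<^sub>R E j t2) s)) (t2 + s\<^sup>2 / 2 * (I' j + \<epsilon>))"
    if j: "j \<in> Basis - {b0}" and \<epsilon>: "\<epsilon> > 0" for j \<epsilon>
  proof -
    \<comment> \<open>The error \<open>\<epsilon>\<close> is shared equally between the given path
      and its prolongation.\<close>
    obtain \<delta>1 where \<delta>1: "\<delta>1 > 0" "\<And>s. \<bar>s\<bar> < \<delta>1 \<Longrightarrow>
        reach p (chart_inv c (crv c (u c t1) (V j t1) s)) (t1 + s\<^sup>2 / 2 * (I j + \<epsilon> / 2))"
      using R[OF j, of "\<epsilon> / 2"] \<epsilon> unfolding V_def E(1) by auto
    have "\<epsilon> / 2 > 0" using \<epsilon> by simp
    from sv(2)[OF j this] obtain \<delta>2 where \<delta>2: "\<delta>2 > 0" "\<And>s. \<bar>s\<bar> < \<delta>2 \<Longrightarrow> (\<exists>w1. (\<forall>t\<in>?I. crv c (u c t) (V j t) s \<in> cdom c) \<and>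
       (\<forall>t\<in>?I. ((\<lambda>t. crv c (u c t) (V j t) s) has_vector_derivative w1 t) (at t within ?I)) \<and>
       continuous_on ?I w1 \<and>
       integral ?I (\<lambda>t. sqrt (lm c (crv c (u c t) (V j t) s) (w1 t) (w1 t)))
         \<le> (t2 - t1) + s\<^sup>2 / 2 * (integral ?I (\<kappa> j) + \<epsilon> / 2))" by blast
    show ?thesis
    proof (intro exI[of _ "min \<delta>1 \<delta>2"] conjI allI impI)
      fix s assume s: "\<bar>s\<bar> < min \<delta>1 \<delta>2"
      have "\<bar>s\<bar> < \<delta>2" using s by simp
      from \<delta>2(2)[OF this] obtain w1 where w1: "\<And>t. t\<in>?I \<Longrightarrow> crv c (u c t) (V j t) s \<in> cdom c"
       "\<And>t. t\<in>?I \<Longrightarrow> ((\<lambda>t. crv c (u c t) (V j t) s) has_vector_derivative w1 t) (at t within ?I)"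
       "continuous_on ?I w1"
       "integral ?I (\<lambda>t. sqrt (lm c (crv c (u c t) (V j t) s) (w1 t) (w1 t)))
         \<le> (t2 - t1) + s\<^sup>2 / 2 * (integral ?I (\<kappa> j) + \<epsilon> / 2)" by blast
      have "reach p (chart_inv c (crv c (u c t1) (V j t1) s)) (t1 + s\<^sup>2 / 2 * (I j + \<epsilon> / 2))" using \<delta>1(2) s by simp
      from reach_extend[where u = "\<lambda>t. crv c (u c t) (V j t) s", OF this c t12 w1]
      have "reach p (chart_inv c (crv c (u c t2) (V j t2) s)) (t1 + s\<^sup>2 / 2 * (I j + \<epsilon> / 2) + ((t2 - t1) + s\<^sup>2 / 2 * (integral ?I (\<kappa> j) + \<epsilon> / 2)))" .
      moreover have "t1 + s\<^sup>2 / 2 * (I j + \<epsilon> / 2) + ((t2 - t1) + s\<^sup>2 / 2 * (integral ?I (\<kappa> j) + \<epsilon> / 2)) = t2 + s\<^sup>2 / 2 * (I' j + \<epsilon>)"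
        by (simp add: I'_def field_simps)
      ultimately show "reach p (chart_inv c (crv c (u c t2) (\<phi> t2 *\<^sub>R E j t2) s)) (t2 + s\<^sup>2 / 2 * (I' j + \<epsilon>))"
        unfolding V_def by (simp only:)
    qed (use \<delta>1 \<delta>2 in auto)
  qed
  moreover have t2: "t2 \<in> ?I" using t12 by simp
  ultimately show ?thesis unfolding Qc_def using E(4)[OF t2] E(2) sumI
    by (intro exI[of _ "\<lambda>j. E j t2"] exI[of _ I']) auto
qed

definition Q :: "real \<Rightarrow> bool" where "Q t \<longleftrightarrow> (\<exists>c\<in>A. t \<in> Jc c \<and> Qc c t)"

text \<open>Near \<open>t0\<close> one chart and one bound \<open>M\<close> for the connection along
  \<open>\<gamma>\<close> serve all short intervals containing \<open>t0\<close>. The form is that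
  of the local hypothesis of \<open>Bolzano\<close>.\<close>

lemma Q_local:
  assumes t0: "t0 \<in> {0..l}"
  shows "\<exists>d>0. \<forall>t1 t2. t1 \<le> t0 \<and> t0 \<le> t2 \<and> t2 - t1 < d \<longrightarrow> 0 \<le> t1 \<longrightarrow> t2 \<le> l \<longrightarrow> Q t1 \<longrightarrow> Q t2"
proof -
  obtain c where c: "c \<in> A" "t0 \<in> Jc c" using ex_chart_Jc t0 sub_J by blast
  interpret metric_patch "cdom c" "lm c" by (rule patch[OF c(1)])
  obtain r where r: "r > 0" "cball t0 r \<subseteq> Jc c" using open_contains_cball open_Jc[OF c(1)] c(2) by blast
  define h where "h = (\<lambda>t. \<Sum>b\<in>Basis. norm (Gam (u c t) (u1 c t) b))"
  have "continuous_on (Jc c) h" unfolding h_def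
    by (intro continuous_intros continuous_on_Gam u_continuous c(1)) (auto intro: u_in)
  then have "bounded (h ` cball t0 r)"
    by (intro compact_imp_bounded compact_continuous_image compact_cball continuous_on_subset[OF _ r(2)])
  then obtain M0 where M0: "\<And>t. t \<in> cball t0 r \<Longrightarrow> \<bar>h t\<bar> \<le> M0" unfolding bounded_iff by (metis image_eqI real_norm_def)
  define M where "M = \<bar>M0\<bar>"
  have M: "norm (Gam (u c t) (u1 c t) x) \<le> M * norm x" if t: "t \<in> cball t0 r" for t x
  proof -
    have "u c t \<in> cdom c" using u_in r(2) t by blast
    then have "norm (Gam (u c t) (u1 c t) x) = norm (\<Sum>b\<in>Basis. (x \<bullet> b) *\<^sub>R Gam (u c t) (u1 c t) b)"
      using linear_basis_expansion[OF Gam_linear(2)] by metis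
    also have "\<dots> \<le> (\<Sum>b\<in>Basis. norm ((x \<bullet> b) *\<^sub>R Gam (u c t) (u1 c t) b))" by (rule norm_sum)
    also have "\<dots> \<le> (\<Sum>b\<in>Basis. norm x * norm (Gam (u c t) (u1 c t) b))"
      by (intro sum_mono) (simp add: Basis_le_norm mult_right_mono)
    also have "\<dots> = norm x * h t" by (simp add: h_def sum_distrib_left)
    also have "\<dots> \<le> norm x * M" using M0[OF t] by (intro mult_left_mono) (auto simp: M_def)
    finally show ?thesis by (simp add: mult.commute)
  qed
  \<comment> \<open>Short enough to stay in the chart and to satisfy
    \<open>(t2 - t1) * M \<le> 1 / 2\<close>, the condition for the frame to be transported;
    \<open>+ 1\<close> covers \<open>M = 0\<close>.\<close>
  define d where "d = min r (1 / (2 * (M + 1)))"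
  have M1: "M \<ge> 0" by (simp add: M_def)
  show ?thesis
  proof (intro exI[of _ d] conjI allI impI)
    show "d > 0" using r(1) M1 by (simp add: d_def)
    fix t1 t2 assume t: "t1 \<le> t0 \<and> t0 \<le> t2 \<and> t2 - t1 < d" "0 \<le> t1" "t2 \<le> l" "Q t1"
    show "Q t2"
    proof (cases "t1 = t2")
      case False
      then have t12: "t1 < t2" using t by simp
      have sub: "{t1..t2} \<subseteq> cball t0 r" using t by (auto simp: d_def dist_real_def)
      obtain e where e: "e \<in> A" "t1 \<in> Jc e" "Qc e t1" using t(4) unfolding Q_def by blast
      have t12c: "t1 \<in> Jc c" "t2 \<in> Jc c" using subset_trans[OF sub r(2)] t12 by (auto simp: subset_iff)
      have "Qc c t1" by (rule Qc_change[OF e(1,2) c(1) t12c(1) e(3)])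
      moreover have "(t2 - t1) * M \<le> 1 / 2"
      proof -
        have "(t2 - t1) * M \<le> 1 / (2 * (M + 1)) * M"
          using t(1) M1 by (intro mult_right_mono) (auto simp: d_def)
        also have "\<dots> \<le> 1 / 2" using M1 by (simp add: field_simps)
        finally show ?thesis .
      qed
      ultimately have "Qc c t2"
        using sub r(2) t(2,3) M M1 by (intro Qc_step[OF c(1) t12, of M]) auto
      then show ?thesis using c(1) t12c(2) unfolding Q_def by blast
    qed (use t in simp)
  qed
qed

text \<open>Bisection: implications from \<open>Q a\<close> to \<open>Q b\<close> compose over
  adjacent intervals and hold on short intervals around every point, hence on all of
  \<open>{0..l}\<close>. The bounds on \<open>a\<close> and \<open>b\<close> confine the intervals
  to the domain.\<close>

lemma Qc_end: assumes c: "c \<in> A" "l \<in> Jc c" shows "Qc c l"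
proof -
  have "0 \<le> (0::real) \<longrightarrow> l \<le> l \<longrightarrow> Q 0 \<longrightarrow> Q l"
  proof (rule Bolzano[where P = "\<lambda>a b. 0 \<le> a \<longrightarrow> b \<le> l \<longrightarrow> Q a \<longrightarrow> Q b", OF l0])
    fix a b c :: real
    assume *: "0 \<le> a \<longrightarrow> b \<le> l \<longrightarrow> Q a \<longrightarrow> Q b" "0 \<le> b \<longrightarrow> c \<le> l \<longrightarrow> Q b \<longrightarrow> Q c" "a \<le> b" "b \<le> c"
    show "0 \<le> a \<longrightarrow> c \<le> l \<longrightarrow> Q a \<longrightarrow> Q c"
    proof (intro impI)
      assume "0 \<le> a" "c \<le> l" "Q a"
      moreover have "b \<le> l" "0 \<le> b" using * calculation by linarith+
      ultimately show "Q c" using * by blast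
    qed
  next
    fix x assume "0 \<le> x" "x \<le> l"
    then show "\<exists>d>0. \<forall>a b. a \<le> x \<and> x \<le> b \<and> b - a < d \<longrightarrow> 0 \<le> a \<longrightarrow> b \<le> l \<longrightarrow> Q a \<longrightarrow> Q b"
      by (intro Q_local) simp
  qed
  moreover have "Q 0" using ex_chart_Jc[of 0] \<alpha> \<beta> l0 Qc_start unfolding Q_def by auto
  ultimately obtain d where "d \<in> A" "l \<in> Jc d" "Qc d l" unfolding Q_def by auto
  then show ?thesis using Qc_change c by blast
qed

end

section \<open>The Laplacian of the distance function\<close>

text \<open>Parabolas above \<open>\<psi>\<close> that agree with it at 0 are compared with its own
  expansion: \<open>s\<close> times the difference of the slopes is bounded by a multiple of
  \<open>s\<^sup>2\<close> for both signs of \<open>s\<close>. This forces equal slopes, and then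
  the quadratic coefficients compare.\<close>

lemma second_order_barrier:
  fixes \<psi> \<psi>' :: "real \<Rightarrow> real"
  assumes "r > 0" and \<psi>: "\<And>s. \<bar>s\<bar> < r \<Longrightarrow> (\<psi> has_real_derivative \<psi>' s) (at s)"
    and \<psi>': "(\<psi>' has_real_derivative b) (at 0)"
    and le: "\<And>\<epsilon>. \<epsilon> > 0 \<Longrightarrow> \<exists>\<delta>>0. \<forall>s. \<bar>s\<bar> < \<delta> \<longrightarrow> \<psi> s \<le> \<psi> 0 + s * a + s\<^sup>2 / 2 * (I + \<epsilon>)"
  shows "\<psi>' 0 = a" "b \<le> I"
proof -
  have *: "\<exists>\<delta>>0. \<forall>s. \<bar>s\<bar> < \<delta> \<longrightarrow> s * (\<psi>' 0 - a) \<le> s\<^sup>2 / 2 * (I - b + \<epsilon>)" if "\<epsilon> > 0" for \<epsilon>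
  proof -
    \<comment> \<open>The Peano error multiplies \<open>s\<^sup>2\<close> and the barrier error
      \<open>s\<^sup>2 / 2\<close>, so the two thirds and the one third add up to
      \<open>\<epsilon>\<close>.\<close>
    have e: "\<epsilon> / 3 > 0" using that by simp
    obtain d1 where d1: "d1 > 0" "\<And>s. \<bar>s\<bar> < d1 \<Longrightarrow> \<psi> s \<le> \<psi> 0 + s * a + s\<^sup>2 / 2 * (I + \<epsilon> / 3)"
      using le[OF e] by blast
    obtain d2 where d2: "d2 > 0" "\<And>s. \<bar>s\<bar> < d2 \<Longrightarrow> norm (\<psi> s - \<psi> 0 - s *\<^sub>R \<psi>' 0 - (s\<^sup>2 / 2) *\<^sub>R b) \<le> \<epsilon> / 3 * s\<^sup>2"
      using Peano_second_order[OF \<open>r > 0\<close> \<psi>[unfolded has_real_derivative_iff_has_vector_derivative]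
          \<psi>'[unfolded has_real_derivative_iff_has_vector_derivative] e] by blast
    have "s * (\<psi>' 0 - a) \<le> s\<^sup>2 / 2 * (I - b + \<epsilon>)" if s: "\<bar>s\<bar> < min d1 d2" for s
    proof -
      have "\<bar>s\<bar> < d2" using s by simp
      from d2(2)[OF this] have "\<psi> s - \<psi> 0 - s * \<psi>' 0 - s\<^sup>2 / 2 * b \<ge> - (\<epsilon> / 3 * s\<^sup>2)"
        unfolding real_norm_def real_scaleR_def by linarith
      with d1(2)[of s] s show ?thesis by (simp add: field_simps)
    qed
    then show ?thesis using d1(1) d2(1) by (intro exI[of _ "min d1 d2"]) auto
  qed
  define k where "k = \<psi>' 0 - a"
  show 1: "\<psi>' 0 = a"
  proof (rule ccontr)
    assume "\<psi>' 0 \<noteq> a"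
    then have k: "\<bar>k\<bar> > 0" by (simp add: k_def)
    obtain d where d: "d > 0" "\<And>s. \<bar>s\<bar> < d \<Longrightarrow> s * k \<le> s\<^sup>2 / 2 * (I - b + 1)"
      using *[of 1] unfolding k_def by auto
    define C where "C = \<bar>I - b + 1\<bar> + 1"
    \<comment> \<open>So small that the quadratic bound is at most \<open>s * |k| / 2\<close>; the
      sign of \<open>k\<close> decides whether \<open>s\<close> or \<open>- s\<close> is
      inserted.\<close>
    define s where "s = min (d / 2) (\<bar>k\<bar> / C)"
    have C: "C > 0" by (simp add: C_def)
    have s: "0 < s" "s < d" "s * C \<le> \<bar>k\<bar>" using d(1) k C by (auto simp: s_def min_def field_simps)
    have "s * \<bar>k\<bar> \<le> s\<^sup>2 / 2 * (I - b + 1)"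
      using d(2)[of s] d(2)[of "- s"] s by (cases "k \<ge> 0") auto
    also have "\<dots> \<le> s\<^sup>2 / 2 * C" by (intro mult_left_mono) (auto simp: C_def)
    also have "\<dots> = s * (s * C) / 2" by (simp add: power2_eq_square)
    also have "\<dots> \<le> s * \<bar>k\<bar> / 2" using s by (intro divide_right_mono mult_left_mono) auto
    finally show False using s(1) k by simp
  qed
  have "b \<le> I + \<epsilon>" if \<epsilon>: "\<epsilon> > 0" for \<epsilon>
  proof -
    obtain d where d: "d > 0" "\<And>s. \<bar>s\<bar> < d \<Longrightarrow> s * (\<psi>' 0 - a) \<le> s\<^sup>2 / 2 * (I - b + \<epsilon>)"
      using *[OF \<epsilon>] by blast
    have "0 \<le> (d/2)\<^sup>2 / 2 * (I - b + \<epsilon>)" using d(2)[of "d / 2"] d(1) 1 by simp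
    then show ?thesis using d(1) by (simp add: zero_le_mult_iff)
  qed
  then show "b \<le> I" by (rule field_le_epsilon)
qed

context geodesic_segment begin

text \<open>The geodesic itself is a path to \<open>\<gamma> t\<close>, also for \<open>t\<close>
  slightly beyond \<open>l\<close>: near \<open>l\<close> its speed is constant, hence still 1. This
  gives a barrier on both sides of \<open>l\<close>.\<close>

lemma reach_along:
  assumes c: "c \<in> A" "l \<in> Jc c"
  shows "\<exists>\<delta>>0. \<forall>t. \<bar>t - l\<bar> < \<delta> \<longrightarrow> 0 < t \<longrightarrow> reach p (\<gamma> t) t"
proof -
  interpret metric_patch "cdom c" "lm c" by (rule patch[OF c(1)])
  obtain \<delta> where \<delta>: "\<delta> > 0" "ball l \<delta> \<subseteq> Jc c" using open_contains_ball open_Jc[OF c(1)] c(2) by blast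
  have lb: "l \<in> ball l \<delta>" using \<delta> by simp
  have "((\<lambda>s. lm c (u c s) (u1 c s) (u1 c s)) has_vector_derivative 0) (at t within ball l \<delta>)" if "t \<in> ball l \<delta>" for t
  proof -
    have t: "t \<in> Jc c" using \<delta> that by blast
    show ?thesis
      using G_has_vector_derivative[where x = "u c" and v = "u1 c" and w = "u1 c", OF _ u_in[OF t] that, OF has_vector_derivative_at_within[OF u_derivatives(1)[OF c(1) t]]
        has_vector_derivative_at_within[OF u_derivatives(2)[OF c(1) t]] has_vector_derivative_at_within[OF u_derivatives(2)[OF c(1) t]]]
      by (simp add: G_simps[OF u_in[OF t]])
  qed
  then have "\<exists>k. \<forall>t\<in>ball l \<delta>. lm c (u c t) (u1 c t) (u1 c t) = k"
    using has_derivative_zero_constant[OF convex_ball, of l \<delta> "\<lambda>s. lm c (u c s) (u1 c s) (u1 c s)"]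
    by (fastforce simp: has_vector_derivative_def)
  then obtain k where k: "\<And>t. t \<in> ball l \<delta> \<Longrightarrow> lm c (u c t) (u1 c t) (u1 c t) = k" by blast
  have "k = 1" using k[OF lb] unit_u[OF c] l0 by simp
  then have sp1: "speed A g \<gamma> t = 1" if "t \<in> ball l \<delta>" for t
    using speed_u[OF c(1), of t] k[OF that] \<delta>(2) that by auto
  show ?thesis
  proof (intro exI[of _ \<delta>] conjI allI impI \<delta>(1))
    fix t assume t: "\<bar>t - l\<bar> < \<delta>" "0 < t"
    have tb: "t \<in> ball l \<delta>" using t by (simp add: dist_real_def abs_minus_commute)
    then have tJ: "t \<in> J" using \<delta>(2) by (auto simp: Jc_def)
    have sub: "{0..t} \<subseteq> J" using \<alpha> tJ by auto
    have C: "C1_curve A \<gamma> 0 t" unfolding C1_curve_def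
    proof (intro conjI ballI)
      show "continuous_on {0..t} \<gamma>" using \<gamma>_cont sub by (intro continuous_at_imp_continuous_on) auto
      fix d assume d: "d \<in> A"
      show "\<exists>D. continuous_on {s \<in> {0..t}. \<gamma> s \<in> fst d} D \<and>
        (\<forall>s\<in>{0..t}. \<gamma> s \<in> fst d \<longrightarrow> (snd d \<circ> \<gamma> has_vector_derivative D s) (at s within {0..t}))"
      proof (intro exI[of _ "u1 d"] conjI ballI impI)
        have "{s \<in> {0..t}. \<gamma> s \<in> fst d} \<subseteq> Jc d" using sub by (auto simp: Jc_def)
        then show "continuous_on {s \<in> {0..t}. \<gamma> s \<in> fst d} (u1 d)"
          by (rule continuous_on_subset[OF u_continuous(2)[OF d]])
        fix s assume "s \<in> {0..t}" "\<gamma> s \<in> fst d"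
        then have "s \<in> Jc d" using sub by (auto simp: Jc_def)
        from u_derivatives(1)[OF d this]
        show "(snd d \<circ> \<gamma> has_vector_derivative u1 d s) (at s within {0..t})"
          by (simp add: o_def has_vector_derivative_at_within)
      qed
    qed
    have "piecewise_C1_curve A \<gamma> 0 t" unfolding piecewise_C1_curve_def
      by (rule exI[of _ "\<lambda>i. real i * t"], rule exI[of _ 1]) (use C t in auto)
    moreover have "speed A g \<gamma> s = 1" if "s \<in> {0..t}" for s
    proof (cases "s \<le> l")
      case False
      then have "s \<in> ball l \<delta>" using that t by (auto simp: dist_real_def)
      then show ?thesis by (rule sp1)
    qed (use unit that in auto)
    then have "curve_length A g \<gamma> 0 t = t" unfolding curve_length_def
      using integral_cong[of "{0..t}" "speed A g \<gamma>" "\<lambda>_. 1"] t(2) by simp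
    ultimately show "reach p (\<gamma> t) t" unfolding reach_def using t(2) start by (intro exI[of _ \<gamma>] exI[of _ t]) auto
  qed
qed

end

context index_form_bound begin

text \<open>The lengths of the constructed paths are barriers for \<open>r\<close> at
  \<open>\<gamma> l\<close>. Their second-order coefficients bound the Hessian of \<open>r\<close>
  in each frame direction, and their slopes determine its gradient.\<close>

lemma weighted_laplacian_bound:
  assumes l: "0 < l" and c: "c \<in> A" "l \<in> Jc c"
    and r: "\<And>x L. reach p x L \<Longrightarrow> r x \<le> L" "r (\<gamma> l) = l" "smooth_at A r (\<gamma> l)"
    and \<phi>l: "\<phi> l = 1"
  shows "weighted_laplacian A g f c r (u c l) \<le> H l - F1 l"
proof -
  interpret metric_patch "cdom c" "lm c" by (rule patch[OF c(1)])
  let ?x = "u c l"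
  have x: "?x \<in> cdom c" by (rule u_in[OF c(2)])
  obtain E I where E: "orthonormal_frame ?x E" "E b0 = u1 c l" and I: "(\<Sum>j\<in>Basis - {b0}. I j) \<le> H l"
    and R: "\<And>j \<epsilon>. j\<in>Basis - {b0} \<Longrightarrow> \<epsilon> > 0 \<Longrightarrow> \<exists>\<delta>>0. \<forall>s. \<bar>s\<bar> < \<delta> \<longrightarrow>
        reach p (chart_inv c (crv c ?x (E j) s)) (l + s\<^sup>2 / 2 * (I j + \<epsilon>))"
    using Qc_end[OF c] unfolding Qc_def \<phi>l scaleR_one by blast
  obtain W where W: "open W" "\<gamma> l \<in> W" "smooth_fun_on A W r" using r(3) by (auto simp: smooth_at_def)
  define h where "h = r \<circ> chart_inv c"
  define W' where "W' = snd c ` (fst c \<inter> W)"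
  have oW': "open W'" unfolding W'_def by (rule open_chart_image[OF c(1) W(1)])
  have xW': "?x \<in> W'" using W(2) c(2) by (auto simp: W'_def Jc_def)
  have sm: "smooth_on W' h" using W(3) c(1) by (simp add: smooth_fun_on_def h_def W'_def)
  have hx: "h ?x = l" using r(2) c by (simp add: h_def Jc_def chart_inverse)
  have dlin: "linear (dir_deriv h y)" if "y \<in> W'" for y by (rule linear_dir_deriv[OF smooth_onD(2)[OF sm that]])
  have ddiff: "(\<lambda>y. dir_deriv h y w) differentiable (at y)" if "y \<in> W'" for y w
    by (rule smooth_onD(2)[OF smooth_onD(3)[OF sm] that])
  have diff_eq: "differential c r = dir_deriv h" by (intro ext) (simp add: differential_def h_def)
  have hess: "hessian A g c r ?x v w = dir_deriv (\<lambda>y. dir_deriv h y w) ?x v - dir_deriv h ?x (Gam ?x v w)" for v w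
    by (simp only: hessian_def diff_eq christoffel_eq[OF c(1)])
  let ?hs = "hessian A g c r ?x"
  have hl1: "linear (\<lambda>v. ?hs v w)" for w unfolding hess
    by (intro linear_compose_sub linear_dir_deriv ddiff xW' linear_compose[OF Gam_linear(1)[OF x] dlin[OF xW'], unfolded o_def])
  have hl2: "linear (?hs v)" for v unfolding hess[abs_def]
    by (intro linear_compose_sub linear_dir_deriv_family[OF oW' xW' dlin ddiff[OF xW']] linear_compose[OF Gam_linear(2)[OF x] dlin[OF xW'], unfolded o_def])
  \<comment> \<open>The derivative of second order along \<open>crv\<close> is the Hessian, as the
    covariant acceleration is zero. The barrier has no linear term, which makes \<open>r\<close>
    stationary in normal directions.\<close>
  have trans: "dir_deriv h ?x (E j) = 0 \<and> ?hs (E j) (E j) \<le> I j" if j: "j \<in> Basis - {b0}" for j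
  proof -
    note q = smooth_composition_quadratic[OF oW' xW' sm, of "E j" "Gam ?x (E j) (E j)"]
    obtain \<rho> where \<rho>: "\<rho> > 0" "\<And>s. \<bar>s\<bar> < \<rho> \<Longrightarrow> ((\<lambda>s. h (crv c ?x (E j) s)) has_vector_derivative
        dir_deriv h (crv c ?x (E j) s) (E j - s *\<^sub>R Gam ?x (E j) (E j))) (at s)"
      using q(1) unfolding crv_def by blast
    let ?\<psi> = "\<lambda>s. h (crv c ?x (E j) s)"
      and ?\<psi>' = "\<lambda>s. dir_deriv h (crv c ?x (E j) s) (E j - s *\<^sub>R Gam ?x (E j) (E j))"
    have d1: "(?\<psi> has_real_derivative ?\<psi>' s) (at s)" if "\<bar>s\<bar> < \<rho>" for s
      using \<rho>(2)[OF that] unfolding has_real_derivative_iff_has_vector_derivative .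
    have d2: "(?\<psi>' has_real_derivative ?hs (E j) (E j)) (at 0)"
      using q(3) unfolding has_real_derivative_iff_has_vector_derivative crv_def hess .
    have le: "\<exists>\<delta>>0. \<forall>s. \<bar>s\<bar> < \<delta> \<longrightarrow> ?\<psi> s \<le> ?\<psi> 0 + s * 0 + s\<^sup>2 / 2 * (I j + \<epsilon>)" if \<epsilon>: "\<epsilon> > 0" for \<epsilon>
    proof -
      have "?\<psi> 0 = l" by (simp add: crv_def hx)
      then show ?thesis using R[OF j \<epsilon>] r(1) unfolding h_def o_apply by (metis add.right_neutral mult_zero_right)
    qed
    from second_order_barrier[OF \<rho>(1) d1 d2 le] show ?thesis by (simp add: crv_def)
  qed
  \<comment> \<open>Along the geodesic the barrier is \<open>l + s\<close>, with slope 1 and no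
    quadratic term.\<close>
  have radial: "dir_deriv h ?x (u1 c l) = 1" "?hs (u1 c l) (u1 c l) \<le> 0"
  proof -
    obtain \<delta> where \<delta>: "\<delta> > 0" "\<And>t. \<bar>t - l\<bar> < \<delta> \<Longrightarrow> 0 < t \<Longrightarrow> reach p (\<gamma> t) t" using reach_along[OF c] by blast
    have "open (Jc c \<inter> u c -` W')"
      by (rule continuous_open_preimage[OF u_continuous(1)[OF c(1)] open_Jc[OF c(1)] oW'])
    moreover have "l \<in> Jc c \<inter> u c -` W'" using c xW' by simp
    ultimately obtain \<rho> where \<rho>: "\<rho> > 0" "ball l \<rho> \<subseteq> Jc c \<inter> u c -` W'" using open_contains_ball by blast
    have in\<rho>: "s + l \<in> Jc c" "u c (s + l) \<in> W'" if "\<bar>s\<bar> < \<rho>" for s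
      using \<rho>(2) that by (auto simp: subset_iff dist_real_def)
    let ?\<psi> = "\<lambda>s. h (u c (s + l))" and ?\<psi>' = "\<lambda>s. dir_deriv h (u c (s + l)) (u1 c (s + l))"
    have sh: "((\<lambda>s. k (s + l)) has_vector_derivative k') (at s)" if "(k has_vector_derivative k') (at (s + l))" for k :: "real \<Rightarrow> 'b::real_normed_vector" and k' s
    proof -
      have "(k \<circ> (\<lambda>s. s + l) has_vector_derivative 1 *\<^sub>R k') (at s)"
        by (rule vector_diff_chain_at) (use that in \<open>auto intro!: derivative_eq_intros simp: has_real_derivative_iff_has_vector_derivative[symmetric]\<close>)
      then show ?thesis by (simp add: o_def)
    qed
    have d1: "(?\<psi> has_real_derivative ?\<psi>' s) (at s)" if "\<bar>s\<bar> < \<rho>" for s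
      unfolding has_real_derivative_iff_has_vector_derivative
      by (rule sh[of "\<lambda>t. h (u c t)"], rule has_vector_derivative_chain_dir_deriv[OF smooth_onD(2)[OF sm in\<rho>(2)[OF that]] u_derivatives(1)[OF c(1) in\<rho>(1)[OF that]]])
    have "((\<lambda>t. dir_deriv h (u c t) (u1 c t)) has_vector_derivative
        dir_deriv (\<lambda>y. dir_deriv h y (u1 c l)) ?x (u1 c l) + dir_deriv h ?x (- Gam ?x (u1 c l) (u1 c l))) (at l)"
      by (rule has_vector_derivative_linear_family[OF oW' dlin ddiff u_derivatives(1)[OF c] xW' UNIV_I u_derivatives(2)[OF c]])
         (auto simp: xW')
    then have "((\<lambda>t. dir_deriv h (u c t) (u1 c t)) has_vector_derivative ?hs (u1 c l) (u1 c l)) (at (0 + l))"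
      by (simp add: hess linear_neg[OF dlin[OF xW']])
    from sh[OF this] have d2: "(?\<psi>' has_real_derivative ?hs (u1 c l) (u1 c l)) (at 0)"
      unfolding has_real_derivative_iff_has_vector_derivative .
    have le: "\<exists>\<delta>>0. \<forall>s. \<bar>s\<bar> < \<delta> \<longrightarrow> ?\<psi> s \<le> ?\<psi> 0 + s * 1 + s\<^sup>2 / 2 * (0 + \<epsilon>)" if \<epsilon>: "\<epsilon> > 0" for \<epsilon>
    proof (intro exI[of _ "min (min \<delta> l) \<rho>"] conjI allI impI)
      fix s assume s: "\<bar>s\<bar> < min (min \<delta> l) \<rho>"
      have "s + l \<in> Jc c" using in\<rho>(1) s by simp
      then have "?\<psi> s = r (\<gamma> (s + l))" by (simp add: h_def Jc_def chart_inverse[OF c(1)])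
      also have "\<dots> \<le> s + l" using \<delta>(2)[of "s + l"] s by (intro r(1)) auto
      finally have 1: "?\<psi> s \<le> s + l" .
      moreover have "s\<^sup>2 / 2 * (0 + \<epsilon>) \<ge> 0" using \<epsilon> by simp
      moreover have "?\<psi> 0 = l" by (simp add: hx)
      ultimately show "?\<psi> s \<le> ?\<psi> 0 + s * 1 + s\<^sup>2 / 2 * (0 + \<epsilon>)" by linarith
    qed (use \<delta> \<rho> l in auto)
    from second_order_barrier[OF \<rho>(1) d1 d2 le]
    show "dir_deriv h ?x (u1 c l) = 1" "?hs (u1 c l) (u1 c l) \<le> 0" by auto
  qed
  have T: "laplacian A g c r ?x = (\<Sum>j\<in>Basis. ?hs (E j) (E j))"
  proof -
    have "laplacian A g c r ?x = (\<Sum>b\<in>Basis. shp ?x (?hs b) \<bullet> b)" by (simp add: laplacian_def sharp_eq[OF c(1)])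
    also have "\<dots> = (\<Sum>j\<in>Basis. lm c ?x (shp ?x (?hs (E j))) (E j))"
    proof (rule trace_frame[OF x E(1)], rule linearI)
      have "?hs (v + w) = (\<lambda>z. ?hs v z + ?hs w z)" for v w using linear_add[OF hl1] by (intro ext)
      then show "shp ?x (?hs (v + w)) = shp ?x (?hs v) + shp ?x (?hs w)" for v w
        using shp_linear_combination(1)[OF x hl2 hl2] by simp
      have "?hs (a *\<^sub>R v) = (\<lambda>z. a * ?hs v z)" for a v using linear_cmul[OF hl1] by (intro ext) simp
      then show "shp ?x (?hs (a *\<^sub>R v)) = a *\<^sub>R shp ?x (?hs v)" for a v
        using shp_linear_combination(2)[OF x hl2 hl2] by simp
    qed
    also have "\<dots> = (\<Sum>j\<in>Basis. ?hs (E j) (E j))" by (simp add: G_shp[OF x hl2])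
    finally show ?thesis .
  qed
  have "(\<Sum>j\<in>Basis. ?hs (E j) (E j)) = ?hs (E b0) (E b0) + (\<Sum>j\<in>Basis - {b0}. ?hs (E j) (E j))"
    using b0 by (intro sum.remove) auto
  also have "\<dots> \<le> 0 + (\<Sum>j\<in>Basis - {b0}. I j)"
    using trans radial(2) unfolding E(2) by (intro add_mono sum_mono) auto
  finally have lap: "laplacian A g c r ?x \<le> H l" using I T by simp
  \<comment> \<open>In the frame only the radial derivative of \<open>r\<close> is nonzero, and it
    is 1.\<close>
  have "gradient A g c r ?x = u1 c l"
    unfolding gradient_def sharp_eq[OF c(1)] diff_eq
  proof (rule shp_eqI[OF x])
    fix w
    have "dir_deriv h ?x w = (\<Sum>j\<in>Basis. lm c ?x w (E j) * dir_deriv h ?x (E j))"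
      by (subst frame_expansion[OF x E(1), of w]) (simp add: linear_sum[OF dlin[OF xW']] linear_cmul[OF dlin[OF xW']])
    also have "\<dots> = lm c ?x w (E b0) * dir_deriv h ?x (E b0) + (\<Sum>j\<in>Basis - {b0}. lm c ?x w (E j) * dir_deriv h ?x (E j))"
      using b0 by (intro sum.remove) auto
    also have "\<dots> = lm c ?x w (u1 c l)" using trans radial(1) by (simp add: E(2))
    finally show "lm c ?x (u1 c l) w = dir_deriv h ?x w" using G_sym[OF x] by metis
  qed
  \<comment> \<open>The drift term of the weighted Laplacian is thus the derivative of
    \<open>f\<close> along the geodesic.\<close>
  moreover have "lm c ?x (gradient A g c f ?x) (u1 c l) = F1 l"
  proof -
    have "linear (differential c f ?x)" unfolding differential_def[abs_def]
      by (rule linear_dir_deriv[OF smooth_onD(2)[OF f_chart[OF c(1)] x]])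
    then show ?thesis unfolding gradient_def sharp_eq[OF c(1)] F_derivatives(2)[OF c] by (rule G_shp[OF x])
  qed
  ultimately show ?thesis unfolding weighted_laplacian_def using lap by simp
qed

end

section \<open>Failure of smoothness of the distance at its base point\<close>

lemma DERIV_pos_part_square: "((\<lambda>t::real. (max 0 t)\<^sup>2) has_real_derivative 2 * max 0 t) (at t)"
proof (cases t "0::real" rule: linorder_cases)
  case less
  have "((\<lambda>t::real. 0) has_real_derivative 2 * max 0 t) (at t)" using less by simp
  then show ?thesis
    by (rule has_field_derivative_transform_within_open[of _ _ _ "{..<0}"]) (use less in auto)
next
  case greater
  have "((\<lambda>t::real. t\<^sup>2) has_real_derivative 2 * max 0 t) (at t)" using greater by (auto intro!: derivative_eq_intros)
  then show ?thesis
    by (rule has_field_derivative_transform_within_open[of _ _ _ "{0<..}"]) (use greater in auto)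
next
  case equal
  have "((\<lambda>y. ((max 0 y)\<^sup>2 - 0) / (y - 0)) \<longlongrightarrow> 0) (at (0::real))"
  proof (rule Lim_null_comparison)
    show "\<forall>\<^sub>F y in at (0::real). norm (((max 0 y)\<^sup>2 - 0) / (y - 0)) \<le> \<bar>y\<bar>"
      by (intro always_eventually allI) (auto simp: max_def power2_eq_square)
    show "((\<lambda>y. \<bar>y\<bar>) \<longlongrightarrow> 0) (at (0::real))" by (rule tendsto_rabs_zero[OF tendsto_ident_at])
  qed
  then show ?thesis using equal by (simp add: has_field_derivative_iff)
qed

context riemannian_atlas begin

text \<open>A \<open>C\<^sup>1\<close> bump function \<open>h\<close> supported in a coordinate ball is Lipschitz for the distance. If the
  ball is centred off \<open>p\<close>, then \<open>h\<close> has nonzero differential at \<open>p\<close>, whereas a distance function that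
  is differentiable at its minimum \<open>p\<close> would have zero differential.\<close>

lemma riem_dist_not_smooth:
  assumes p0: "riem_dist A g p p = 0" shows "\<not> smooth_at A (riem_dist A g p) p"
proof
  assume sp: "smooth_at A (riem_dist A g p) p"
  obtain c where c: "c \<in> A" "p \<in> fst c" using ex_chart by blast
  interpret metric_patch "cdom c" "lm c" by (rule patch[OF c(1)])
  let ?x = "snd c p"
  have x: "?x \<in> cdom c" using c by auto
  obtain \<rho>0 where \<rho>0: "\<rho>0 > 0" "cball ?x \<rho>0 \<subseteq> cdom c" using open_contains_cball open_U x by blast
  \<comment> \<open>A third of the radius: the ball of radius \<open>2 * norm w\<close> about
    \<open>?x - w\<close> contains \<open>?x\<close> off its centre and still lies in
    \<open>cball ?x \<rho>0\<close>.\<close>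
  obtain w :: 'e where w: "norm w = \<rho>0 / 3" using vector_choose_size[of "\<rho>0 / 3"] \<rho>0(1) by auto
  define y0 where "y0 = ?x - w"
  define \<rho> where "\<rho> = 2 * norm w"
  have \<rho>: "\<rho> > 0" unfolding \<rho>_def w using \<rho>0 by simp
  have ball_sub: "cball y0 \<rho> \<subseteq> cdom c"
  proof -
    have "cball y0 \<rho> \<subseteq> cball ?x \<rho>0"
    proof
      fix y assume "y \<in> cball y0 \<rho>"
      then have "dist ?x y \<le> dist ?x y0 + \<rho>" using dist_triangle[of ?x y y0] by simp
      also have "dist ?x y0 = norm w" by (simp add: y0_def dist_norm)
      finally show "y \<in> cball ?x \<rho>0" by (simp add: \<rho>_def w)
    qed
    then show ?thesis using \<rho>0(2) by blast
  qed
  obtain m where m: "m > 0" "\<And>y v. y \<in> cball y0 \<rho> \<Longrightarrow> lm c y v v \<ge> m * (norm v)\<^sup>2"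
    using G_lower_bound[OF compact_cball ball_sub] by blast
  define \<theta> where "\<theta> = (\<lambda>y. \<rho>\<^sup>2 - (y - y0) \<bullet> (y - y0))"
  \<comment> \<open>The square makes the positive part differentiable across the boundary sphere,
    with zero differential there and outside.\<close>
  define \<beta> where "\<beta> = (\<lambda>y. (max 0 (\<theta> y))\<^sup>2)"
  define D\<beta> where "D\<beta> = (\<lambda>y v. 2 * max 0 (\<theta> y) * (- 2 * ((y - y0) \<bullet> v)))"
  have d\<beta>: "(\<beta> has_derivative D\<beta> y) (at y)" for y
  proof -
    have "(\<theta> has_derivative (\<lambda>v. - 2 * ((y - y0) \<bullet> v))) (at y)" unfolding \<theta>_def
      by (auto intro!: derivative_eq_intros simp: inner_commute)
    from has_derivative_compose[OF this DERIV_pos_part_square[unfolded has_field_derivative_def]]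
    show ?thesis unfolding \<beta>_def D\<beta>_def .
  qed
  have outside: "max 0 (\<theta> y) = 0" if "y \<notin> cball y0 \<rho>" for y
  proof -
    have "\<rho> \<le> norm (y - y0)" using that by (simp add: dist_norm norm_minus_commute)
    then have "\<rho>\<^sup>2 \<le> (norm (y - y0))\<^sup>2" using \<rho> by (intro power_mono) auto
    then show ?thesis by (simp add: \<theta>_def power2_norm_eq_inner)
  qed
  \<comment> \<open>In the ball \<open>\<theta> y\<close> is at most \<open>\<rho>\<^sup>2\<close>
    and \<open>norm (y - y0)\<close> at most \<open>\<rho>\<close>; dividing by
    \<open>sqrt m\<close> replaces the Euclidean norm by the metric one.\<close>
  define K where "K = 4 * \<rho>\<^sup>2 * \<rho> / sqrt m"
  have K: "K > 0" using \<rho> m(1) by (simp add: K_def)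
  have bd: "\<bar>D\<beta> y v\<bar> \<le> K * sqrt (lm c y v v)" if y: "y \<in> cdom c" for y v
  proof (cases "y \<in> cball y0 \<rho>")
    case True
    have "\<bar>D\<beta> y v\<bar> = 4 * max 0 (\<theta> y) * \<bar>(y - y0) \<bullet> v\<bar>" by (simp add: D\<beta>_def abs_mult)
    also have "\<dots> \<le> 4 * \<rho>\<^sup>2 * (norm (y - y0) * norm v)"
      using Cauchy_Schwarz_ineq2[of "y - y0" v] by (intro mult_mono) (auto simp: \<theta>_def)
    also have "\<dots> \<le> 4 * \<rho>\<^sup>2 * (\<rho> * norm v)"
      using True by (intro mult_left_mono mult_right_mono) (auto simp: dist_norm norm_minus_commute)
    also have "\<dots> = K * (sqrt m * norm v)" using m(1) by (simp add: K_def)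
    also have "sqrt m * norm v = sqrt (m * (norm v)\<^sup>2)" by (simp add: real_sqrt_mult)
    also have "K * sqrt (m * (norm v)\<^sup>2) \<le> K * sqrt (lm c y v v)"
      using m(2)[OF True] K by (intro mult_left_mono real_sqrt_le_mono) auto
    finally show ?thesis .
  qed (use outside G_nonneg[OF y] K in \<open>simp add: D\<beta>_def\<close>)
  define h where "h = (\<lambda>\<mu>. if \<mu> \<in> fst c then \<beta> (snd c \<mu>) else 0)"
  have lip: "lipschitz_fun h K" unfolding lipschitz_fun_def
  proof (intro ballI)
    fix d z assume d: "d \<in> A" and z: "z \<in> cdom d"
    interpret Ch: chart_change "cdom d" "lm d" "cdom c" "lm c" "tr d c" "trdom d c" by (rule change[OF d c(1)])
    show "\<exists>D. (h \<circ> chart_inv d has_derivative D) (at z) \<and> (\<forall>v. \<bar>D v\<bar> \<le> K * sqrt (lm d z v v))"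
    proof (cases "chart_inv d z \<in> fst c")
      case True
      have zt: "z \<in> trdom d c"
        using True z chart_inverse[OF d] by (intro image_eqI[of _ _ "chart_inv d z"]) auto
      have "(\<beta> \<circ> tr d c has_derivative D\<beta> (tr d c z) \<circ> dir_deriv (tr d c) z) (at z)"
        by (intro diff_chain_at has_derivative_dir_deriv smooth_onD(2)[OF Ch.T_smooth zt] d\<beta>)
      then have "(h \<circ> chart_inv d has_derivative D\<beta> (tr d c z) \<circ> dir_deriv (tr d c) z) (at z)"
        by (rule has_derivative_transform_within_open[OF _ Ch.open_D zt])
           (auto simp: h_def chart_inverse[OF d])
      moreover have "\<bar>(D\<beta> (tr d c z) \<circ> dir_deriv (tr d c) z) v\<bar> \<le> K * sqrt (lm d z v v)" for v
        unfolding Ch.isometry[OF zt] o_def[of "D\<beta> _"] by (rule bd) (use Ch.T_im zt in blast)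
      ultimately show ?thesis by blast
    next
      case False
      \<comment> \<open>The image of the ball is compact, hence closed in a Hausdorff space. Its
        complement is an open set on which \<open>h\<close> vanishes and which contains all points
        outside the chart.\<close>
      define N where "N = - (chart_inv c ` cball y0 \<rho>)"
      have "compact (chart_inv c ` cball y0 \<rho>)"
        by (intro compact_continuous_image continuous_on_subset[OF chart_continuous(2)[OF c(1)] ball_sub] compact_cball)
      then have N: "open N" unfolding N_def using compact_imp_closed by blast
      have hN: "h \<mu> = 0" if "\<mu> \<in> N" for \<mu>
      proof (cases "\<mu> \<in> fst c")
        case True
        then have "snd c \<mu> \<notin> cball y0 \<rho>" using that chart_inverse(1)[OF c(1) True] unfolding N_def
          by (metis ComplD image_eqI)
        then show ?thesis using outside by (simp add: h_def \<beta>_def)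
      qed (simp add: h_def)
      have zN: "chart_inv d z \<in> N" using False ball_sub chart_inverse(3)[OF c(1)] unfolding N_def by auto
      then have z': "z \<in> snd d ` (fst d \<inter> N)"
        using z chart_inverse[OF d] by (intro image_eqI[of _ _ "chart_inv d z"]) auto
      have "((\<lambda>y. 0) has_derivative (\<lambda>v. 0::real)) (at z)" by simp
      then have "(h \<circ> chart_inv d has_derivative (\<lambda>v. 0)) (at z)"
        by (rule has_derivative_transform_within_open[OF _ open_chart_image[OF d N] z'])
           (auto simp: hN chart_inverse[OF d])
      then show ?thesis using K Ch.P.G_nonneg[OF z] by (intro exI[of _ "\<lambda>v. 0"]) auto
    qed
  qed
  define \<sigma> where "\<sigma> = (\<lambda>s. ?x + s *\<^sub>R w)"
  define r where "r = riem_dist A g p"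
  have \<sigma>in: "\<sigma> s \<in> cdom c" if "\<bar>s\<bar> \<le> 1" for s
  proof -
    have "\<bar>s\<bar> * norm w \<le> 1 * \<rho>0" using that w \<rho>0(1) by (intro mult_mono) auto
    then have "\<sigma> s \<in> cball ?x \<rho>0" by (simp add: \<sigma>_def dist_norm)
    then show ?thesis using \<rho>0(2) by blast
  qed
  \<comment> \<open>Every curve from \<open>p\<close> to the point is at least as long as the change
    of \<open>h\<close> divided by \<open>K\<close>, and the infimum inherits the bound; the
    coordinate segment shows that there are such curves.\<close>
  have low: "\<bar>\<beta> (\<sigma> s) - \<beta> ?x\<bar> \<le> K * r (chart_inv c (\<sigma> s))" if s: "\<bar>s\<bar> \<le> 1" for s
  proof -
    have "C1_curve A (\<lambda>t. chart_inv c (?x + t *\<^sub>R (s *\<^sub>R w))) 0 1"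
    proof (rule C1_curve_chart[OF c(1), where ?u1.0 = "\<lambda>t. s *\<^sub>R w"])
      show "?x + t *\<^sub>R s *\<^sub>R w \<in> cdom c" if "t \<in> {0..1}" for t
        using \<sigma>in[of "t * s"] that s mult_mono[of "\<bar>t\<bar>" 1 "\<bar>s\<bar>" 1] by (simp add: \<sigma>_def abs_mult)
      show "((\<lambda>t. ?x + t *\<^sub>R s *\<^sub>R w) has_vector_derivative s *\<^sub>R w) (at t within {0..1})" for t
        unfolding has_vector_derivative_def by (auto intro!: derivative_eq_intros)
    qed simp
    then have pw: "piecewise_C1_curve A (\<lambda>t. chart_inv c (?x + t *\<^sub>R (s *\<^sub>R w))) 0 1"
      unfolding piecewise_C1_curve_def by (intro exI[of _ "\<lambda>i. real i"] exI[of _ 1]) auto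
    have "\<bar>\<beta> (\<sigma> s) - \<beta> ?x\<bar> / K \<le> r (chart_inv c (\<sigma> s))"
      unfolding r_def riem_dist_def
    proof (rule cInf_greatest)
      show "{curve_length A g \<eta> 0 1 |\<eta>. piecewise_C1_curve A \<eta> 0 1 \<and> \<eta> 0 = p \<and> \<eta> 1 = chart_inv c (\<sigma> s)} \<noteq> {}"
        using pw chart_inverse(1)[OF c] by (auto simp: \<sigma>_def intro!: exI[of _ "\<lambda>t. chart_inv c (?x + t *\<^sub>R (s *\<^sub>R w))"])
      fix L assume "L \<in> {curve_length A g \<eta> 0 1 |\<eta>. piecewise_C1_curve A \<eta> 0 1 \<and> \<eta> 0 = p \<and> \<eta> 1 = chart_inv c (\<sigma> s)}"
      then obtain \<eta> where \<eta>: "L = curve_length A g \<eta> 0 1" "piecewise_C1_curve A \<eta> 0 1" "\<eta> 0 = p" "\<eta> 1 = chart_inv c (\<sigma> s)" by blast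
      have "\<bar>h (\<eta> 1) - h (\<eta> 0)\<bar> \<le> K * L"
        using piecewise_C1_curve_length(3)[OF \<eta>(2) lip] by (simp add: \<eta>(1) curve_length_def)
      moreover have "h (\<eta> 1) = \<beta> (\<sigma> s)" "h (\<eta> 0) = \<beta> ?x"
        using \<eta>(3,4) c chart_inverse[OF c(1)] \<sigma>in[OF s] by (auto simp: h_def)
      ultimately show "\<bar>\<beta> (\<sigma> s) - \<beta> ?x\<bar> / K \<le> L" using K by (simp add: field_simps)
    qed
    then show ?thesis using K by (simp add: field_simps)
  qed
  have r_diff: "(r \<circ> chart_inv c) differentiable (at ?x)"
    using smooth_at_differentiable[OF c sp] by (simp add: r_def)
  have d\<sigma>: "(\<sigma> has_vector_derivative w) (at 0)" unfolding \<sigma>_def has_vector_derivative_def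
    by (auto intro!: derivative_eq_intros)
  have \<sigma>0: "\<sigma> 0 = ?x" by (simp add: \<sigma>_def)
  define a where "a = dir_deriv (r \<circ> chart_inv c) ?x w"
  have dr: "((\<lambda>s. r (chart_inv c (\<sigma> s))) has_real_derivative a) (at 0)"
    using has_vector_derivative_chain_dir_deriv[of "r \<circ> chart_inv c" \<sigma> 0 w UNIV] r_diff d\<sigma>
    unfolding has_real_derivative_iff_has_vector_derivative by (simp add: \<sigma>0 a_def)
  have "dir_deriv \<beta> ?x = D\<beta> ?x" by (rule dir_deriv_eqI[OF d\<beta>])
  then have db: "((\<lambda>s. \<beta> (\<sigma> s)) has_real_derivative D\<beta> ?x w) (at 0)"
    using has_vector_derivative_chain_dir_deriv[of \<beta> \<sigma> 0 w UNIV] d\<beta>[of ?x] d\<sigma>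
    unfolding has_real_derivative_iff_has_vector_derivative by (auto simp: \<sigma>0 differentiable_def)
  have rp: "r (chart_inv c (\<sigma> 0)) = 0" using p0 by (simp add: \<sigma>0 r_def chart_inverse[OF c(1)] c(2))
  \<comment> \<open>\<open>low\<close> makes \<open>r\<close> nonnegative along
    \<open>\<sigma>\<close>, and it is 0 at \<open>s = 0\<close>.\<close>
  have "a = 0"
  proof (rule DERIV_local_min[OF dr])
    show "\<forall>s. \<bar>0 - s\<bar> < 1 \<longrightarrow> r (chart_inv c (\<sigma> 0)) \<le> r (chart_inv c (\<sigma> s))"
    proof (intro allI impI)
      fix s :: real assume "\<bar>0 - s\<bar> < 1"
      then have "0 \<le> K * r (chart_inv c (\<sigma> s))" using low[of s] by (intro order_trans[OF abs_ge_zero]) auto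
      then show "r (chart_inv c (\<sigma> 0)) \<le> r (chart_inv c (\<sigma> s))" using K rp by (simp add: zero_le_mult_iff)
    qed
  qed simp
  \<comment> \<open>By \<open>low\<close> the difference \<open>K r - \<beta>\<close> is minimal at
    0 too, so the slope of the bump would have to vanish; yet it is a nonzero multiple of
    \<open>w \<bullet> w\<close> because \<open>\<theta> ?x\<close> is positive.\<close>
  have "K * a - D\<beta> ?x w = 0"
  proof (rule DERIV_local_min)
    show "((\<lambda>s. K * r (chart_inv c (\<sigma> s)) - \<beta> (\<sigma> s)) has_real_derivative K * a - D\<beta> ?x w) (at 0)"
      by (intro DERIV_diff DERIV_cmult dr db)
    show "\<forall>s. \<bar>0 - s\<bar> < 1 \<longrightarrow> K * r (chart_inv c (\<sigma> 0)) - \<beta> (\<sigma> 0) \<le> K * r (chart_inv c (\<sigma> s)) - \<beta> (\<sigma> s)"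
    proof (intro allI impI)
      fix s :: real assume "\<bar>0 - s\<bar> < 1"
      then show "K * r (chart_inv c (\<sigma> 0)) - \<beta> (\<sigma> 0) \<le> K * r (chart_inv c (\<sigma> s)) - \<beta> (\<sigma> s)"
        using low[of s] rp by (simp add: \<sigma>0)
    qed
  qed simp
  then have "D\<beta> ?x w = 0" using \<open>a = 0\<close> by simp
  moreover have "w \<bullet> w > 0" using w \<rho>0 by auto
  moreover have "\<theta> ?x = 3 * (w \<bullet> w)" by (simp add: \<theta>_def y0_def \<rho>_def power2_norm_eq_inner power_mult_distrib)
  ultimately show False by (simp add: D\<beta>_def y0_def)
qed

end

section \<open>The optimal test function and the conclusion\<close>

theorem theorem3p2:
  fixes A :: "('a::{t2_space,second_countable_topology}, 'e::euclidean_space) chart set"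
    and g :: "'a metric"
    and f :: "'a \<Rightarrow> real"
    and p q :: 'a
    and r v :: "'a \<Rightarrow> real"
    and \<gamma> :: "real \<Rightarrow> 'a"
    and c :: "('a, 'e) chart"
    and n :: nat
  assumes "complete_riemannian_manifold A g"
    and "n = DIM('e)" and "n \<ge> 2"
    and "smooth_fun_on A UNIV f"
    and "CD_0_1 A g f"
    and "r = riem_dist A g p"
    and "smooth_at A r q"
    and "unit_speed_minimal_geodesic A g \<gamma> (r q)" and "\<gamma> 0 = p" and "\<gamma> (r q) = q"
    and "v = (\<lambda>m. exp (f m / (real n - 1)))"
    and "c \<in> A" and "q \<in> fst c"
  shows "weighted_laplacian A g f c r (snd c q)
           \<le> (real n - 1) / ((v q)\<^sup>2 * integral {0..r q} (\<lambda>t. 1 / (v (\<gamma> t))\<^sup>2))"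
proof -
  interpret riemannian_atlas A g
    by standard (use assms(1) in \<open>simp add: complete_riemannian_manifold_def\<close>)
  define l where "l = r q"
  have \<gamma>l: "\<gamma> l = q" using assms(10) by (simp add: l_def)
  obtain \<alpha> \<beta> where \<alpha>\<beta>: "\<alpha> < 0" "l < \<beta>" "geodesic_on A g {\<alpha><..<\<beta>} \<gamma>"
    and unit: "\<And>t. t \<in> {0..l} \<Longrightarrow> speed A g \<gamma> t = 1"
    and len: "curve_length A g \<gamma> 0 l = riem_dist A g (\<gamma> 0) (\<gamma> l)"
    using assms(8) unfolding unit_speed_minimal_geodesic_def l_def by blast
  have len': "curve_length A g \<gamma> 0 l = l" using len assms(6,9) \<gamma>l by (simp add: l_def)
  \<comment> \<open>For \<open>l \<le> 0\<close> the length over \<open>{0..l}\<close> is 0, hence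
    \<open>l = 0\<close> and \<open>q = p\<close>, where the distance is not smooth.\<close>
  have "l > 0"
  proof (rule ccontr)
    assume "\<not> l > 0"
    moreover then have "curve_length A g \<gamma> 0 l = 0" unfolding curve_length_def by (cases "l = 0") auto
    ultimately have "l = 0" using len' by simp
    then have "p = q" "riem_dist A g p p = 0" using \<gamma>l assms(6,9) by (auto simp: l_def)
    then show False using riem_dist_not_smooth[of p] assms(6,7) by simp
  qed
  interpret geodesic_segment A g \<gamma> \<alpha> \<beta> l p f
    by standard (use \<alpha>\<beta> unit assms(4,9) \<open>l > 0\<close> in auto)
  define N where "N = real DIM('e) - 1"
  have N: "N > 0" "real n - 1 = N" using assms(2,3) by (auto simp: N_def)
  define V where "V = (\<lambda>t. exp (F t / N))"
  have V: "V t > 0" for t by (simp add: V_def)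
  have vV: "v (\<gamma> t) = V t" for t using assms(11) N(2) by (simp add: V_def F_def)
  define S where "S = (\<lambda>t. integral {0..t} (\<lambda>s. 1 / (V s)\<^sup>2))"
  have dF: "(F has_real_derivative F1 t) (at t within {0..l})" "(F1 has_real_derivative F2 t) (at t within {0..l})"
    if "t \<in> {0..l}" for t
    using ex_chart_Jc[of t] sub_J that F_derivatives(1,3) by (blast intro: has_field_derivative_at_within)+
  have cF: "continuous_on {0..l} F" "continuous_on {0..l} F1"
    by (rule DERIV_continuous_on[OF dF(1)], assumption, rule DERIV_continuous_on[OF dF(2)], assumption)
  have cV: "continuous_on {0..l} V" unfolding V_def using N by (intro continuous_intros cF) auto
  have ci: "continuous_on {0..l} (\<lambda>s. 1 / (V s)\<^sup>2)" using V by (intro continuous_intros cV) (simp add: less_imp_neq[OF V, symmetric])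
  have dS: "(S has_real_derivative 1 / (V t)\<^sup>2) (at t within {0..l})" if "t \<in> {0..l}" for t
    unfolding S_def has_real_derivative_iff_has_vector_derivative
    by (rule integral_has_vector_derivative[OF ci that])
  have cS: "continuous_on {0..l} S" by (rule DERIV_continuous_on[OF dS])
  have dV: "(V has_real_derivative V t * (F1 t / N)) (at t within {0..l})" if "t \<in> {0..l}" for t
    unfolding V_def using dF(1)[OF that] N by (auto intro!: derivative_eq_intros)
  have Sl: "S l > 0"
  proof -
    have "S l \<noteq> 0"
    proof
      assume "S l = 0"
      then have "1 / (V l)\<^sup>2 = 0"
        using integral_eq_0_iff[OF ci \<open>0 < l\<close>] V \<open>0 < l\<close> unfolding S_def by force
      then show False using V[of l] by simp
    qed
    moreover have "S l \<ge> 0" unfolding S_def using V by (intro integral_nonneg integrable_continuous_real ci) auto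
    ultimately show ?thesis by simp
  qed
  \<comment> \<open>The normalisation that gives \<open>\<phi> l = 1\<close>.\<close>
  define C where "C = 1 / (V l * S l)"
  define \<phi> where "\<phi> = (\<lambda>t. C * (V t * S t))"
  \<comment> \<open>The product rule with \<open>V' = V * F1 / N\<close> and
    \<open>S' = 1 / V\<^sup>2\<close>.\<close>
  define \<phi>1 where "\<phi>1 = (\<lambda>t. \<phi> t * F1 t / N + C / V t)"
  \<comment> \<open>The antiderivative of the index integrand for this \<open>\<phi>\<close>; it
    vanishes at 0 because \<open>S 0 = 0\<close>.\<close>
  define H where "H = (\<lambda>t. (\<phi> t)\<^sup>2 * F1 t + N * C\<^sup>2 * S t)"
  have d\<phi>: "(\<phi> has_real_derivative \<phi>1 t) (at t within {0..l})" if "t \<in> {0..l}" for t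
  proof -
    have "(\<phi> has_real_derivative C * (V t * (F1 t / N) * S t + 1 / (V t)\<^sup>2 * V t)) (at t within {0..l})"
      unfolding \<phi>_def by (intro DERIV_cmult DERIV_mult dV dS that)
    then show ?thesis using V[of t] N by (simp add: \<phi>1_def \<phi>_def field_simps power2_eq_square)
  qed
  obtain b0 :: 'e where b0: "b0 \<in> Basis" using nonempty_Basis by blast
  interpret index_form_bound A g \<gamma> \<alpha> \<beta> l p f \<phi> \<phi>1 H b0
  proof
    show "CD_0_1 A g f" by fact
    show "b0 \<in> Basis" by fact
    show "(\<phi> has_real_derivative \<phi>1 t) (at t within {0..l})" if "t \<in> {0..l}" for t by (rule d\<phi>[OF that])
    show "continuous_on {0..l} \<phi>1" unfolding \<phi>1_def \<phi>_def
      using V N by (intro continuous_intros cV cS cF) (auto simp: less_imp_neq[OF V, symmetric])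
    show "\<phi> 0 = 0" by (simp add: \<phi>_def S_def)
    show "H 0 = 0" by (simp add: H_def \<phi>_def S_def)
    fix t assume t: "t \<in> {0..l}"
    have "(H has_real_derivative (2 * \<phi> t * \<phi>1 t) * F1 t + F2 t * (\<phi> t)\<^sup>2 + N * C\<^sup>2 * (1 / (V t)\<^sup>2)) (at t within {0..l})"
      unfolding H_def using d\<phi>[OF t] dF(2)[OF t] dS[OF t]
      by (intro DERIV_add DERIV_mult DERIV_cmult) (auto intro!: derivative_eq_intros)
    \<comment> \<open>Both sides expand to \<open>2 \<phi>\<^sup>2 F1\<^sup>2 / N + 2 C \<phi> F1 /
      V + N C\<^sup>2 / V\<^sup>2 + \<phi>\<^sup>2 F2\<close>.\<close>
    moreover have "(2 * \<phi> t * \<phi>1 t) * F1 t + F2 t * (\<phi> t)\<^sup>2 + N * C\<^sup>2 * (1 / (V t)\<^sup>2)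
       = N * (\<phi>1 t)\<^sup>2 + (\<phi> t)\<^sup>2 * (F2 t + (F1 t)\<^sup>2 / N)"
      unfolding \<phi>1_def using V[of t] N by (simp add: field_simps power2_eq_square)
    ultimately show "(H has_real_derivative (real DIM('e) - 1) * (\<phi>1 t)\<^sup>2 + (\<phi> t)\<^sup>2 * (F2 t + (F1 t)\<^sup>2 / (real DIM('e) - 1))) (at t within {0..l})"
      by (simp add: N_def)
  qed
  have "l \<in> Jc c" using assms(13) \<alpha> \<beta> \<open>l > 0\<close> by (simp add: Jc_def \<gamma>l)
  have \<phi>l: "\<phi> l = 1" using V[of l] Sl by (simp add: \<phi>_def C_def)
  have "weighted_laplacian A g f c r (u c l) \<le> H l - F1 l"
    using reach_dist assms(6,7) \<gamma>l
    by (intro weighted_laplacian_bound[OF \<open>0 < l\<close> assms(12) \<open>l \<in> Jc c\<close> _ _ _ \<phi>l]) (auto simp: l_def)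
  \<comment> \<open>The boundary term of \<open>H\<close> at \<open>l\<close> cancels the drift
    term, since \<open>\<phi> l = 1\<close>.\<close>
  also have "H l - F1 l = N * C\<^sup>2 * S l" by (simp add: H_def \<phi>l)
  also have "\<dots> = N / ((V l)\<^sup>2 * S l)" using V[of l] Sl by (simp add: C_def field_simps power2_eq_square)
  finally show ?thesis unfolding S_def N(2) vV[symmetric] \<gamma>l unfolding l_def .
qed

end
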